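(* For every positive integer $t$ and every positive integer $n$, every graph on $n$ vertices that contains no subdivision of $K_t$ has at most $2^{50t} n$ cliques.
   Context: Graphs are finite and simple. A clique is a set of pairwise adjacent vertices; the empty set counts as a clique. A $K_t$-subdivision in a graph $G$ is a subgraph of $G$ obtained from a copy of the complete graph $K_t$ by replacing its edges with internally vertex-disjoint paths. *)

theory Defs
  imports "Graph_Theory.Graph_Theory"
begin

text \<open>
  Finite simple graphs are represented by \<^locale>\<open>pair_graph\<close>: finite, loop-free, symmetric
  digraphs whose arcs are ordered pairs of vertices, so that an undirected edge \<open>uv\<close> is the pair
  of arcs \<open>(u, v)\<close> and \<open>(v, u)\<close>.
\<close>

definition cliques :: "'a pair_pre_digraph \<Rightarrow> 'a set set" where
  "cliques G = {C. C \<subseteq> pverts G \<and> (\<forall>u\<in>C. \<forall>v\<in>C. u \<noteq> v \<longrightarrow> (u, v) \<in> parcs G)}"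

text \<open>
  The relation \<^const>\<open>subdivision\<close> requires the graph and its subdivision to share the type of
  arcs and the tail and head functions. With ordered pairs as arcs every \<open>K\<^sub>t\<close> on vertices of
  \<open>H\<close> is available; over an arbitrary arc type it might not exist.
  Replacing an edge by a path is the same as inserting the inner vertices of the path one after
  another, which is how \<^const>\<open>subdivision\<close> is generated.
\<close>

definition contains_complete_subdivision :: "nat \<Rightarrow> 'a pair_pre_digraph \<Rightarrow> bool" where
  "contains_complete_subdivision t G \<longleftrightarrow>
     (\<exists>K H :: 'a pair_pre_digraph.
        complete_digraph t (with_proj K) \<and>
        subdivision_pair K H \<and>
        subgraph (with_proj H) (with_proj G))"

end

theory Submission
  imports Defs Complex_Main
begin

text \<open>
  A graph all of whose vertices have degree at least \<open>198 t\<^sup>2\<close> contains a subdivision of \<open>K\<^sub>t\<close>: by Mader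
  it has a dense subgraph that is \<open>t\<^sup>2\<close>-connected, and a minor of this subgraph which is minimal
  for its density yields a small minor that stays connected, with short paths, after the deletion of
  \<open>8 t\<^sup>2\<close> vertices; together with the connectivity such a minor links any prescribed pairs of neighbours
  of \<open>t\<close> branch vertices by disjoint connected sets. Hence a graph without a subdivision of \<open>K\<^sub>t\<close> is
  \<open>198 t\<^sup>2\<close>-degenerate, and it suffices to bound the number of cliques in a graph on \<open>m \<le> 198 t\<^sup>2\<close> vertices.
  If every vertex of such a graph with \<open>m \<ge> 8 t\<close> has at most \<open>r = min (m / 8) (m\<^sup>2 / (2 t\<^sup>2))\<close> non-neighbours, then
  a set of \<open>t\<close> vertices with few non-edges and distinct common neighbours of its non-adjacent pairs form a
  subdivision of \<open>K\<^sub>t\<close>. So some vertex \<open>v\<close> has more than \<open>r\<close> non-neighbours, and putting \<open>v\<close> into the clique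
  leaves at most \<open>m - r\<close> candidates; solving this recursion gives \<open>2\<^bsup>O(t)\<^esup>\<close> cliques.
\<close>

section \<open>Connected sets, separations and contractions\<close>

text \<open>Degeneracy alone is not enough: cliques have fewer than t vertices, and choosing them
  from neighbourhoods of size \<open>198 t^2\<close> gives about (198 t^2 + 1)^t n = 2^(O(t log t))
  n of them. The recursion inside the neighbourhoods removes the logarithm, since a subdivision,
  unlike a clique, can repair a missing pair by a path through a common neighbour. A dense minor by
  itself gives no subdivision, because a connected branch set need not contain a vertex of large
  degree. Therefore the branch vertices are fixed in the host graph first, each ordered pair of them
  receives a private neighbour as a terminal, and the minor serves only to route between terminals.
  Connected sets replace paths until the very end: preimages of connected sets under a contraction
  are connected, and so is the union of the branch sets along a connected set of the minor. Only the
  construction of the subdivision itself extracts a path from each connected set.\<close>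

definition sgraph :: "'a set \<Rightarrow> 'a rel \<Rightarrow> bool" where
  "sgraph V E \<longleftrightarrow> finite V \<and> E \<subseteq> V \<times> V \<and> sym E \<and> irrefl E"

text \<open>The empty set counts as connected, so nonemptiness is demanded separately where it
  matters, as in \<open>model\<close>.\<close>

definition conn :: "'a rel \<Rightarrow> 'a set \<Rightarrow> bool" where
  "conn E S \<longleftrightarrow> (\<forall>x\<in>S. \<forall>y\<in>S. (x, y) \<in> (E \<inter> S \<times> S)\<^sup>*)"

text \<open>The separator is \<open>X \<inter> Y\<close> and its size is the order of the
  separation; either side may exhaust \<open>V\<close>. For a symmetric \<open>E\<close> one
  orientation of the crossing arcs is enough.\<close>

definition sep :: "'a set \<Rightarrow> 'a rel \<Rightarrow> 'a set \<Rightarrow> 'a set \<Rightarrow> bool" where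
  "sep V E X Y \<longleftrightarrow> X \<union> Y = V \<and> E \<inter> (X - Y) \<times> (Y - X) = {}"

lemma sgraph_finite_E: "sgraph V E \<Longrightarrow> finite E"
  unfolding sgraph_def by (meson finite_SigmaI finite_subset)

lemma sgraph_sym: "sgraph V E \<Longrightarrow> (a, b) \<in> E \<Longrightarrow> (b, a) \<in> E"
  unfolding sgraph_def by (meson symD)

lemma sgraph_irrefl: "sgraph V E \<Longrightarrow> (a, a) \<notin> E"
  unfolding sgraph_def irrefl_def by blast

lemma sgraph_in: "sgraph V E \<Longrightarrow> (a, b) \<in> E \<Longrightarrow> a \<in> V \<and> b \<in> V"
  unfolding sgraph_def by blast

lemma sgraph_induced: "sgraph V E \<Longrightarrow> W \<subseteq> V \<Longrightarrow> sgraph W (E \<inter> W \<times> W)"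
  unfolding sgraph_def sym_def irrefl_def by (auto intro: finite_subset)

lemma conn_mono:
  assumes "conn E S" "E \<inter> S \<times> S \<subseteq> E'"
  shows "conn E' S"
proof -
  have "(E \<inter> S \<times> S)\<^sup>* \<subseteq> (E' \<inter> S \<times> S)\<^sup>*" using assms(2) by (intro rtrancl_mono) auto
  with assms(1) show ?thesis unfolding conn_def by blast
qed

lemma conn_sing [simp]: "conn E {x}"
  unfolding conn_def by auto

lemma conn_Un:
  assumes "conn E A" "conn E B" "A \<inter> B \<noteq> {}"
  shows "conn E (A \<union> B)"
proof -
  obtain c where c: "c \<in> A" "c \<in> B" using assms(3) by auto
  let ?R = "(E \<inter> (A \<union> B) \<times> (A \<union> B))\<^sup>*"
  have "(E \<inter> A \<times> A)\<^sup>* \<subseteq> ?R" "(E \<inter> B \<times> B)\<^sup>* \<subseteq> ?R" by (auto intro!: rtrancl_mono)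
  then have "(x, c) \<in> ?R \<and> (c, x) \<in> ?R" if "x \<in> A \<union> B" for x
    using that c assms(1,2) unfolding conn_def by blast
  then show ?thesis unfolding conn_def by (meson rtrancl_trans)
qed

lemma conn_pair:
  assumes "(a, b) \<in> E" "sym E"
  shows "conn E {a, b}"
proof -
  have "(b, a) \<in> E" using assms by (meson symD)
  with assms(1) show ?thesis unfolding conn_def by (auto intro!: r_into_rtrancl)
qed

lemma conn_Un_edge:
  assumes "conn E A" "conn E B" "(a, b) \<in> E" "a \<in> A" "b \<in> B" "sym E"
  shows "conn E (A \<union> B)"
proof -
  have "conn E (A \<union> {a, b})" using assms by (intro conn_Un conn_pair) auto
  moreover have "(A \<union> {a, b}) \<inter> B \<noteq> {}" using assms by auto
  ultimately have "conn E ((A \<union> {a, b}) \<union> B)" by (rule conn_Un[OF _ assms(2)])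
  moreover have "(A \<union> {a, b}) \<union> B = A \<union> B" using assms by auto
  ultimately show ?thesis by simp
qed

lemma conn_insert:
  assumes "conn E A" "(a, b) \<in> E" "a \<in> A" "sym E"
  shows "conn E (insert b A)"
  using conn_Un_edge[OF assms(1) conn_sing assms(2,3) _ assms(4)] by simp

text \<open>A walk in \<open>C\<close> lifts: each step becomes one edge between consecutive sets,
  and walks inside the sets join these edges. With branch sets for \<open>B h\<close> this carries
  connectivity from a minor to its host.\<close>

lemma conn_UN:
  assumes C: "conn HE C" and B: "\<And>h. h \<in> C \<Longrightarrow> conn E (B h)"
    and adj: "\<And>h h'. h \<in> C \<Longrightarrow> h' \<in> C \<Longrightarrow> (h, h') \<in> HE \<Longrightarrow> \<exists>a\<in>B h. \<exists>b\<in>B h'. (a, b) \<in> E"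
  shows "conn E (\<Union>h\<in>C. B h)"
proof -
  let ?U = "\<Union>h\<in>C. B h"
  let ?R = "E \<inter> ?U \<times> ?U"
  have inside: "(a, b) \<in> ?R\<^sup>*" if "h \<in> C" "a \<in> B h" "b \<in> B h" for a b h
  proof -
    have "(E \<inter> B h \<times> B h)\<^sup>* \<subseteq> ?R\<^sup>*" using that by (intro rtrancl_mono) auto
    then show ?thesis using B[OF that(1)] that unfolding conn_def by blast
  qed
  have "\<forall>y\<in>B h'. (x, y) \<in> ?R\<^sup>*"
    if "h \<in> C" "x \<in> B h" "(h, h') \<in> (HE \<inter> C \<times> C)\<^sup>*" for x h h'
    using that(3)
  proof (induction rule: rtrancl_induct)
    case base
    then show ?case using inside that by blast
  next
    case (step g g')
    then obtain a b where ab: "a \<in> B g" "b \<in> B g'" "(a, b) \<in> E" using adj by blast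
    then have "(a, b) \<in> ?R" using step by auto
    then show ?case using ab step inside by (metis IntD2 mem_Sigma_iff rtrancl.rtrancl_into_rtrancl rtrancl_trans)
  qed
  then show ?thesis using C unfolding conn_def by blast
qed

lemma conn_edge:
  assumes "conn E S" "a \<in> S \<inter> P" "b \<in> S - P"
  obtains u v where "u \<in> S \<inter> P" "v \<in> S - P" "(u, v) \<in> E"
proof -
  have "(a, b) \<in> (E \<inter> S \<times> S)\<^sup>*" using assms unfolding conn_def by auto
  then have "b \<in> P \<or> (\<exists>u\<in>S \<inter> P. \<exists>v\<in>S - P. (u, v) \<in> E)"
    by (induction rule: rtrancl_induct) (use assms in auto)
  with assms that show ?thesis by auto
qed

lemma not_conn_split:
  assumes "\<not> conn E S"
  obtains P where "P \<subseteq> S" "P \<noteq> {}" "S - P \<noteq> {}" "E \<inter> P \<times> (S - P) = {}"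
proof -
  obtain x y where xy: "x \<in> S" "y \<in> S" "(x, y) \<notin> (E \<inter> S \<times> S)\<^sup>*"
    using assms unfolding conn_def by auto
  let ?P = "{z\<in>S. (x, z) \<in> (E \<inter> S \<times> S)\<^sup>*}"
  show ?thesis
  proof (rule that[of ?P])
    show "E \<inter> ?P \<times> (S - ?P) = {}" by (auto intro: rtrancl.rtrancl_into_rtrancl)
  qed (use xy in auto)
qed

text \<open>A connected set that leaves \<open>Y - X\<close> has an edge out of it, and in a
  separation such an edge ends in \<open>X \<inter> Y\<close>.\<close>

lemma sep_conn_side:
  assumes "sep V E X Y" "conn E S" "S \<subseteq> V" "S \<inter> (X \<inter> Y) = {}" "S \<inter> (Y - X) \<noteq> {}" "sym E"
  shows "S \<subseteq> Y - X"
proof (rule ccontr)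
  assume "\<not> ?thesis"
  then obtain a b where "a \<in> S \<inter> (Y - X)" "b \<in> S - (Y - X)" using assms by blast
  with assms(2) obtain u v where "u \<in> S \<inter> (Y - X)" "v \<in> S - (Y - X)" "(u, v) \<in> E"
    by (rule conn_edge)
  moreover from this have "(v, u) \<in> E" using assms(6) by (meson symD)
  ultimately show False using assms unfolding sep_def by blast
qed

text \<open>The two corner separators together lie in the union of the given ones, and their
  intersection lies in the intersection; inclusion-exclusion on both sides gives the
  inequality.\<close>

lemma sep_submodular:
  assumes "finite V" "sep V E X Y" "sep V E X' Y'" "sym E"
  shows "sep V E (X \<union> X') (Y \<inter> Y')" "sep V E (X \<inter> X') (Y \<union> Y')"
    "card ((X \<union> X') \<inter> (Y \<inter> Y')) + card ((X \<inter> X') \<inter> (Y \<union> Y')) \<le> card (X \<inter> Y) + card (X' \<inter> Y')"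
proof -
  show "sep V E (X \<union> X') (Y \<inter> Y')" "sep V E (X \<inter> X') (Y \<union> Y')"
    using assms(2,3) unfolding sep_def by blast+
  let ?A = "(X \<union> X') \<inter> (Y \<inter> Y')" and ?B = "(X \<inter> X') \<inter> (Y \<union> Y')"
  have fin: "finite X" "finite Y" "finite X'" "finite Y'"
    using assms(1-3) unfolding sep_def by (auto intro: finite_subset)
  have "card ?A + card ?B = card (?A \<union> ?B) + card (?A \<inter> ?B)"
    using fin by (intro card_Un_Int) auto
  also have "\<dots> \<le> card ((X \<inter> Y) \<union> (X' \<inter> Y')) + card ((X \<inter> Y) \<inter> (X' \<inter> Y'))"
    using fin by (intro add_mono card_mono) auto
  also have "\<dots> = card (X \<inter> Y) + card (X' \<inter> Y')"
    using fin by (intro card_Un_Int[symmetric]) auto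
  finally show "card ?A + card ?B \<le> card (X \<inter> Y) + card (X' \<inter> Y')" .
qed

section \<open>Contraction of an edge\<close>

definition fold_at :: "'a \<Rightarrow> 'a \<Rightarrow> 'a \<Rightarrow> 'a" where
  "fold_at x y v = (if v = y then x else v)"

text \<open>The merged vertex keeps the name \<open>x\<close> and \<open>y\<close> leaves the vertex
  set. Contracted graphs thus stay on the same type, and inductions can contract repeatedly.\<close>

definition contr :: "'a \<Rightarrow> 'a \<Rightarrow> 'a rel \<Rightarrow> 'a rel" where
  "contr x y E = {(fold_at x y u, fold_at x y v) | u v. (u, v) \<in> E} - Id"

lemma contr_image: "contr x y E = map_prod (fold_at x y) (fold_at x y) ` E - Id"
  unfolding contr_def by force

lemma sgraph_contr:
  assumes "sgraph V E" "(x, y) \<in> E"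
  shows "sgraph (V - {y}) (contr x y E)"
proof -
  have "sym (contr x y E)"
  proof (rule symI)
    fix a b assume "(a, b) \<in> contr x y E"
    then obtain u v where "a = fold_at x y u" "b = fold_at x y v" "(u, v) \<in> E" "a \<noteq> b"
      unfolding contr_def by auto
    moreover from this have "(v, u) \<in> E" using sgraph_sym[OF assms(1)] by auto
    ultimately show "(b, a) \<in> contr x y E" unfolding contr_def by blast
  qed
  moreover have "irrefl (contr x y E)" unfolding contr_def irrefl_def by auto
  moreover have "contr x y E \<subseteq> (V - {y}) \<times> (V - {y})"
    using assms sgraph_irrefl[OF assms(1)] unfolding sgraph_def contr_def fold_at_def by (auto split: if_splits)
  ultimately show ?thesis using assms(1) unfolding sgraph_def by auto
qed

lemma card_contr_le: "finite E \<Longrightarrow> card (contr x y E) \<le> card E"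
  unfolding contr_image by (meson Diff_subset card_image_le card_mono finite_imageI le_trans)

lemma conn_contr_image:
  assumes "conn E S"
  shows "conn (contr x y E) (fold_at x y ` S)"
proof -
  let ?f = "fold_at x y" let ?R = "contr x y E \<inter> ?f ` S \<times> ?f ` S"
  have "(?f a, ?f b) \<in> ?R\<^sup>*" if "(a, b) \<in> (E \<inter> S \<times> S)\<^sup>*" for a b
    using that
  proof (induction rule: rtrancl_induct)
    case (step c d)
    have "?f c = ?f d \<or> (?f c, ?f d) \<in> ?R" using step(2) unfolding contr_def by auto
    then show ?case using step(3) by (metis rtrancl.rtrancl_into_rtrancl)
  qed auto
  then show ?thesis using assms unfolding conn_def by blast
qed

text \<open>A fibre of \<open>fold_at x y\<close> is empty, a single vertex or
  \<open>{x, y}\<close>, and the last one is connected by the contracted edge. Each edge of the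
  contraction lifts to an edge between the fibres of its ends.\<close>

lemma conn_contr_vimage:
  assumes "conn (contr x y E) S" "(x, y) \<in> E" "sym E"
  shows "conn E (fold_at x y -` S)"
proof -
  let ?f = "fold_at x y" let ?P = "?f -` S" let ?R = "E \<inter> ?P \<times> ?P"
  have yx: "(y, x) \<in> E" using assms by (meson symD)
  have fib: "(a, b) \<in> ?R\<^sup>*" if "?f a = ?f b" "?f a \<in> S" for a b
  proof -
    have "a = b \<or> (a, b) \<in> ?R"
      using that assms(2) yx unfolding fold_at_def by (auto split: if_splits)
    then show ?thesis by auto
  qed
  have "\<forall>b. ?f b = q \<longrightarrow> (a, b) \<in> ?R\<^sup>*" if "(?f a, q) \<in> (contr x y E \<inter> S \<times> S)\<^sup>*" "?f a \<in> S" for a q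
    using that(1)
  proof (induction rule: rtrancl_induct)
    case base
    then show ?case using fib that(2) by metis
  next
    case (step p q)
    from step(2) obtain c d where cd: "?f c = p" "?f d = q" "(c, d) \<in> E" "p \<in> S" "q \<in> S"
      unfolding contr_def by auto
    then have "(a, c) \<in> ?R\<^sup>*" using step(3) by blast
    moreover have "(c, d) \<in> ?R" using cd by auto
    ultimately have "(a, d) \<in> ?R\<^sup>*" by (rule rtrancl_into_rtrancl)
    then show ?case using fib cd by (metis rtrancl_trans)
  qed
  then show ?thesis using assms(1) unfolding conn_def by (metis vimageE)
qed

lemma sep_contr_vimage:
  assumes "sep (V - {y}) (contr x y E) X Y" "x \<in> V" "y \<in> V" "x \<noteq> y" "E \<subseteq> V \<times> V"
  shows "sep V E (fold_at x y -` X) (fold_at x y -` Y)"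
proof -
  have "fold_at x y -` X \<union> fold_at x y -` Y = fold_at x y -` (V - {y})"
    using assms unfolding sep_def by auto
  also have "\<dots> = V" using assms(2-4) unfolding fold_at_def by (auto split: if_splits)
  finally have U: "fold_at x y -` X \<union> fold_at x y -` Y = V" .
  have "(fold_at x y a, fold_at x y b) \<in> contr x y E"
    if "(a, b) \<in> E" "fold_at x y a \<noteq> fold_at x y b" for a b
    using that unfolding contr_def by blast
  moreover have no: "contr x y E \<inter> (X - Y) \<times> (Y - X) = {}" using assms(1) unfolding sep_def by auto
  ultimately have False if "(a, b) \<in> E" "fold_at x y a \<in> X - Y" "fold_at x y b \<in> Y - X" for a b
    using that by (metis DiffD1 DiffD2 IntI SigmaI empty_iff)
  then show ?thesis using U unfolding sep_def by auto
qed

text \<open>A separator pulled back from the contraction thus has one vertex more if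
  \<open>x\<close> lies in it, and the same size otherwise.\<close>

lemma fold_at_vimage:
  "y \<notin> S \<Longrightarrow> fold_at x y -` S = (if x \<in> S then insert y S else S)"
  unfolding fold_at_def by (auto split: if_splits)

text \<open>Disjoint sets that all meet \<open>S\<close>, as many as \<open>S\<close> has elements,
  leave exactly one element of \<open>S\<close> to each set; \<open>g\<close> names a set by this
  element.\<close>

lemma disjoint_transversal:
  assumes "finite S" "card D = card S" "disjoint D" "\<And>d. d \<in> D \<Longrightarrow> d \<inter> S \<noteq> {}" "finite D"
  obtains g where "bij_betw g S D" "\<And>s. s \<in> S \<Longrightarrow> g s \<inter> S = {s}"
proof -
  define r where "r d = (SOME s. s \<in> d \<inter> S)" for d
  have r: "r d \<in> d \<inter> S" if "d \<in> D" for d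
    unfolding r_def using assms(4)[OF that] by (metis some_in_eq)
  have inj: "inj_on r D"
    using assms(3) r unfolding disjoint_def inj_on_def by (metis IntD1 IntI emptyE)
  have "r ` D = S"
    using inj assms r by (intro card_subset_eq) (auto simp: card_image)
  then have bij: "bij_betw r D S" using inj unfolding bij_betw_def by simp
  let ?g = "the_inv_into D r"
  show thesis
  proof (rule that)
    show bg: "bij_betw ?g S D" using bij by (rule bij_betw_the_inv_into)
    fix s assume s: "s \<in> S"
    have gs: "?g s \<in> D" using bg s by (meson bij_betwE)
    have rg: "r (?g s') = s'" if "s' \<in> S" for s'
      using bij that by (simp add: f_the_inv_into_f_bij_betw)
    show "?g s \<inter> S = {s}"
    proof (intro equalityI subsetI)
      fix s' assume s': "s' \<in> ?g s \<inter> S"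
      have "?g s' \<in> D" using bg s' by (meson IntD2 bij_betwE)
      moreover have "s' \<in> ?g s'" using r[OF calculation] rg s' by auto
      ultimately have "?g s' = ?g s" using assms(3) gs s' unfolding disjoint_def by blast
      then show "s' \<in> {s}" using rg s s' by (metis IntD2 singletonI)
    next
      fix s' assume "s' \<in> {s}"
      then show "s' \<in> ?g s \<inter> S" using r[OF gs] rg s by auto
    qed
  qed
qed

text \<open>Menger's theorem, with connected sets in place of paths, so that preimages under a contraction
  are immediate.\<close>

theorem menger_connected:
  assumes "sgraph V E" "A \<subseteq> V" "B \<subseteq> V"
    and "\<And>X Y. sep V E X Y \<Longrightarrow> A \<subseteq> X \<Longrightarrow> B \<subseteq> Y \<Longrightarrow> p \<le> card (X \<inter> Y)"
  shows "\<exists>D. finite D \<and> card D = p \<and> disjoint D \<and> (\<forall>d\<in>D. d \<subseteq> V \<and> conn E d \<and> d \<inter> A \<noteq> {} \<and> d \<inter> B \<noteq> {})"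
  using assms
proof (induction "card V + card E" arbitrary: V E A B rule: less_induct)
  case less
  note sg = less.prems(1)
  have symE: "sym E" and finV: "finite V" and EV: "E \<subseteq> V \<times> V" using sg unfolding sgraph_def by auto
  have finE: "finite E" using sg by (rule sgraph_finite_E)
  show ?case
  proof (cases "E = {}")
    case True
    \<comment> \<open>Without edges this pair is a separation with separator
      \<open>A \<inter> B\<close>, so singletons already do.\<close>
    have "p \<le> card ((A \<union> (V - B)) \<inter> B)"
      using less.prems(2,3) True by (intro less.prems(4)) (auto simp: sep_def)
    moreover have "(A \<union> (V - B)) \<inter> B = A \<inter> B" by auto
    ultimately have "p \<le> card (A \<inter> B)" by simp
    then obtain S where S: "S \<subseteq> A \<inter> B" "card S = p" "finite S"
      by (meson obtain_subset_with_card_n)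
    have "finite ((\<lambda>x. {x}) ` S)" "card ((\<lambda>x. {x}) ` S) = p" "disjoint ((\<lambda>x. {x}) ` S)"
      using S by (auto simp: card_image disjoint_def)
    moreover have "\<forall>d\<in>(\<lambda>x. {x}) ` S. d \<subseteq> V \<and> conn E d \<and> d \<inter> A \<noteq> {} \<and> d \<inter> B \<noteq> {}"
      using S less.prems(2) by auto
    ultimately show ?thesis by blast
  next
    case False
    then obtain x y where xy: "(x, y) \<in> E" by auto
    have xV: "x \<in> V" "y \<in> V" "x \<noteq> y" using sgraph_in[OF sg xy] sgraph_irrefl[OF sg] xy by auto
    let ?f = "fold_at x y" let ?V = "V - {y}" let ?E = "contr x y E"
    show ?thesis
    \<comment> \<open>Either the contraction still satisfies the hypothesis and its connected sets
      are pulled back, or a separation of order below \<open>p\<close> in it pulls back to one of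
      order exactly \<open>p\<close> whose separator contains both \<open>x\<close> and
      \<open>y\<close>.\<close>
    proof (cases "\<exists>X Y. sep ?V ?E X Y \<and> ?f ` A \<subseteq> X \<and> ?f ` B \<subseteq> Y \<and> card (X \<inter> Y) < p")
      case False
      have "card ?V < card V" using finV xV by (meson card_Diff1_less)
      then have "card ?V + card ?E < card V + card E" using card_contr_le[OF finE, of x y] by linarith
      moreover have "?f ` A \<subseteq> ?V" "?f ` B \<subseteq> ?V" using less.prems(2,3) xV unfolding fold_at_def by auto
      ultimately obtain D where D: "finite D" "card D = p" "disjoint D"
        "\<forall>d\<in>D. d \<subseteq> ?V \<and> conn ?E d \<and> d \<inter> ?f ` A \<noteq> {} \<and> d \<inter> ?f ` B \<noteq> {}"
        using less.hyps[of ?V ?E "?f ` A" "?f ` B"] False sgraph_contr[OF sg xy] by (metis not_less)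
      let ?D = "(\<lambda>d. ?f -` d) ` D"
      have "?f -` d \<subseteq> V \<and> conn E (?f -` d) \<and> ?f -` d \<inter> A \<noteq> {} \<and> ?f -` d \<inter> B \<noteq> {}" if "d \<in> D" for d
      proof (intro conjI)
        have d: "d \<subseteq> ?V" "conn ?E d" "d \<inter> ?f ` A \<noteq> {}" "d \<inter> ?f ` B \<noteq> {}" using D(4) that by auto
        show "?f -` d \<subseteq> V" using d(1) xV unfolding fold_at_def by (auto split: if_splits)
        show "conn E (?f -` d)" using d(2) xy symE by (rule conn_contr_vimage)
        show "?f -` d \<inter> A \<noteq> {}" "?f -` d \<inter> B \<noteq> {}" using d(3,4) by auto
      qed
      moreover have "inj_on (\<lambda>d. ?f -` d) D"
      proof (rule inj_onI)
        fix d d' assume dd: "d \<in> D" "d' \<in> D" "?f -` d = ?f -` d'"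
        have "d \<inter> ?f ` A \<noteq> {}" using D(4) dd by auto
        then obtain a where "?f a \<in> d" by auto
        then have "?f a \<in> d'" using dd(3) by auto
        with \<open>?f a \<in> d\<close> show "d = d'" using D(3) dd unfolding disjoint_def by blast
      qed
      then have "card ?D = p" using D(2) by (simp add: card_image)
      moreover have "disjoint ?D"
      proof (rule disjointI)
        fix e e' assume "e \<in> ?D" "e' \<in> ?D" "e \<noteq> e'"
        then obtain d d' where d: "d \<in> D" "d' \<in> D" "e = ?f -` d" "e' = ?f -` d'" "d \<noteq> d'" by auto
        then have "d \<inter> d' = {}" using D(3) unfolding disjoint_def by auto
        then show "e \<inter> e' = {}" using d by auto
      qed
      moreover have "finite ?D" using D(1) by simp
      ultimately show ?thesis by (intro exI[of _ ?D]) auto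
    next
      case True
      then obtain X' Y' where XY': "sep ?V ?E X' Y'" "?f ` A \<subseteq> X'" "?f ` B \<subseteq> Y'" "card (X' \<inter> Y') < p"
        by auto
      define X where "X = ?f -` X'"
      define Y where "Y = ?f -` Y'"
      define S where "S = X \<inter> Y"
      have sXY: "sep V E X Y" unfolding X_def Y_def using XY'(1) xV EV by (intro sep_contr_vimage) auto
      have AX: "A \<subseteq> X" and BY: "B \<subseteq> Y" unfolding X_def Y_def using XY' by auto
      have pS: "p \<le> card S" unfolding S_def using less.prems(4) sXY AX BY by auto
      have finX': "finite (X' \<inter> Y')" using XY'(1) finV unfolding sep_def by (metis finite_Diff finite_Int finite_Un)
      have yXY: "y \<notin> X' \<inter> Y'" using XY'(1) unfolding sep_def by auto
      have S_eq: "S = ?f -` (X' \<inter> Y')" unfolding S_def X_def Y_def by auto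
      have xX': "x \<in> X' \<inter> Y'"
      proof (rule ccontr)
        assume "x \<notin> X' \<inter> Y'"
        then have "S = X' \<inter> Y'" using S_eq fold_at_vimage[OF yXY] by auto
        then show False using pS XY'(4) by simp
      qed
      then have S_ins: "S = insert y (X' \<inter> Y')" using S_eq fold_at_vimage[OF yXY] by auto
      have cardS: "card S = p" using pS XY'(4) S_ins finX' yXY by simp
      have finS: "finite S" using S_ins finX' by simp
      have xyS: "x \<in> S" "y \<in> S" using S_ins xX' by auto
      \<comment> \<open>The edge lies inside the separator, so leaving it out affects no separation
        that keeps \<open>S\<close> on one side. Its removal makes the measure drop even if one of
        the sides is all of \<open>V\<close>.\<close>
      let ?r = "{(x, y), (y, x)}"
      have XV: "X \<subseteq> V" "Y \<subseteq> V" using sXY unfolding sep_def by auto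
      have smaller: "card W + card (E \<inter> W \<times> W - ?r) < card V + card E" if "W \<subseteq> V" for W
      proof -
        have "E \<inter> W \<times> W - ?r \<subset> E" using xy by auto
        then have "card (E \<inter> W \<times> W - ?r) < card E" using finE by (rule psubset_card_mono[rotated])
        moreover have "card W \<le> card V" using that finV by (rule card_mono[rotated])
        ultimately show ?thesis by linarith
      qed
      have sgW: "sgraph W (E \<inter> W \<times> W - ?r)" if "W \<subseteq> V" for W
      proof -
        have "sym (E \<inter> W \<times> W - ?r)" using symE unfolding sym_def by blast
        then show ?thesis using sgraph_induced[OF sg that] unfolding sgraph_def irrefl_def by blast
      qed
      let ?EX = "E \<inter> X \<times> X - ?r" let ?EY = "E \<inter> Y \<times> Y - ?r"
      have noXY: "E \<inter> (X - Y) \<times> (Y - X) = {}" and XuY: "X \<union> Y = V" using sXY unfolding sep_def by auto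
      have "\<exists>D. finite D \<and> card D = p \<and> disjoint D \<and> (\<forall>d\<in>D. d \<subseteq> X \<and> conn ?EX d \<and> d \<inter> A \<noteq> {} \<and> d \<inter> S \<noteq> {})"
      proof (rule less.hyps[OF smaller[OF XV(1)] sgW[OF XV(1)] AX])
        show "S \<subseteq> X" unfolding S_def by simp
        fix P Q assume PQ: "sep X ?EX P Q" "A \<subseteq> P" "S \<subseteq> Q"
        have PX: "P \<union> Q = X" and no: "?EX \<inter> (P - Q) \<times> (Q - P) = {}" using PQ unfolding sep_def by auto
        \<comment> \<open>A separation of the side \<open>X\<close> that has \<open>S\<close> in its
          far part extends to \<open>V\<close> by adding \<open>Y\<close> to that part; the
          separator does not change.\<close>
        have "p \<le> card (P \<inter> (Q \<union> Y))"
        proof (rule less.prems(4))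
          have "P \<union> (Q \<union> Y) = V" using PX XuY by auto
          moreover have False if "(a, b) \<in> E" "a \<in> P" "a \<notin> Q" "a \<notin> Y" "b \<in> Q \<union> Y" "b \<notin> P" for a b
          proof -
            have "a \<in> X - Y" using that PX by auto
            then have "b \<in> X" using that noXY PX by auto
            then have "b \<in> Q - P" using that PX by auto
            moreover have "(a, b) \<notin> ?r" using xyS PQ(3) that by auto
            ultimately have "(a, b) \<in> ?EX \<inter> (P - Q) \<times> (Q - P)" using that PX by auto
            then show False using no by auto
          qed
          ultimately show "sep V E P (Q \<union> Y)" unfolding sep_def by auto
        qed (use PQ BY in auto)
        moreover have "P \<inter> (Q \<union> Y) = P \<inter> Q" using PX PQ(3) unfolding S_def by auto
        ultimately show "p \<le> card (P \<inter> Q)" by simp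
      qed
      then obtain D1 where D1: "finite D1" "card D1 = p" "disjoint D1"
        "\<And>d. d \<in> D1 \<Longrightarrow> d \<subseteq> X \<and> conn ?EX d \<and> d \<inter> A \<noteq> {} \<and> d \<inter> S \<noteq> {}" by auto
      have "\<exists>D. finite D \<and> card D = p \<and> disjoint D \<and> (\<forall>d\<in>D. d \<subseteq> Y \<and> conn ?EY d \<and> d \<inter> S \<noteq> {} \<and> d \<inter> B \<noteq> {})"
      proof (rule less.hyps[OF smaller[OF XV(2)] sgW[OF XV(2)]])
        show "S \<subseteq> Y" unfolding S_def by simp
        show "B \<subseteq> Y" by fact
        fix P Q assume PQ: "sep Y ?EY P Q" "S \<subseteq> P" "B \<subseteq> Q"
        have PX: "P \<union> Q = Y" and no: "?EY \<inter> (P - Q) \<times> (Q - P) = {}" using PQ unfolding sep_def by auto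
        have "p \<le> card ((P \<union> X) \<inter> Q)"
        proof (rule less.prems(4))
          have "(P \<union> X) \<union> Q = V" using PX XuY by auto
          moreover have False if "(a, b) \<in> E" "a \<in> P \<union> X" "a \<notin> Q" "b \<in> Q" "b \<notin> P" "b \<notin> X" for a b
          proof -
            have "b \<in> Y - X" using that PX by auto
            then have "a \<in> Y" using that noXY PX by auto
            then have "a \<in> P - Q" using that PX by auto
            moreover have "(a, b) \<notin> ?r" using xyS PQ(2) that by auto
            ultimately have "(a, b) \<in> ?EY \<inter> (P - Q) \<times> (Q - P)" using that PX by auto
            then show False using no by auto
          qed
          ultimately show "sep V E (P \<union> X) Q" unfolding sep_def by auto
        qed (use PQ AX in auto)
        moreover have "(P \<union> X) \<inter> Q = P \<inter> Q" using PX PQ(2) unfolding S_def by auto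
        ultimately show "p \<le> card (P \<inter> Q)" by simp
      qed
      then obtain D2 where D2: "finite D2" "card D2 = p" "disjoint D2"
        "\<And>d. d \<in> D2 \<Longrightarrow> d \<subseteq> Y \<and> conn ?EY d \<and> d \<inter> S \<noteq> {} \<and> d \<inter> B \<noteq> {}" by auto
      obtain g1 where g1: "bij_betw g1 S D1" "\<And>s. s \<in> S \<Longrightarrow> g1 s \<inter> S = {s}"
        using disjoint_transversal[of S D1] D1 finS cardS by metis
      obtain g2 where g2: "bij_betw g2 S D2" "\<And>s. s \<in> S \<Longrightarrow> g2 s \<inter> S = {s}"
        using disjoint_transversal[of S D2] D2 finS cardS by metis
      have m1: "g1 s \<in> D1" and m2: "g2 s \<in> D2" if "s \<in> S" for s
        using that g1(1) g2(1) by (auto simp: bij_betwE)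
      \<comment> \<open>The two sides share only \<open>S\<close>, and every set of either family
        meets \<open>S\<close> in one vertex, so gluing at \<open>s\<close> keeps the sets
        disjoint.\<close>
      let ?g = "\<lambda>s. g1 s \<union> g2 s"
      have disj: "?g s \<inter> ?g s' = {}" if "s \<in> S" "s' \<in> S" "s \<noteq> s'" for s s'
      proof -
        have "g1 s \<noteq> g1 s'" "g2 s \<noteq> g2 s'"
          using that g1(1) g2(1) unfolding bij_betw_def inj_on_def by blast+
        then have "g1 s \<inter> g1 s' = {}" "g2 s \<inter> g2 s' = {}"
          using m1 m2 that D1(3) D2(3) unfolding disjoint_def by blast+
        moreover have "g1 s \<inter> g2 s' \<subseteq> S" "g2 s \<inter> g1 s' \<subseteq> S"
          using D1(4)[OF m1] D2(4)[OF m2] that unfolding S_def by blast+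
        then have "g1 s \<inter> g2 s' \<subseteq> (g1 s \<inter> S) \<inter> (g2 s' \<inter> S)" "g2 s \<inter> g1 s' \<subseteq> (g2 s \<inter> S) \<inter> (g1 s' \<inter> S)"
          by auto
        then have "g1 s \<inter> g2 s' \<subseteq> {s} \<inter> {s'}" "g2 s \<inter> g1 s' \<subseteq> {s} \<inter> {s'}"
          unfolding g1(2)[OF that(1)] g1(2)[OF that(2)] g2(2)[OF that(1)] g2(2)[OF that(2)] by this+
        then have "g1 s \<inter> g2 s' = {}" "g2 s \<inter> g1 s' = {}" using that(3) by auto
        ultimately show ?thesis by auto
      qed
      have props: "?g s \<subseteq> V \<and> conn E (?g s) \<and> ?g s \<inter> A \<noteq> {} \<and> ?g s \<inter> B \<noteq> {}" if "s \<in> S" for s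
      proof (intro conjI)
        note d1 = D1(4)[OF m1[OF that]] and d2 = D2(4)[OF m2[OF that]]
        show "?g s \<subseteq> V" using d1 d2 XV by auto
        show "?g s \<inter> A \<noteq> {}" "?g s \<inter> B \<noteq> {}" using d1 d2 by auto
        have "conn E (g1 s)" "conn E (g2 s)" using d1 d2 by (auto elim!: conn_mono)
        moreover have "s \<in> g1 s \<inter> g2 s" using g1(2)[OF that] g2(2)[OF that] by auto
        ultimately show "conn E (?g s)" by (intro conn_Un) auto
      qed
      have "inj_on ?g S"
      proof (rule inj_onI, rule ccontr)
        fix s s' assume s: "s \<in> S" "s' \<in> S" "?g s = ?g s'" "s \<noteq> s'"
        then have "?g s = {}" using disj[of s s'] by auto
        then show False using props[OF s(1)] by auto
      qed
      then have "card (?g ` S) = p" using cardS by (simp add: card_image)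
      moreover have "disjoint (?g ` S)"
      proof (rule disjointI)
        fix e e' assume "e \<in> ?g ` S" "e' \<in> ?g ` S" "e \<noteq> e'"
        then obtain s s' where "s \<in> S" "s' \<in> S" "e = ?g s" "e' = ?g s'" "s \<noteq> s'" by auto
        then show "e \<inter> e' = {}" using disj by simp
      qed
      moreover have "finite (?g ` S)" using finS by simp
      ultimately show ?thesis using props by (intro exI[of _ "?g ` S"]) auto
    qed
  qed
qed

section \<open>Linkages through a robust minor\<close>

text \<open>\<open>B\<close> gives the branch sets of a minor. The minor has its own index type and
  stays fixed when the host is contracted; only the branch sets change.\<close>

definition model :: "'a set \<Rightarrow> 'a rel \<Rightarrow> 'b set \<Rightarrow> 'b rel \<Rightarrow> ('b \<Rightarrow> 'a set) \<Rightarrow> bool" where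
  "model V E I HE B \<longleftrightarrow>
     (\<forall>h\<in>I. B h \<subseteq> V \<and> B h \<noteq> {} \<and> conn E (B h)) \<and>
     (\<forall>h\<in>I. \<forall>h'\<in>I. h \<noteq> h' \<longrightarrow> B h \<inter> B h' = {}) \<and>
     (\<forall>h\<in>I. \<forall>h'\<in>I. (h, h') \<in> HE \<longrightarrow> (\<exists>a\<in>B h. \<exists>b\<in>B h'. (a, b) \<in> E))"

text \<open>The bound \<open>6\<close> is what two neighbourhoods of radius two give in a graph on at most \<open>2 D\<close>
  vertices with minimum degree close to \<open>D\<close>.\<close>

definition robust :: "'b set \<Rightarrow> 'b rel \<Rightarrow> nat \<Rightarrow> bool" where
  "robust I HE q \<longleftrightarrow> finite I \<and>
     (\<forall>R. R \<subseteq> I \<and> card R \<le> q \<longrightarrow>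
        (\<forall>a\<in>I - R. \<forall>b\<in>I - R. \<exists>C. C \<subseteq> I - R \<and> a \<in> C \<and> b \<in> C \<and> conn HE C \<and> card C \<le> 6))"

lemma robust_link:
  assumes "robust I HE q" "R \<subseteq> I" "card R \<le> q" "a \<in> I - R" "b \<in> I - R"
  obtains C where "C \<subseteq> I - R" "a \<in> C" "b \<in> C" "conn HE C" "card C \<le> 6"
  using assms unfolding robust_def by meson

lemma modelD:
  assumes "model V E I HE B" "h \<in> I"
  shows "B h \<subseteq> V" "B h \<noteq> {}" "conn E (B h)"
  using assms unfolding model_def by auto

lemma model_disjoint:
  assumes "model V E I HE B" "h \<in> I" "h' \<in> I" "v \<in> B h" "v \<in> B h'"
  shows "h = h'"
  using assms unfolding model_def by (metis IntI emptyE)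

lemma model_adj:
  assumes "model V E I HE B" "h \<in> I" "h' \<in> I" "(h, h') \<in> HE"
  shows "\<exists>a\<in>B h. \<exists>b\<in>B h'. (a, b) \<in> E"
  using assms unfolding model_def by blast

lemma model_conn_UN:
  assumes "model V E I HE B" "C \<subseteq> I" "conn HE C"
  shows "conn E (\<Union>h\<in>C. B h)"
  using assms(3)
proof (rule conn_UN)
  fix h assume "h \<in> C"
  then show "conn E (B h)" using assms(2) modelD[OF assms(1)] by blast
next
  fix h h' assume "h \<in> C" "h' \<in> C" "(h, h') \<in> HE"
  then show "\<exists>a\<in>B h. \<exists>b\<in>B h'. (a, b) \<in> E" using assms(2) model_adj[OF assms(1)] by blast
qed

text \<open>Disjoint branch sets that meet \<open>S\<close> own distinct elements of
  \<open>S\<close>. So a separator of order at most \<open>q\<close> spoils at most \<open>q\<close>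
  indices, which is what \<open>robust\<close> tolerates.\<close>

lemma model_hit_card:
  assumes "model V E I HE B" "finite S"
  shows "card {h\<in>I. B h \<inter> S \<noteq> {}} \<le> card S"
proof -
  let ?H = "{h\<in>I. B h \<inter> S \<noteq> {}}"
  define r where "r h = (SOME v. v \<in> B h \<inter> S)" for h
  have r: "r h \<in> B h \<inter> S" if "h \<in> ?H" for h
    unfolding r_def using that by (intro some_in_eq[THEN iffD2]) auto
  have "inj_on r ?H"
  proof (rule inj_onI)
    fix h h' assume h: "h \<in> ?H" "h' \<in> ?H" "r h = r h'"
    then have "r h \<in> B h" "r h \<in> B h'" using r by force+
    then show "h = h'" using model_disjoint[OF assms(1)] h by blast
  qed
  moreover have "r ` ?H \<subseteq> S" using r by auto
  ultimately show ?thesis using assms(2) by (metis card_inj_on_le)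
qed

text \<open>Robustness joins \<open>h1\<close> to \<open>h\<close> by indices whose branch sets
  avoid the separator, and their union is connected. Hence a small separation has all untouched
  branch sets on the same side.\<close>

lemma robust_model_side:
  assumes sg: "sgraph V E" and mo: "model V E I HE B" and ro: "robust I HE q"
    and s: "sep V E X Y" "card (X \<inter> Y) \<le> q"
    and h1: "h1 \<in> I" "B h1 \<subseteq> Y - X" and h: "h \<in> I" "B h \<inter> (X \<inter> Y) = {}"
  shows "B h \<subseteq> Y - X"
proof -
  let ?R = "{h\<in>I. B h \<inter> (X \<inter> Y) \<noteq> {}}"
  have symE: "sym E" and "finite V" using sg unfolding sgraph_def by auto
  then have "finite (X \<inter> Y)" using s unfolding sep_def by (metis finite_Int finite_Un)
  then have Rq: "card ?R \<le> q" using model_hit_card[OF mo] s(2) by (meson le_trans)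
  have RI: "?R \<subseteq> I" by (rule Collect_restrict)
  have m1: "h1 \<in> I - ?R"
  proof -
    have "B h1 \<inter> (X \<inter> Y) = {}" using h1(2) by blast
    then show ?thesis using h1(1) by simp
  qed
  have m2: "h \<in> I - ?R" using h by simp
  obtain C where C: "C \<subseteq> I - ?R" "h1 \<in> C" "h \<in> C" "conn HE C"
    by (rule robust_link[OF ro RI Rq m1 m2])
  have CI: "C \<subseteq> I" using C(1) by (rule order_trans) (rule Diff_subset)
  have CR: "B g \<inter> (X \<inter> Y) = {}" if "g \<in> C" for g
  proof -
    have "g \<in> I - ?R" using C(1) that by (rule subsetD)
    then show ?thesis by simp
  qed
  have "conn E (\<Union>h\<in>C. B h)" using CI C(4) by (rule model_conn_UN[OF mo])
  then have "(\<Union>h\<in>C. B h) \<subseteq> Y - X"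
  proof (rule sep_conn_side[OF s(1)])
    show "(\<Union>h\<in>C. B h) \<subseteq> V" using CI modelD(1)[OF mo] by blast
    show "(\<Union>h\<in>C. B h) \<inter> (X \<inter> Y) = {}" using CR by blast
    show "(\<Union>h\<in>C. B h) \<inter> (Y - X) \<noteq> {}" using C(2) h1(2) modelD(2)[OF mo h1(1)] by blast
  qed fact
  then show ?thesis using C(3) by blast
qed

text \<open>Folding makes two branch sets overlap only if the contracted edge runs between them; the
  assumption on \<open>x\<close> and \<open>y\<close> excludes this.\<close>

lemma model_contr:
  assumes mo: "model V E I HE B" and sg: "sgraph V E" and xy: "(x, y) \<in> E"
    and no: "\<And>h h'. h \<in> I \<Longrightarrow> h' \<in> I \<Longrightarrow> x \<in> B h \<Longrightarrow> y \<in> B h' \<Longrightarrow> h = h'"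
    and irr: "irrefl HE"
  shows "model (V - {y}) (contr x y E) I HE (\<lambda>h. fold_at x y ` B h)"
proof -
  have xV: "x \<in> V" "x \<noteq> y" using sgraph_in[OF sg xy] sgraph_irrefl[OF sg] xy by auto
  have disj: "h = h'" if "h \<in> I" "h' \<in> I" "a \<in> B h" "b \<in> B h'" "fold_at x y a = fold_at x y b" for h h' a b
  proof -
    have "a = b \<or> (a = x \<and> b = y) \<or> (a = y \<and> b = x)"
      using that unfolding fold_at_def by (auto split: if_splits)
    then show ?thesis using that no[of h h'] no[of h' h] model_disjoint[OF mo] by blast
  qed
  have "\<exists>a\<in>fold_at x y ` B h. \<exists>b\<in>fold_at x y ` B h'. (a, b) \<in> contr x y E"
    if h: "h \<in> I" "h' \<in> I" "(h, h') \<in> HE" for h h'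
  proof -
    obtain a b where ab: "a \<in> B h" "b \<in> B h'" "(a, b) \<in> E" using model_adj[OF mo h] by auto
    have "h \<noteq> h'" using h irr unfolding irrefl_def by auto
    then have "fold_at x y a \<noteq> fold_at x y b" using disj ab h by blast
    then have "(fold_at x y a, fold_at x y b) \<in> contr x y E" using ab unfolding contr_def by blast
    then show ?thesis using ab by blast
  qed
  moreover have "fold_at x y ` B h \<inter> fold_at x y ` B h' = {}" if "h \<in> I" "h' \<in> I" "h \<noteq> h'" for h h'
    using disj that by blast
  moreover have "fold_at x y ` B h \<subseteq> V - {y}" if "h \<in> I" for h
    using modelD(1)[OF mo that] xV unfolding fold_at_def by auto
  ultimately show ?thesis
    using modelD[OF mo] unfolding model_def by (auto intro: conn_contr_image)
qed

text \<open>Stop \<open>d\<close> at its first contact with \<open>Q\<close>: a largest connected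
  part that contains \<open>z\<close> and avoids \<open>Q\<close> has a neighbour in the rest of
  \<open>d\<close>, and by maximality this neighbour lies in \<open>Q\<close>.\<close>

lemma conn_trim:
  assumes "conn E d" "finite d" "z \<in> d" "d \<inter> Q \<noteq> {}" "sym E"
  obtains d' v where "d' \<subseteq> d" "conn E d'" "z \<in> d'" "d' \<inter> Q = {v}"
proof (cases "z \<in> Q")
  case True
  then show ?thesis using that[of "{z}" z] assms by auto
next
  case False
  let ?P = "\<lambda>K. K \<subseteq> d - Q \<and> conn E K \<and> z \<in> K"
  have "?P {z}" using False assms by auto
  moreover have "\<forall>K. ?P K \<longrightarrow> card K < Suc (card d)"
    using assms(2) by (meson Diff_subset card_mono le_imp_less_Suc subset_trans)
  ultimately obtain K where K: "?P K" "\<And>K'. ?P K' \<Longrightarrow> card K' \<le> card K"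
    using ex_has_greatest_nat[of ?P "{z}" card "Suc (card d)"] by auto
  obtain w where w: "w \<in> d \<inter> Q" using assms by auto
  have "z \<in> d \<inter> K" "w \<in> d - K" using K w by auto
  with assms(1) obtain u v where uv: "u \<in> d \<inter> K" "v \<in> d - K" "(u, v) \<in> E" by (rule conn_edge)
  have cK: "conn E (insert v K)" using K(1) uv assms(5) by (intro conn_insert) auto
  have "v \<in> Q"
  proof (rule ccontr)
    assume "v \<notin> Q"
    then have "?P (insert v K)" using K(1) uv cK by auto
    then have "card (insert v K) \<le> card K" by (rule K(2))
    moreover have "finite K" using K(1) assms(2) finite_subset by fastforce
    ultimately show False using uv by auto
  qed
  then have "insert v K \<inter> Q = {v}" using K(1) by auto
  then show ?thesis using that[of "insert v K" v] cK K(1) uv by auto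
qed

text \<open>Greedy choice of links. Each one has to avoid at most \<open>p\<close> indices outside
  \<open>I0\<close>, at most \<open>p\<close> foreign terminals and at most \<open>6 * p\<close>
  indices of earlier links, which adds up to \<open>8 * p\<close>.\<close>

lemma robust_links:
  assumes ro: "robust I HE q" and I0: "I0 \<subseteq> I" "card (I - I0) \<le> p"
    and K: "K \<subseteq> I0" "card K \<le> p" and q: "8 * p \<le> q"
    and M: "finite M" "card M \<le> p" "\<And>m. m \<in> M \<Longrightarrow> m \<subseteq> K \<and> (\<exists>s t. m = {s, t})" "disjoint M"
  shows "\<exists>C. (\<forall>m\<in>M. m \<subseteq> C m \<and> C m \<subseteq> I0 - (K - m) \<and> conn HE (C m) \<and> card (C m) \<le> 6) \<and>
    (\<forall>m\<in>M. \<forall>m'\<in>M. m \<noteq> m' \<longrightarrow> C m \<inter> C m' = {})"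
  using M
proof (induction M rule: finite_induct)
  case empty
  then show ?case by auto
next
  case (insert m M)
  have finI: "finite I" using ro unfolding robust_def by auto
  have disjM: "disjoint M" and disjm: "\<And>m'. m' \<in> M \<Longrightarrow> m \<inter> m' = {}"
    using insert.prems(3) insert.hyps(2) unfolding disjoint_def by auto
  have cM: "card M < p" using insert by auto
  obtain C where C: "\<And>m. m \<in> M \<Longrightarrow> m \<subseteq> C m \<and> C m \<subseteq> I0 - (K - m) \<and> conn HE (C m) \<and> card (C m) \<le> 6"
    "\<And>m m'. m \<in> M \<Longrightarrow> m' \<in> M \<Longrightarrow> m \<noteq> m' \<Longrightarrow> C m \<inter> C m' = {}"
  proof -
    have "card M \<le> p" using cM by simp
    moreover have "m \<subseteq> K \<and> (\<exists>s t. m = {s, t})" if "m \<in> M" for m using insert.prems(2) that by simp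
    ultimately show ?thesis using insert.IH[OF _ _ disjM] that by metis
  qed
  let ?R = "(I - I0) \<union> (K - m) \<union> (\<Union>m'\<in>M. C m')"
  obtain s t where st: "m = {s, t}" "m \<subseteq> K" using insert.prems(2)[of m] by auto
  have finK: "finite K" using K I0 finI by (meson finite_subset)
  have "card (\<Union>m'\<in>M. C m') \<le> (\<Sum>m'\<in>M. card (C m'))" using insert.hyps(1) by (rule card_UN_le)
  also have "\<dots> \<le> (\<Sum>m'\<in>M. 6)" using C by (intro sum_mono) auto
  also have "\<dots> \<le> 6 * p" using cM by simp
  finally have c3: "card (\<Union>m'\<in>M. C m') \<le> 6 * p" .
  have "card (K - m) \<le> p" using finK K(2) by (meson Diff_subset card_mono le_trans)
  then have "card ?R \<le> p + p + 6 * p"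
    using I0(2) c3 by (intro card_Un_le[THEN order_trans] add_mono) auto
  then have "card ?R \<le> q" using q by simp
  moreover have "?R \<subseteq> I" using I0 K C(1) by blast
  moreover have "m \<inter> C m' = {}" if "m' \<in> M" for m' using C(1)[OF that] disjm[OF that] st by blast
  then have mR: "m \<inter> ?R = {}" using st K by blast
  have "m \<subseteq> I" using st(2) K(1) I0(1) by simp
  then have "s \<in> I - ?R" "t \<in> I - ?R" using mR unfolding st(1) by simp_all
  ultimately obtain D where D: "D \<subseteq> I - ?R" "s \<in> D" "t \<in> D" "conn HE D" "card D \<le> 6"
    using robust_link[OF ro, of ?R s t] by blast
  let ?C = "C(m := D)"
  have eq: "?C m' = C m'" if "m' \<in> M" for m' using that insert.hyps(2) by auto
  show ?case
  proof (intro exI[of _ ?C] conjI ballI impI)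
    fix m' assume m': "m' \<in> insert m M"
    have Dp: "m \<subseteq> D" "D \<subseteq> I0 - (K - m)" using D st by auto
    show "m' \<subseteq> ?C m'" "?C m' \<subseteq> I0 - (K - m')" "conn HE (?C m')" "card (?C m') \<le> 6"
      using C(1)[of m'] D Dp m' eq[of m'] by (auto split: if_splits)
    fix m'' assume m'': "m'' \<in> insert m M" "m' \<noteq> m''"
    show "?C m' \<inter> ?C m'' = {}"
      using C(2)[of m' m''] D(1) m' m'' by (auto split: if_splits)
  qed
qed

lemma UN_Un_disjoint:
  assumes "\<And>z z'. z \<in> A \<Longrightarrow> z' \<in> A' \<Longrightarrow> d z \<inter> d z' = {}" "\<And>z. z \<in> A \<Longrightarrow> d z \<inter> U' = {}"
    "\<And>z. z \<in> A' \<Longrightarrow> U \<inter> d z = {}" "U \<inter> U' = {}"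
  shows "((\<Union>z\<in>A. d z) \<union> U) \<inter> ((\<Union>z\<in>A'. d z) \<union> U') = {}"
  using assms by blast

text \<open>Menger's theorem leads \<open>Z\<close> to the singleton branch sets, and the minor
  links the ends. Since the sets are singletons, a trimmed connection \<open>d z\<close> contains
  the branch set in which it ends; disjoint connections therefore have different ends and touch no
  other branch set with index in \<open>I0\<close>.\<close>

lemma link_singletons:
  assumes sg: "sgraph V E" and Z: "Z \<subseteq> V" "card Z = p"
    and mo: "model V E I HE B" and ro: "robust I HE q" and q: "8 * p \<le> q" "q < card I"
    and free: "\<And>X Y h. sep V E X Y \<Longrightarrow> Z \<subseteq> X \<Longrightarrow> h \<in> I \<Longrightarrow> B h \<subseteq> Y - X \<Longrightarrow> p \<le> card (X \<inter> Y)"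
    and I0: "I0 \<subseteq> I" "card (I - I0) \<le> p" "\<And>h. h \<in> I0 \<Longrightarrow> \<exists>v. B h = {v}"
    and M: "\<And>m. m \<in> M \<Longrightarrow> m \<subseteq> Z \<and> (\<exists>s t. m = {s, t})" "disjoint M" "card M \<le> p"
  shows "\<exists>L. (\<forall>m\<in>M. m \<subseteq> L m \<and> L m \<subseteq> V \<and> conn E (L m)) \<and> (\<forall>m\<in>M. \<forall>m'\<in>M. m \<noteq> m' \<longrightarrow> L m \<inter> L m' = {})"
proof -
  have finV: "finite V" and symE: "sym E" using sg unfolding sgraph_def by auto
  have finZ: "finite Z" using Z finV finite_subset by blast
  have finI: "finite I" using ro unfolding robust_def by auto
  let ?Q = "\<Union>h\<in>I0. B h"
  have QV: "?Q \<subseteq> V" using I0 modelD(1)[OF mo] by blast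
  have cI0: "p \<le> card I0"
  proof -
    have "card I - card I0 \<le> p" using I0 finI by (metis card_Diff_subset finite_subset)
    then show ?thesis using q by linarith
  qed
  \<comment> \<open>A separator with fewer than \<open>p\<close> vertices misses one of the at least
    \<open>p\<close> branch sets of \<open>I0\<close>. That one lies beyond \<open>X\<close>,
    against \<open>free\<close>.\<close>
  have "p \<le> card (X \<inter> Y)" if XY: "sep V E X Y" "Z \<subseteq> X" "?Q \<subseteq> Y" for X Y
  proof (rule ccontr)
    assume less: "\<not> p \<le> card (X \<inter> Y)"
    have "finite (X \<inter> Y)" using XY(1) finV unfolding sep_def by (metis finite_Int finite_Un)
    then have "card {h\<in>I. B h \<inter> (X \<inter> Y) \<noteq> {}} < p" using model_hit_card[OF mo] less by (meson le_less_trans not_le)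
    then have "\<not> I0 \<subseteq> {h\<in>I. B h \<inter> (X \<inter> Y) \<noteq> {}}"
      using cI0 finI card_mono[of "{h\<in>I. B h \<inter> (X \<inter> Y) \<noteq> {}}" I0] by auto
    then obtain h where h: "h \<in> I0" "h \<in> I" "B h \<inter> (X \<inter> Y) = {}" using I0 by auto
    then have "B h \<subseteq> Y - X" using XY(3) by auto
    then show False using free[OF XY(1,2) h(2)] less by auto
  qed
  then obtain D where D: "finite D" "card D = p" "disjoint D"
    "\<And>d. d \<in> D \<Longrightarrow> d \<subseteq> V \<and> conn E d \<and> d \<inter> Z \<noteq> {} \<and> d \<inter> ?Q \<noteq> {}"
    using menger_connected[OF sg Z(1) QV, of p] by auto
  obtain g where g: "bij_betw g Z D" "\<And>s. s \<in> Z \<Longrightarrow> g s \<inter> Z = {s}"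
    using disjoint_transversal[of Z D] D finZ Z(2) by metis
  have gD: "g z \<in> D" if "z \<in> Z" for z using g(1) that by (auto simp: bij_betwE)
  have "\<exists>d k. d \<subseteq> g z \<and> conn E d \<and> z \<in> d \<and> k \<in> I0 \<and> d \<inter> ?Q = B k" if z: "z \<in> Z" for z
  proof -
    have dp: "g z \<subseteq> V" "conn E (g z)" "g z \<inter> ?Q \<noteq> {}" using D(4)[OF gD[OF z]] by auto
    have "z \<in> g z" using g(2)[OF z] by auto
    obtain d v where d: "d \<subseteq> g z" "conn E d" "z \<in> d" "d \<inter> ?Q = {v}"
      using conn_trim[OF dp(2) finite_subset[OF dp(1) finV] \<open>z \<in> g z\<close> dp(3) symE] by metis
    then obtain k where "k \<in> I0" "v \<in> B k" by blast
    moreover obtain v' where "B k = {v'}" using I0(3)[OF \<open>k \<in> I0\<close>] by auto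
    ultimately have "k \<in> I0" "B k = {v}" by auto
    then show ?thesis using d by metis
  qed
  then obtain d k where dk: "\<And>z. z \<in> Z \<Longrightarrow> d z \<subseteq> g z \<and> conn E (d z) \<and> z \<in> d z \<and> k z \<in> I0 \<and> d z \<inter> ?Q = B (k z)"
    by metis
  have gdisj: "g z \<inter> g z' = {}" if "z \<in> Z" "z' \<in> Z" "z \<noteq> z'" for z z'
  proof -
    have "g z \<noteq> g z'" using g(1) that unfolding bij_betw_def inj_on_def by blast
    then show ?thesis using D(3) gD that unfolding disjoint_def by blast
  qed
  have Bk: "B (k z) \<subseteq> d z" "B (k z) \<noteq> {}" if "z \<in> Z" for z
    using dk[OF that] modelD(2)[OF mo] I0 by blast+
  have kinj: "inj_on k Z"
  proof (rule inj_onI, rule ccontr)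
    fix z z' assume z: "z \<in> Z" "z' \<in> Z" "k z = k z'" "z \<noteq> z'"
    then have "B (k z) \<subseteq> g z \<inter> g z'" using dk Bk by (metis Int_greatest order_trans)
    then show False using gdisj[OF z(1,2,4)] Bk(2)[OF z(1)] by simp
  qed
  have finM: "finite M" using M(1) finZ by (metis Pow_iff finite_Pow_iff finite_subset subsetI)
  let ?M = "(`) k ` M"
  have injM: "k ` m = k ` m' \<Longrightarrow> m = m'" if "m \<in> M" "m' \<in> M" for m m'
    using kinj M(1) that by (simp add: inj_on_image_eq_iff)
  have "\<exists>C. (\<forall>m\<in>?M. m \<subseteq> C m \<and> C m \<subseteq> I0 - (k ` Z - m) \<and> conn HE (C m) \<and> card (C m) \<le> 6) \<and>
    (\<forall>m\<in>?M. \<forall>m'\<in>?M. m \<noteq> m' \<longrightarrow> C m \<inter> C m' = {})"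
  proof (rule robust_links[OF ro I0(1,2) _ _ q(1)])
    show "k ` Z \<subseteq> I0" using dk by auto
    show "card (k ` Z) \<le> p" using Z(2) card_image_le[OF finZ] by auto
    show "finite ?M" using finM by simp
    show "card ?M \<le> p" using M(3) card_image_le[OF finM] by (meson le_trans)
    show "m \<subseteq> k ` Z \<and> (\<exists>s t. m = {s, t})" if "m \<in> ?M" for m using that M(1) by fastforce
    show "disjoint ?M"
    proof (rule disjointI)
      fix a b assume "a \<in> ?M" "b \<in> ?M" "a \<noteq> b"
      then obtain m m' where m: "m \<in> M" "m' \<in> M" "a = k ` m" "b = k ` m'" "m \<noteq> m'" by auto
      then have "m \<inter> m' = {}" using M(2) unfolding disjoint_def by auto
      then show "a \<inter> b = {}" using m M(1) kinj by (metis image_empty inj_on_image_Int)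
    qed
  qed
  then obtain C where C: "\<And>m. m \<in> M \<Longrightarrow> k ` m \<subseteq> C (k ` m) \<and> C (k ` m) \<subseteq> I0 - (k ` Z - k ` m) \<and> conn HE (C (k ` m))"
    "\<And>m m'. m \<in> M \<Longrightarrow> m' \<in> M \<Longrightarrow> m \<noteq> m' \<Longrightarrow> C (k ` m) \<inter> C (k ` m') = {}"
    using injM by (metis (no_types, lifting) imageI)
  let ?U = "\<lambda>m. \<Union>h\<in>C (k ` m). B h"
  let ?L = "\<lambda>m. (\<Union>z\<in>m. d z) \<union> ?U m"
  have UQ: "?U m \<subseteq> ?Q" if "m \<in> M" for m using C(1)[OF that] by blast
  have UV: "?U m \<subseteq> V" if "m \<in> M" for m using UQ[OF that] QV by simp
  \<comment> \<open>Inside \<open>?Q\<close> the connection \<open>d z\<close> occupies only the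
    branch set of \<open>k z\<close>, and links of other pairs avoid the index
    \<open>k z\<close>.\<close>
  have cross: "d z \<inter> ?U m' = {}" if "z \<in> Z" "m' \<in> M" "z \<notin> m'" for z m'
  proof (rule ccontr)
    assume "d z \<inter> ?U m' \<noteq> {}"
    then obtain h v where h: "h \<in> C (k ` m')" "v \<in> B h" "v \<in> d z" by auto
    then have hI: "h \<in> I0" using C(1)[OF that(2)] by blast
    then have "v \<in> B (k z)" using h dk[OF that(1)] by blast
    then have "h = k z" using model_disjoint[OF mo _ _ h(2)] hI I0(1) dk[OF that(1)] by blast
    moreover have "k z \<notin> k ` m'" using that M(1)[OF that(2)] kinj by (meson inj_on_image_mem_iff)
    ultimately show False using h(1) C(1)[OF that(2)] that(1) by blast
  qed
  show ?thesis
  proof (intro exI[of _ ?L] conjI ballI impI)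
    fix m assume m: "m \<in> M"
    obtain s t where st: "m = {s, t}" "s \<in> Z" "t \<in> Z" using M(1)[OF m] by blast
    show "m \<subseteq> ?L m" using dk M(1)[OF m] by blast
    have "d z \<subseteq> V" if "z \<in> m" for z
    proof -
      have "z \<in> Z" using that M(1)[OF m] by blast
      then show ?thesis using dk D(4)[OF gD] by (meson order_trans)
    qed
    then show "?L m \<subseteq> V" using UV[OF m] by blast
    have cU: "conn E (?U m)" using C(1)[OF m] I0(1) by (intro model_conn_UN[OF mo]) auto
    have meet: "d z \<inter> ?U m \<noteq> {}" if "z \<in> m" for z
    proof -
      have "z \<in> Z" using that M(1)[OF m] by auto
      moreover have "B (k z) \<subseteq> ?U m" using C(1)[OF m] that by blast
      ultimately show ?thesis using Bk[of z] by blast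
    qed
    have "conn E (d s \<union> (d t \<union> ?U m))"
    proof (intro conn_Un)
      show "conn E (d s)" "conn E (d t)" "conn E (?U m)" using dk st cU by auto
      show "d t \<inter> ?U m \<noteq> {}" using meet st by blast
      have "d s \<inter> ?U m \<noteq> {}" using meet st by blast
      then show "d s \<inter> (d t \<union> ?U m) \<noteq> {}" by blast
    qed
    moreover have "?L m = d s \<union> (d t \<union> ?U m)" using st by auto
    ultimately show "conn E (?L m)" by simp
    fix m' assume m': "m' \<in> M" "m \<noteq> m'"
    have mm: "m \<inter> m' = {}" using M(2) m m' unfolding disjoint_def by auto
    have U: "?U m \<inter> ?U m' = {}"
    proof (rule ccontr)
      assume "?U m \<inter> ?U m' \<noteq> {}"
      then obtain h h' v where h: "h \<in> C (k ` m)" "h' \<in> C (k ` m')" "v \<in> B h" "v \<in> B h'" by auto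
      have "h \<in> I0" "h' \<in> I0" using h(1,2) C(1)[OF m] C(1)[OF m'(1)] by (meson DiffD1 subsetD)+
      then have "h = h'" using I0(1) model_disjoint[OF mo _ _ h(3,4)] by (meson subsetD)
      then show False using h(1,2) C(2)[OF m m'] by (metis IntI emptyE)
    qed
    have dU: "d z \<inter> ?U m' = {}" if "z \<in> m" for z
      using that mm M(1)[OF m] by (intro cross m') auto
    have Ud: "?U m \<inter> d z = {}" if "z \<in> m'" for z
      using cross[of z m] that mm M(1)[OF m'(1)] m by blast
    have dd: "d z \<inter> d z' = {}" if "z \<in> m" "z' \<in> m'" for z z'
    proof -
      have z: "z \<in> Z" "z' \<in> Z" "z \<noteq> z'" using that mm M(1)[OF m] M(1)[OF m'(1)] by blast+
      have "d z \<subseteq> g z" "d z' \<subseteq> g z'" using dk z(1,2) by auto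
      then show ?thesis using gdisj[OF z] by blast
    qed
    show "?L m \<inter> ?L m' = {}" using dd dU Ud U by (rule UN_Un_disjoint)
  qed
qed

text \<open>Take a separation of order \<open>p\<close> between \<open>Z\<close> and some branch set whose far side \<open>Y\<close> is minimal. By
  submodularity no edge of \<open>Y\<close> outside \<open>X \<inter> Y\<close> lies in the separator of another separation of order \<open>p\<close>,
  so contracting it keeps \<open>Z\<close> well connected to the model. When no such edge remains inside or
  outside the branch sets, those beyond \<open>X\<close> are single vertices.\<close>

theorem linkage:
  fixes B :: "'b \<Rightarrow> 'a set"
  assumes "sgraph V E" and "Z \<subseteq> V" "card Z = p"
    and "model V E I HE B" and "robust I HE q" and "8 * p \<le> q" "q < card I" "irrefl HE"
    and "\<And>X Y h. sep V E X Y \<Longrightarrow> Z \<subseteq> X \<Longrightarrow> h \<in> I \<Longrightarrow> B h \<subseteq> Y - X \<Longrightarrow> p \<le> card (X \<inter> Y)"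
    and "\<And>m. m \<in> M \<Longrightarrow> m \<subseteq> Z \<and> (\<exists>s t. m = {s, t})" "disjoint M" "card M \<le> p"
  shows "\<exists>L. (\<forall>m\<in>M. m \<subseteq> L m \<and> L m \<subseteq> V \<and> conn E (L m)) \<and> (\<forall>m\<in>M. \<forall>m'\<in>M. m \<noteq> m' \<longrightarrow> L m \<inter> L m' = {})"
  using assms
proof (induction "card V" arbitrary: V E B rule: less_induct)
  case less
  note sg = less.prems(1) and Z = less.prems(2,3) and mo = less.prems(4) and ro = less.prems(5)
    and q = less.prems(6,7) and irr = less.prems(8) and free = less.prems(9) and M = less.prems(10-12)
  have finV: "finite V" and symE: "sym E" and EV: "E \<subseteq> V \<times> V" using sg unfolding sgraph_def by auto
  have finZ: "finite Z" using Z finV finite_subset by blast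
  have finI: "finite I" using ro unfolding robust_def by auto
  have finXY: "finite X \<and> finite Y" if "sep V E X Y" for X Y
    using that finV unfolding sep_def by (metis finite_Un)
  have avoid: "\<exists>h\<in>I. B h \<inter> S = {}" if "finite S" "card S \<le> q" for S
  proof (rule ccontr)
    assume "\<not> ?thesis"
    then have "{h\<in>I. B h \<inter> S \<noteq> {}} = I" by auto
    then show False using model_hit_card[OF mo that(1)] that(2) q(2) by auto
  qed
  let ?tight = "\<lambda>XY. sep V E (fst XY) (snd XY) \<and> Z \<subseteq> fst XY \<and> card (fst XY \<inter> snd XY) = p \<and>
    (\<exists>h\<in>I. B h \<subseteq> snd XY - fst XY)"
  obtain h0 where "h0 \<in> I" "B h0 \<inter> Z = {}" using avoid[OF finZ] Z q by auto
  then have "B h0 \<subseteq> V - Z" using modelD(1)[OF mo] by blast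
  \<comment> \<open>The trivial separation with separator \<open>Z\<close> shows that a tight one
    with smallest far side exists.\<close>
  then have "?tight (Z, V)" using Z \<open>h0 \<in> I\<close> by (auto simp: sep_def Int_absorb2)
  then obtain XY where "?tight XY" "\<And>XY'. ?tight XY' \<Longrightarrow> card (snd XY) \<le> card (snd XY')"
    using ex_has_least_nat[of ?tight "(Z, V)" "\<lambda>XY. card (snd XY)"] by metis
  then obtain X Y h1 where XY: "sep V E X Y" "Z \<subseteq> X" "card (X \<inter> Y) = p" and h1: "h1 \<in> I" "B h1 \<subseteq> Y - X"
    and least: "\<And>X' Y' h. sep V E X' Y' \<Longrightarrow> Z \<subseteq> X' \<Longrightarrow> card (X' \<inter> Y') = p \<Longrightarrow> h \<in> I \<Longrightarrow> B h \<subseteq> Y' - X' \<Longrightarrow> card Y \<le> card Y'"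
    by (metis fst_conv snd_conv)
  have side: "B h \<subseteq> Y - X" if "h \<in> I" "B h \<inter> (X \<inter> Y) = {}" for h
    using robust_model_side[OF sg mo ro XY(1) _ h1 that] XY(3) q by simp
  show ?case
  proof (cases "\<exists>x y. (x, y) \<in> E \<and> x \<in> Y \<and> y \<in> Y \<and> \<not> (x \<in> X \<and> y \<in> X) \<and>
      (\<forall>h\<in>I. \<forall>h'\<in>I. x \<in> B h \<longrightarrow> y \<in> B h' \<longrightarrow> h = h')")
    case True
    then obtain x0 y0 where xy0: "(x0, y0) \<in> E" "x0 \<in> Y" "y0 \<in> Y" "\<not> (x0 \<in> X \<and> y0 \<in> X)"
      "\<forall>h\<in>I. \<forall>h'\<in>I. x0 \<in> B h \<longrightarrow> y0 \<in> B h' \<longrightarrow> h = h'" by auto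
    \<comment> \<open>The contraction drops the name \<open>y\<close>, so an end that lies in
      \<open>Z\<close> has to be called \<open>x\<close>. Both ends cannot lie in \<open>Z\<close>,
      because \<open>Z \<subseteq> X\<close>.\<close>
    obtain x y where xy: "(x, y) \<in> E" "x \<in> Y" "y \<in> Y" "\<not> (x \<in> X \<and> y \<in> X)" "y \<notin> Z"
      "\<And>h h'. h \<in> I \<Longrightarrow> h' \<in> I \<Longrightarrow> x \<in> B h \<Longrightarrow> y \<in> B h' \<Longrightarrow> h = h'"
    proof (cases "y0 \<in> Z")
      case True
      then have "x0 \<notin> Z" using xy0 XY by auto
      moreover have "(y0, x0) \<in> E" using sgraph_sym[OF sg] xy0 by auto
      ultimately show ?thesis using that[of y0 x0] xy0 by blast
    next
      case False
      then show ?thesis using that[of x0 y0] xy0 by blast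
    qed
    have xV: "x \<in> V" "y \<in> V" "x \<noteq> y" using sgraph_in[OF sg xy(1)] sgraph_irrefl[OF sg] xy by auto
    let ?f = "fold_at x y" let ?V = "V - {y}" let ?E = "contr x y E" let ?B = "\<lambda>h. ?f ` B h"
    have mo': "model ?V ?E I HE ?B" using mo sg xy(1) xy(6) irr by (rule model_contr)
    have free': "p \<le> card (X' \<inter> Y')"
      if s': "sep ?V ?E X' Y'" "Z \<subseteq> X'" "h \<in> I" "?B h \<subseteq> Y' - X'" for X' Y' h
    proof (rule ccontr)
      assume less': "\<not> p \<le> card (X' \<inter> Y')"
      let ?X1 = "?f -` X'" let ?Y1 = "?f -` Y'"
      have s1: "sep V E ?X1 ?Y1" using s'(1) xV EV by (intro sep_contr_vimage) auto
      have Z1: "Z \<subseteq> ?X1" using s'(2) xy(5) unfolding fold_at_def by auto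
      have h1': "B h \<subseteq> ?Y1 - ?X1" using s'(4) by auto
      have yXY: "y \<notin> X' \<inter> Y'" using s'(1) unfolding sep_def by auto
      have "?X1 \<inter> ?Y1 = ?f -` (X' \<inter> Y')" by auto
      also have "\<dots> = (if x \<in> X' \<inter> Y' then insert y (X' \<inter> Y') else X' \<inter> Y')" by (rule fold_at_vimage[OF yXY])
      finally have eq1: "?X1 \<inter> ?Y1 = (if x \<in> X' \<inter> Y' then insert y (X' \<inter> Y') else X' \<inter> Y')" .
      have p1: "p \<le> card (?X1 \<inter> ?Y1)" using free[OF s1 Z1 s'(3) h1'] .
      have xX': "x \<in> X' \<inter> Y'"
      proof (rule ccontr)
        assume "x \<notin> X' \<inter> Y'"
        then have "?X1 \<inter> ?Y1 = X' \<inter> Y'" using eq1 by (metis if_not_P)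
        then show False using p1 less' by metis
      qed
      then have eq1': "?X1 \<inter> ?Y1 = insert y (X' \<inter> Y')" using eq1 by simp
      have "finite (X' \<inter> Y')" using eq1' finXY[OF s1] by (metis finite_Int finite_insert)
      then have c1: "card (?X1 \<inter> ?Y1) = p" using p1 eq1' less' yXY by simp
      have xy1: "x \<in> ?X1 \<inter> ?Y1" "y \<in> ?X1 \<inter> ?Y1" using eq1' xX' by auto
      \<comment> \<open>As \<open>2 * p \<le> q\<close>, some branch set misses both separators, and
        by robustness it lies on the far side of both separations. So \<open>free\<close> applies to
        both corners, and submodularity makes their orders equal to \<open>p\<close>.\<close>
      have "card ((X \<inter> Y) \<union> (?X1 \<inter> ?Y1)) \<le> p + p"
        using card_Un_le[of "X \<inter> Y" "?X1 \<inter> ?Y1"] XY(3) c1 by simp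
      then obtain h2 where h2: "h2 \<in> I" "B h2 \<inter> ((X \<inter> Y) \<union> (?X1 \<inter> ?Y1)) = {}"
        using avoid[of "(X \<inter> Y) \<union> (?X1 \<inter> ?Y1)"] finXY[OF s1] finXY[OF XY(1)] q by auto
      have b1: "B h2 \<subseteq> Y - X" using h2 by (intro side) auto
      have b2: "B h2 \<subseteq> ?Y1 - ?X1"
        using robust_model_side[OF sg mo ro s1 _ s'(3) h1' h2(1)] h2(2) c1 q by auto
      note sub = sep_submodular[OF finV XY(1) s1 symE]
      have o2: "p \<le> card ((X \<inter> ?X1) \<inter> (Y \<union> ?Y1))"
        using b1 b2 XY(2) Z1 by (intro free[OF sub(2) _ h2(1)]) auto
      have o1: "p \<le> card ((X \<union> ?X1) \<inter> (Y \<inter> ?Y1))"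
        using b1 b2 XY(2) Z1 by (intro free[OF sub(1) _ h2(1)]) auto
      have c: "card ((X \<union> ?X1) \<inter> (Y \<inter> ?Y1)) = p" using o1 o2 sub(3) XY(3) c1 by linarith
      have "card Y \<le> card (Y \<inter> ?Y1)"
        using b1 b2 XY(2) by (intro least[OF sub(1) _ c h2(1)]) auto
      then have "Y \<inter> ?Y1 = Y" using finXY[OF XY(1)] by (metis card_seteq inf_le1)
      then have YY: "Y \<subseteq> ?Y1" by auto
      \<comment> \<open>Once the choice of \<open>Y\<close> has forced
        \<open>Y \<subseteq> ?Y1\<close>, the corner separator contains \<open>X \<inter> Y\<close>
        and has the same size. But \<open>x\<close> and \<open>y\<close> belong to it as well, so
        both would lie in \<open>X\<close>.\<close>
      have "X \<inter> Y = (X \<union> ?X1) \<inter> (Y \<inter> ?Y1)"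
        using YY c XY(3) finXY[OF XY(1)] by (intro card_subset_eq) auto
      then show False using xy1 xy(2-4) by blast
    qed
    have ZV: "Z \<subseteq> ?V" using Z xy(5) by auto
    have "card ?V < card V" using finV xV by (meson card_Diff1_less)
    then have "\<exists>L. (\<forall>m\<in>M. m \<subseteq> L m \<and> L m \<subseteq> ?V \<and> conn ?E (L m)) \<and>
        (\<forall>m\<in>M. \<forall>m'\<in>M. m \<noteq> m' \<longrightarrow> L m \<inter> L m' = {})"
      by (rule less.hyps[OF _ sgraph_contr[OF sg xy(1)] ZV Z(2) mo' ro q irr _ M]) (rule free')
    then obtain L where L: "\<And>m. m \<in> M \<Longrightarrow> m \<subseteq> L m \<and> L m \<subseteq> ?V \<and> conn ?E (L m)"
      "\<And>m m'. m \<in> M \<Longrightarrow> m' \<in> M \<Longrightarrow> m \<noteq> m' \<Longrightarrow> L m \<inter> L m' = {}" by metis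
    show ?thesis
    proof (intro exI[of _ "\<lambda>m. ?f -` L m"] conjI ballI impI)
      fix m assume m: "m \<in> M"
      show "m \<subseteq> ?f -` L m" using L(1)[OF m] M(1)[OF m] xy(5) unfolding fold_at_def by auto
      show "?f -` L m \<subseteq> V" using L(1)[OF m] xV unfolding fold_at_def by (auto split: if_splits)
      show "conn E (?f -` L m)" using L(1)[OF m] xy(1) symE by (intro conn_contr_vimage) auto
      fix m' assume "m' \<in> M" "m \<noteq> m'"
      then show "?f -` L m \<inter> ?f -` L m' = {}" using L(2)[OF m] by blast
    qed
  next
    case False
    let ?I0 = "{h\<in>I. B h \<inter> (X \<inter> Y) = {}}"
    have "I - ?I0 = {h\<in>I. B h \<inter> (X \<inter> Y) \<noteq> {}}" by auto
    then have c: "card (I - ?I0) \<le> p" using model_hit_card[OF mo, of "X \<inter> Y"] finXY[OF XY(1)] XY(3) by auto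
    have single: "\<exists>v. B h = {v}" if h: "h \<in> ?I0" for h
    proof (rule ccontr)
      assume no: "\<nexists>v. B h = {v}"
      obtain a where a: "a \<in> B h" using modelD(2)[OF mo] h by auto
      then obtain b where b: "b \<in> B h" "b \<noteq> a" using no by blast
      obtain u v where uv: "u \<in> B h \<inter> {a}" "v \<in> B h - {a}" "(u, v) \<in> E"
        using conn_edge[of E "B h" a "{a}" b] modelD(3)[OF mo] h a b by auto
      have "B h \<subseteq> Y - X" using h side by auto
      then have "u \<in> Y" "v \<in> Y" "u \<notin> X" using uv by auto
      moreover have "\<forall>h\<in>I. \<forall>h'\<in>I. u \<in> B h \<longrightarrow> v \<in> B h' \<longrightarrow> h = h'"
        using uv h model_disjoint[OF mo] by blast
      ultimately show False using False uv(3) by blast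
    qed
    show ?thesis
      by (rule link_singletons[OF sg Z mo ro q free _ c single M]) auto
  qed
qed

section \<open>Robust minors of dense graphs\<close>

lemma conn_insert_eq:
  assumes "conn E A" "b = a \<or> (a, b) \<in> E" "a \<in> A" "sym E"
  shows "conn E (insert b A)"
  using assms conn_insert[of E A a b] by (auto simp: insert_absorb)

lemma model_mono:
  assumes "model V E I HE B" "V \<subseteq> V'" "E \<subseteq> E'"
  shows "model V' E' I HE B"
  using assms conn_mono[of E _ E'] unfolding model_def by (meson le_infI1 order_trans subsetD)

lemma model_subset:
  assumes "model V E I HE B" "J \<subseteq> I" "HJ \<subseteq> HE"
  shows "model V E J HJ B"
  using assms unfolding model_def by (meson subsetD)

lemma model_contr_vimage:
  assumes mo: "model (V - {y}) (contr x y E) I HE B" and "sgraph V E" "(x, y) \<in> E"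
  shows "model V E I HE (\<lambda>h. fold_at x y -` B h)"
proof -
  have symE: "sym E" using assms(2) unfolding sgraph_def by auto
  have xV: "x \<in> V" "y \<in> V" using sgraph_in[OF assms(2,3)] by auto
  have "fold_at x y -` B h \<subseteq> V" if "h \<in> I" for h
    using modelD(1)[OF mo that] xV unfolding fold_at_def by (auto split: if_splits)
  moreover have "fold_at x y -` B h \<noteq> {}" if h: "h \<in> I" for h
  proof -
    obtain b where b: "b \<in> B h" using modelD(2)[OF mo h] by auto
    then have "fold_at x y b = b" using modelD(1)[OF mo h] unfolding fold_at_def by auto
    then show ?thesis using b by (metis emptyE vimageI)
  qed
  moreover have "conn E (fold_at x y -` B h)" if "h \<in> I" for h
    using conn_contr_vimage[OF modelD(3)[OF mo that] assms(3) symE] .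
  moreover have "fold_at x y -` B h \<inter> fold_at x y -` B h' = {}" if "h \<in> I" "h' \<in> I" "h \<noteq> h'" for h h'
    using model_disjoint[OF mo that(1,2)] that(3) by blast
  moreover have "\<exists>a\<in>fold_at x y -` B h. \<exists>b\<in>fold_at x y -` B h'. (a, b) \<in> E"
    if "h \<in> I" "h' \<in> I" "(h, h') \<in> HE" for h h'
    using model_adj[OF mo that] unfolding contr_def by blast
  ultimately show ?thesis unfolding model_def by blast
qed

text \<open>The contraction loses the two arcs of the edge and, for every common neighbour, the two
  arcs at \<open>y\<close> that become parallel to those at \<open>x\<close>; on the remaining arcs
  the folding is injective.\<close>

lemma card_contr_ge:
  assumes "sgraph V E" "(x, y) \<in> E"
  shows "card E \<le> card (contr x y E) + 2 + 2 * card (E `` {x} \<inter> E `` {y})"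
proof -
  let ?f = "fold_at x y" let ?c = "E `` {x} \<inter> E `` {y}"
  have finE: "finite E" using assms(1) by (rule sgraph_finite_E)
  have fc: "finite ?c" using finE by (metis Image_singleton finite_Image finite_Int finite.emptyI finite_insert)
  have xy: "x \<noteq> y" using sgraph_irrefl[OF assms(1)] assms(2) by auto
  let ?X = "{(x, y), (y, x)} \<union> {y} \<times> ?c \<union> ?c \<times> {y}"
  have symE: "\<And>a b. (a, b) \<in> E \<Longrightarrow> (b, a) \<in> E" using sgraph_sym[OF assms(1)] .
  have irr: "\<And>a. (a, a) \<notin> E" using sgraph_irrefl[OF assms(1)] .
  have "inj_on (map_prod ?f ?f) (E - ?X)"
  proof (rule inj_onI)
    fix e e' assume e: "e \<in> E - ?X" "e' \<in> E - ?X" "map_prod ?f ?f e = map_prod ?f ?f e'"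
    obtain a b a' b' where ab: "e = (a, b)" "e' = (a', b')" by (metis surj_pair)
    have *: "(a, b) \<in> E" "(a', b') \<in> E" "(a, b) \<notin> ?X" "(a', b') \<notin> ?X" "?f a = ?f a'" "?f b = ?f b'"
      using e unfolding ab by auto
    have "a = a' \<or> a = x \<and> a' = y \<or> a = y \<and> a' = x" "b = b' \<or> b = x \<and> b' = y \<or> b = y \<and> b' = x"
      using *(5,6) unfolding fold_at_def by (auto split: if_splits)
    then have "a = a' \<and> b = b'" using *(1-4) irr symE by blast
    then show "e = e'" using ab by simp
  qed
  moreover have "map_prod ?f ?f ` (E - ?X) \<subseteq> contr x y E"
  proof (rule image_subsetI)
    fix e assume e: "e \<in> E - ?X"
    obtain a b where ab: "e = (a, b)" by (metis surj_pair)
    have "?f a \<noteq> ?f b" using e ab irr xy unfolding fold_at_def by (auto split: if_splits)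
    then show "map_prod ?f ?f e \<in> contr x y E" using e ab unfolding contr_def by auto
  qed
  moreover have "finite (contr x y E)" unfolding contr_image using finE by simp
  ultimately have "card (E - ?X) \<le> card (contr x y E)" by (metis card_inj_on_le)
  moreover have "card E \<le> card (E - ?X) + card ?X"
  proof -
    have "card E - card ?X \<le> card (E - ?X)" using fc by (intro diff_card_le_card_Diff) auto
    then show ?thesis by linarith
  qed
  moreover have "card ?X \<le> card {(x, y), (y, x)} + card ({y} \<times> ?c) + card (?c \<times> {y})"
    by (meson add_mono card_Un_le le_trans order_refl)
  moreover have "card {(x, y), (y, x)} = 2" using xy by auto
  ultimately show ?thesis by (simp add: card_cartesian_product)
qed

lemma card_arcs:
  assumes "sgraph V E"
  shows "card E = (\<Sum>v\<in>V. card (E `` {v}))"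
proof -
  have "finite V" using assms unfolding sgraph_def by auto
  moreover have "finite (E `` {v})" for v using sgraph_finite_E[OF assms] by auto
  ultimately have "card (Sigma V (\<lambda>v. E `` {v})) = (\<Sum>v\<in>V. card (E `` {v}))" by (simp add: card_SigmaI)
  moreover have "Sigma V (\<lambda>v. E `` {v}) = E" using sgraph_in[OF assms] by auto
  ultimately show ?thesis by simp
qed

lemma card_minus_pair_ge: "finite A \<Longrightarrow> card A \<le> card (A - {a, b}) + 2"
  using diff_card_le_card_Diff[of "{a, b}" A] card_length[of "[a, b]"] by simp

text \<open>\<open>card E\<close> counts both orientations, so the average degree is at least
  \<open>2 * D\<close>. In a minimal such minor every edge lies in at least \<open>D\<close>
  triangles, since otherwise contracting it would keep the density. Hence the neighbourhood of a
  vertex of degree at most \<open>2 * D\<close> induces minimum degree at least \<open>D\<close>.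
  Isolated vertices are removed to keep that neighbourhood nonempty.\<close>

lemma dense_minor:
  assumes "sgraph V E" "V \<noteq> {}" "2 * D * card V \<le> card E" "D \<ge> 1"
  shows "\<exists>I HE B. sgraph I HE \<and> I \<noteq> {} \<and> card I \<le> 2 * D \<and> (\<forall>h\<in>I. D \<le> card (HE `` {h})) \<and>
    model V E I HE (B :: 'a \<Rightarrow> 'a set)"
  using assms
proof (induction "card V + card E" arbitrary: V E rule: less_induct)
  case less
  note sg = less.prems(1)
  have finV: "finite V" and EV: "E \<subseteq> V \<times> V" and symE: "sym E" using sg unfolding sgraph_def by auto
  have finE: "finite E" using sg by (rule sgraph_finite_E)
  have "0 < card V" using finV less.prems(2) by (simp add: card_gt_0_iff)
  then have "2 * D * 1 \<le> 2 * D * card V" by (intro mult_le_mono2) auto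
  then have "0 < card E" using less.prems(3,4) by linarith
  then have "E \<noteq> {}" by auto
  then obtain x0 y0 where xy0: "(x0, y0) \<in> E" by auto
  have V2: "V - {v} \<noteq> {}" for v
    using sgraph_in[OF sg xy0] sgraph_irrefl[OF sg] xy0 by blast
  consider (big) "2 * D * card V + 2 \<le> card E" | (isolated) v where "v \<in> V" "E `` {v} = {}"
    | (contract) x y where "(x, y) \<in> E" "card (E `` {x} \<inter> E `` {y}) < D"
    | (final) "card E < 2 * D * card V + 2" "\<forall>v\<in>V. E `` {v} \<noteq> {}" "\<forall>(x, y)\<in>E. D \<le> card (E `` {x} \<inter> E `` {y})"
  proof (cases "2 * D * card V + 2 \<le> card E \<or> (\<exists>v\<in>V. E `` {v} = {}) \<or> (\<exists>x y. (x, y) \<in> E \<and> card (E `` {x} \<inter> E `` {y}) < D)")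
    case True
    then show ?thesis using that(1-3) by blast
  next
    case False
    then show ?thesis by (intro that(4)) (auto simp: not_less)
  qed
  then show ?case
  proof cases
    case big
    let ?E = "E - {(x0, y0), (y0, x0)}"
    have "sym ?E" using symE unfolding sym_def by blast
    then have sg': "sgraph V ?E" using sg unfolding sgraph_def irrefl_def by blast
    have "?E \<subset> E" using xy0 by auto
    then have "card ?E < card E" using finE by (metis psubset_card_mono)
    moreover have "card E \<le> card ?E + 2"
      using card_minus_pair_ge[OF finE] by simp
    ultimately have "card V + card ?E < card V + card E" "2 * D * card V \<le> card ?E" using big by linarith+
    from less.hyps[OF this(1) sg' less.prems(2) this(2) less.prems(4)]
    obtain I HE B where "sgraph I HE \<and> I \<noteq> {} \<and> card I \<le> 2 * D \<and> (\<forall>h\<in>I. D \<le> card (HE `` {h})) \<and>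
      model V ?E I HE (B :: 'a \<Rightarrow> 'a set)" by blast
    then show ?thesis using model_mono[of V ?E I HE B V E] by blast
  next
    case isolated
    let ?V = "V - {v}"
    have "E \<subseteq> ?V \<times> ?V"
    proof clarify
      fix a b assume ab: "(a, b) \<in> E"
      then have "(b, a) \<in> E" using sgraph_sym[OF sg] by auto
      then show "a \<in> ?V \<and> b \<in> ?V" using ab isolated sgraph_in[OF sg ab] by blast
    qed
    then have sg': "sgraph ?V E" using sg unfolding sgraph_def by auto
    have c: "card ?V < card V" using isolated finV by (meson card_Diff1_less)
    then have "2 * D * card ?V \<le> 2 * D * card V" by simp
    then have e: "2 * D * card ?V \<le> card E" using less.prems(3) by linarith
    have "card ?V + card E < card V + card E" using c by simp
    from less.hyps[OF this sg' V2 e less.prems(4)]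
    obtain I HE B where "sgraph I HE \<and> I \<noteq> {} \<and> card I \<le> 2 * D \<and> (\<forall>h\<in>I. D \<le> card (HE `` {h})) \<and>
      model ?V E I HE (B :: 'a \<Rightarrow> 'a set)" by blast
    then show ?thesis using model_mono[of ?V E I HE B V E] by blast
  next
    case contract
    let ?V = "V - {y}" let ?E = "contr x y E"
    have yV: "y \<in> V" using sgraph_in[OF sg contract(1)] by auto
    have c: "card V = Suc (card ?V)" using finV yV by (metis card_Suc_Diff1)
    have "card ?E \<le> card E" using finE by (rule card_contr_le)
    then have lt: "card ?V + card ?E < card V + card E" using c by linarith
    \<comment> \<open>At most \<open>2 * D\<close> arcs are lost, exactly what the disappearance of
      one vertex permits.\<close>
    have "card E \<le> card ?E + 2 + 2 * (D - 1)" using card_contr_ge[OF sg contract(1)] contract(2) by linarith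
    then have "card E \<le> card ?E + 2 * D" using less.prems(4) by linarith
    moreover have "2 * D * card V = 2 * D * card ?V + 2 * D" using c by simp
    ultimately have "2 * D * card ?V \<le> card ?E" using less.prems(3) by linarith
    from less.hyps[OF lt sgraph_contr[OF sg contract(1)] V2 this less.prems(4)]
    obtain I HE B where "sgraph I HE \<and> I \<noteq> {} \<and> card I \<le> 2 * D \<and> (\<forall>h\<in>I. D \<le> card (HE `` {h})) \<and>
      model ?V ?E I HE (B :: 'a \<Rightarrow> 'a set)" by blast
    then show ?thesis using model_contr_vimage[OF _ sg contract(1)] by blast
  next
    case final
    \<comment> \<open>If all degrees exceeded \<open>2 * D\<close>, there would be at least
      \<open>2 * D * card V + card V\<close> arcs; with fewer than \<open>2 * D * card V + 2\<close>
      of them only a single vertex is possible, and that has no edge.\<close>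
    have "\<exists>v\<in>V. card (E `` {v}) \<le> 2 * D"
    proof (rule ccontr)
      assume "\<not> ?thesis"
      then have "(\<Sum>v\<in>V. 2 * D + 1) \<le> (\<Sum>v\<in>V. card (E `` {v}))" by (intro sum_mono) auto
      then have "card V * (2 * D + 1) \<le> card E" using card_arcs[OF sg] by simp
      then have "2 * D * card V + card V \<le> card E" by (simp add: algebra_simps)
      then have "card V < 2" using final(1) by linarith
      then have "card V = 1" using \<open>0 < card V\<close> by linarith
      then obtain v where "V = {v}" by (auto simp: card_1_singleton_iff)
      then show False using V2[of v] by simp
    qed
    then obtain v where v: "v \<in> V" "card (E `` {v}) \<le> 2 * D" by auto
    let ?I = "E `` {v}" let ?H = "E \<inter> ?I \<times> ?I"
    have IV: "?I \<subseteq> V" using sgraph_in[OF sg] by auto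
    have "sgraph ?I ?H" using sg IV by (rule sgraph_induced)
    moreover have "D \<le> card (?H `` {h})" if "h \<in> ?I" for h
    proof -
      have "(v, h) \<in> E" using that by auto
      then have "D \<le> card (E `` {v} \<inter> E `` {h})" using final(3) by blast
      moreover have "E `` {v} \<inter> E `` {h} = ?H `` {h}" using that by auto
      ultimately show ?thesis by simp
    qed
    moreover have "model V E ?I ?H (\<lambda>h. {h})" unfolding model_def using IV by auto
    ultimately show ?thesis using v final(2) by metis
  qed
qed

section \<open>Robustness from minimum degree\<close>

lemma robustI:
  assumes "finite I" "\<And>R a b. R \<subseteq> I \<Longrightarrow> card R \<le> q \<Longrightarrow> a \<in> I - R \<Longrightarrow> b \<in> I - R \<Longrightarrow>
    \<exists>C. C \<subseteq> I - R \<and> a \<in> C \<and> b \<in> C \<and> conn HE C \<and> card C \<le> 6"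
  shows "robust I HE q"
  using assms unfolding robust_def by blast

text \<open>After the deletion of \<open>R\<close> two vertices keep at least \<open>d - q\<close>
  neighbours each among at most \<open>D\<close> vertices. Since \<open>2 * (d - q) > D\<close>,
  they have a common one.\<close>

lemma robust_near_clique:
  assumes sg: "sgraph J H" and "card J \<le> D" and deg: "\<And>h. h \<in> J \<Longrightarrow> d \<le> card (H `` {h})" and "D + 2 * q < 2 * d"
  shows "robust J H q"
proof (rule robustI)
  show finJ: "finite J" using sg unfolding sgraph_def by auto
  have symH: "sym H" using sg unfolding sgraph_def by auto
  fix R a b assume R: "R \<subseteq> J" "card R \<le> q" and ab: "a \<in> J - R" "b \<in> J - R"
  have big: "d - q \<le> card (H `` {h} - R)" if "h \<in> J" for h
  proof -
    have "finite R" using R finJ finite_subset by auto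
    then have "card (H `` {h}) - card R \<le> card (H `` {h} - R)" by (rule diff_card_le_card_Diff)
    then show ?thesis using deg[OF that] R(2) by linarith
  qed
  have sub: "H `` {h} - R \<subseteq> J - R" for h using sgraph_in[OF sg] by auto
  have "(H `` {a} - R) \<inter> (H `` {b} - R) \<noteq> {}"
  proof
    assume "(H `` {a} - R) \<inter> (H `` {b} - R) = {}"
    then have "card (H `` {a} - R) + card (H `` {b} - R) = card ((H `` {a} - R) \<union> (H `` {b} - R))"
      using sub finJ by (metis card_Un_disjoint finite_Diff finite_subset)
    also have "\<dots> \<le> card J" using sub finJ by (intro card_mono) auto
    finally show False using big[of a] big[of b] ab assms(2,4) by simp
  qed
  then obtain c where c: "c \<in> J - R" "(a, c) \<in> H" "(b, c) \<in> H" using sub by blast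
  have "(c, b) \<in> H" using c symH by (meson symD)
  have "conn H {c, a}" using conn_insert[OF conn_sing c(2) _ symH] by auto
  then have "conn H {b, c, a}" using conn_insert[OF _ \<open>(c, b) \<in> H\<close> _ symH] by auto
  moreover have "card (set [b, c, a]) \<le> length [b, c, a]" by (rule card_length)
  ultimately show "\<exists>C. C \<subseteq> J - R \<and> a \<in> C \<and> b \<in> C \<and> conn H C \<and> card C \<le> 6"
    using c ab by (intro exI[of _ "{b, c, a}"]) auto
qed

text \<open>Three disjoint closed neighbourhoods outside \<open>R\<close> would need at least
  \<open>3 * (D - q + 1) > 2 * D\<close> vertices. So if \<open>a\<close> and \<open>b\<close> are
  at distance more than two, every vertex is within distance two of one of them. Connectivity gives
  an edge between the two balls, hence a connecting set of at most six vertices.\<close>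

lemma robust_conn:
  assumes sg: "sgraph I H" and cI: "card I \<le> 2 * D" and deg: "\<And>h. h \<in> I \<Longrightarrow> D \<le> card (H `` {h})" and D: "3 * q \<le> D"
    and co: "\<And>R. R \<subseteq> I \<Longrightarrow> card R \<le> q \<Longrightarrow> conn H (I - R)"
  shows "robust I H q"
proof (rule robustI)
  show finI: "finite I" using sg unfolding sgraph_def by auto
  have symH: "sym H" using sg unfolding sgraph_def by auto
  fix R a b assume R: "R \<subseteq> I" "card R \<le> q" and ab: "a \<in> I - R" "b \<in> I - R"
  let ?N = "\<lambda>h. insert h (H `` {h} - R)"
  have Nsym: "u \<in> ?N w" if "w \<in> ?N u" "u \<in> I - R" for u w
    using that symH by (auto dest: symD)
  have Nsub: "?N h \<subseteq> I - R" if "h \<in> I - R" for h using that sgraph_in[OF sg] by auto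
  have Nfin: "finite (?N h)" for h using sgraph_finite_E[OF sg] by auto
  have big: "D - q + 1 \<le> card (?N h)" if "h \<in> I" for h
  proof -
    have "finite R" using R finI finite_subset by auto
    then have "card (H `` {h}) - card R \<le> card (H `` {h} - R)" by (rule diff_card_le_card_Diff)
    moreover have "card (?N h) = Suc (card (H `` {h} - R))"
      using sgraph_irrefl[OF sg] sgraph_finite_E[OF sg] by (intro card_insert_disjoint) auto
    ultimately show ?thesis using deg[OF that] R(2) by linarith
  qed
  let ?A = "\<Union>u\<in>?N a. ?N u" let ?B = "\<Union>u\<in>?N b. ?N u"
  have conn3: "conn H {w, u, z}" if "u \<in> ?N z" "w \<in> ?N u" for w u z
  proof -
    have "conn H {u, z}" using that by (intro conn_insert_eq[OF conn_sing _ _ symH]) auto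
    then show ?thesis by (rule conn_insert_eq[where a = u, OF _ _ _ symH]) (use that in auto)
  qed
  show "\<exists>C. C \<subseteq> I - R \<and> a \<in> C \<and> b \<in> C \<and> conn H C \<and> card C \<le> 6"
  proof (cases "b \<in> ?A")
    case True
    then obtain u where u: "u \<in> ?N a" "b \<in> ?N u" by blast
    then have "u \<in> I - R" using Nsub ab by blast
    moreover have "card (set [b, u, a]) \<le> length [b, u, a]" by (rule card_length)
    ultimately show ?thesis using conn3[OF u] ab by (intro exI[of _ "{b, u, a}"]) auto
  next
    case False
    have dab: "?N a \<inter> ?N b = {}"
    proof (rule ccontr)
      assume "?N a \<inter> ?N b \<noteq> {}"
      then obtain u where "u \<in> ?N a" "u \<in> ?N b" by blast
      moreover from this have "b \<in> ?N u" using Nsym[of u b] ab by blast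
      ultimately show False using False by blast
    qed
    have cover: "w \<in> ?A \<union> ?B" if w: "w \<in> I - R" for w
    proof (rule ccontr)
      assume nw: "w \<notin> ?A \<union> ?B"
      have d1: "?N w \<inter> ?N z = {}" if "z = a \<or> z = b" for z
      proof (rule ccontr)
        assume "?N w \<inter> ?N z \<noteq> {}"
        then obtain u where "u \<in> ?N w" "u \<in> ?N z" by blast
        moreover from this have "w \<in> ?N u" using Nsym[of u w] w by blast
        ultimately show False using nw that by blast
      qed
      have "card (?N a) + card (?N b) = card (?N a \<union> ?N b)"
        using dab Nfin by (metis card_Un_disjoint)
      moreover have "(?N a \<union> ?N b) \<inter> ?N w = {}" using d1[of a] d1[of b] by blast
      then have "card (?N a \<union> ?N b) + card (?N w) = card (?N a \<union> ?N b \<union> ?N w)"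
        using Nfin by (metis card_Un_disjoint finite_UnI)
      moreover have "?N a \<union> ?N b \<union> ?N w \<subseteq> I" using Nsub[of a] Nsub[of b] Nsub[of w] ab w by blast
      then have "card (?N a \<union> ?N b \<union> ?N w) \<le> card I" using finI by (rule card_mono[rotated])
      moreover have "D - q + 1 \<le> card (?N a)" "D - q + 1 \<le> card (?N b)" "D - q + 1 \<le> card (?N w)"
        using big[of a] big[of b] big[of w] ab w by (simp_all only: Diff_iff)
      ultimately show False using cI D by linarith
    qed
    have "a \<in> (I - R) \<inter> ?A" "b \<in> (I - R) - ?A" using ab False by auto
    with co[OF R] obtain u v where uv: "u \<in> (I - R) \<inter> ?A" "v \<in> (I - R) - ?A" "(u, v) \<in> H" by (rule conn_edge)
    obtain u1 where u1: "u1 \<in> ?N a" "u \<in> ?N u1" using uv(1) by blast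
    have "v \<in> ?B" using uv(2) cover[of v] by blast
    then obtain v1 where v1: "v1 \<in> ?N b" "v \<in> ?N v1" by blast
    have in1: "u1 \<in> I - R" "v1 \<in> I - R" using u1 v1 Nsub ab by blast+
    have "conn H ({u, u1, a} \<union> {v, v1, b})"
      using conn3[OF u1] conn3[OF v1] uv(3) symH by (intro conn_Un_edge[of H _ _ u v]) auto
    moreover have "card (set [u, u1, a, v, v1, b]) \<le> length [u, u1, a, v, v1, b]" by (rule card_length)
    moreover have "set [u, u1, a, v, v1, b] = {u, u1, a} \<union> {v, v1, b}" by auto
    ultimately show ?thesis using in1 ab uv by (intro exI[of _ "{u, u1, a} \<union> {v, v1, b}"]) auto
  qed
qed

text \<open>If no deletion of at most \<open>q\<close> vertices disconnects \<open>I\<close>, then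
  \<open>robust_conn\<close> applies to all of \<open>I\<close>. Otherwise the smaller piece
  \<open>J\<close> left by such a deletion has at most \<open>D\<close> vertices and minimum degree
  at least \<open>D - q\<close>, and \<open>robust_near_clique\<close> applies because
  \<open>4 * q < D\<close>.\<close>

lemma robust_part:
  assumes sg: "sgraph I H" and ne: "I \<noteq> {}" and cI: "card I \<le> 2 * D" and deg: "\<And>h. h \<in> I \<Longrightarrow> D \<le> card (H `` {h})"
    and D: "6 * q < D"
  shows "\<exists>J\<subseteq>I. robust J (H \<inter> J \<times> J) q \<and> q < card J"
proof -
  have finI: "finite I" using sg unfolding sgraph_def by auto
  have finN: "finite (H `` {h})" for h using sgraph_finite_E[OF sg] by auto
  show ?thesis
  proof (cases "\<forall>R. R \<subseteq> I \<longrightarrow> card R \<le> q \<longrightarrow> conn H (I - R)")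
    case True
    have "H \<inter> I \<times> I = H" using sg unfolding sgraph_def by auto
    moreover have "robust I H q" using True D by (intro robust_conn[OF sg cI deg]) auto
    moreover obtain h where "h \<in> I" using ne by auto
    then have "D \<le> card (H `` {h})" by (rule deg)
    moreover have "card (H `` {h}) \<le> card I" using finI sgraph_in[OF sg] by (intro card_mono) auto
    ultimately show ?thesis using D by (intro exI[of _ I]) auto
  next
    case False
    then obtain R where R: "R \<subseteq> I" "card R \<le> q" "\<not> conn H (I - R)" by auto
    then obtain P where P: "P \<subseteq> I - R" "P \<noteq> {}" "I - R - P \<noteq> {}" "H \<inter> P \<times> (I - R - P) = {}"
      by (elim not_conn_split)
    have "card P + card (I - R - P) = card (I - R)"
      using P(1) finI by (metis Diff_partition card_Un_disjoint Diff_disjoint finite_Diff finite_subset)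
    moreover have "card (I - R) \<le> card I" using finI by (intro card_mono) auto
    ultimately have "card P \<le> D \<or> card (I - R - P) \<le> D" using cI by linarith
    moreover have "H \<inter> (I - R - P) \<times> P = {}" using P(4) sgraph_sym[OF sg] by blast
    moreover have "I - R - (I - R - P) = P" using P(1) by auto
    ultimately obtain J where J: "J \<subseteq> I - R" "J \<noteq> {}" "card J \<le> D" "H \<inter> J \<times> (I - R - J) = {}"
      using P by (metis Diff_subset)
    let ?H = "H \<inter> J \<times> J"
    have JI: "J \<subseteq> I" using J(1) by auto
    have sgJ: "sgraph J ?H" using sg JI by (rule sgraph_induced)
    have degJ: "D - q \<le> card (?H `` {h})" if h: "h \<in> J" for h
    proof -
      have "H `` {h} - R \<subseteq> ?H `` {h}" using J(4) h sgraph_in[OF sg] by blast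
      moreover have "finite (?H `` {h})" using finN[of h] by (rule finite_subset[rotated]) auto
      ultimately have "card (H `` {h} - R) \<le> card (?H `` {h})" by (metis card_mono)
      moreover have "card (H `` {h}) - card R \<le> card (H `` {h} - R)"
        using R(1) finI by (intro diff_card_le_card_Diff) (rule finite_subset)
      moreover have "D \<le> card (H `` {h})" using h JI by (intro deg) auto
      ultimately show ?thesis using R(2) by linarith
    qed
    have "robust J ?H q" using D J(3) by (intro robust_near_clique[OF sgJ J(3) degJ]) auto
    moreover obtain h where "h \<in> J" using J by auto
    then have "D - q \<le> card (?H `` {h})" by (rule degJ)
    moreover have "card (?H `` {h}) \<le> card J" using finite_subset[OF JI finI] by (intro card_mono) auto
    ultimately show ?thesis using D JI by (intro exI[of _ J]) auto
  qed
qed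

lemma robust_minor:
  assumes sg: "sgraph V E" and "V \<noteq> {}" "2 * D * card V \<le> card E" "6 * q < D"
  shows "\<exists>J HJ B. robust J HJ q \<and> q < card J \<and> irrefl HJ \<and> model V E J HJ (B :: 'a \<Rightarrow> 'a set)"
proof -
  obtain I HE and B :: "'a \<Rightarrow> 'a set" where I: "sgraph I HE" "I \<noteq> {}" "card I \<le> 2 * D"
    "\<And>h. h \<in> I \<Longrightarrow> D \<le> card (HE `` {h})" "model V E I HE B"
    using dense_minor[OF assms(1-3)] assms(4) by force
  obtain J where J: "J \<subseteq> I" "robust J (HE \<inter> J \<times> J) q" "q < card J"
    using robust_part[OF I(1-4) assms(4)] by blast
  have "irrefl (HE \<inter> J \<times> J)" using I(1) unfolding sgraph_def irrefl_def by auto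
  moreover have "model V E J (HE \<inter> J \<times> J) B" using I(5) J(1) by (rule model_subset) auto
  ultimately show ?thesis using J(2,3) by metis
qed

section \<open>Subdivisions in graphs of large minimum degree\<close>

text \<open>\<open>W\<close> is a smallest set with at least \<open>2 * k\<close> vertices and more
  than \<open>2 * g * (card W - k)\<close> arcs. A vertex of degree at most \<open>g\<close> could
  be deleted. For a separation of order at most \<open>k\<close> each side contains a whole
  neighbourhood, hence at least \<open>2 * k\<close> vertices; if both sides missed the arc bound,
  adding up would show that \<open>W\<close> misses it too.\<close>

lemma highly_connected_part:
  assumes sg: "sgraph V E" and ne: "V \<noteq> {}" and deg: "\<And>v. v \<in> V \<Longrightarrow> 2 * g \<le> card (E `` {v})"
    and k: "2 * k \<le> g" "1 \<le> k"
  shows "\<exists>W\<subseteq>V. W \<noteq> {} \<and> (\<forall>v\<in>W. g < card (E `` {v} \<inter> W)) \<and>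
    (\<forall>X Y. sep W (E \<inter> W \<times> W) X Y \<longrightarrow> X - Y \<noteq> {} \<longrightarrow> Y - X \<noteq> {} \<longrightarrow> k < card (X \<inter> Y))"
proof -
  have finV: "finite V" using sg unfolding sgraph_def by auto
  have finE: "finite E" using sg by (rule sgraph_finite_E)
  let ?a = "\<lambda>W. card (E \<inter> W \<times> W)"
  let ?P = "\<lambda>W. W \<subseteq> V \<and> 2 * k \<le> card W \<and> 2 * g * card W < ?a W + 2 * g * k"
  have "?P V"
  proof (intro conjI)
    obtain v where v: "v \<in> V" using ne by auto
    have "card (E `` {v}) \<le> card V" using finV sgraph_in[OF sg] by (intro card_mono) auto
    then show "2 * k \<le> card V" using deg[OF v] k by linarith
    have "(\<Sum>v\<in>V. 2 * g) \<le> (\<Sum>v\<in>V. card (E `` {v}))" using deg by (intro sum_mono)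
    then have "2 * g * card V \<le> card E" using card_arcs[OF sg] by (simp add: mult.commute)
    moreover have "E \<inter> V \<times> V = E" using sg unfolding sgraph_def by auto
    then have "?a V = card E" by simp
    moreover have "0 < 2 * g * k" using k by (intro mult_pos_pos) auto
    ultimately show "2 * g * card V < ?a V + 2 * g * k" by linarith
  qed simp
  then obtain W where W: "?P W" and least: "\<And>W'. ?P W' \<Longrightarrow> card W \<le> card W'"
    using ex_has_least_nat[of ?P V card] by blast
  have finW: "finite W" using W finV finite_subset by blast
  \<comment> \<open>With exactly \<open>2 * k\<close> vertices there is no room for the required
    arcs, so one vertex may be deleted without violating the size condition.\<close>
  have big: "2 * k < card W"
  proof (rule ccontr)
    assume "\<not> ?thesis"
    then have c: "card W = 2 * k" using W by linarith
    have "?a W \<le> card (W \<times> W)" using finW by (intro card_mono) auto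
    then have "?a W \<le> (2 * k) * (2 * k)" using c by (simp add: card_cartesian_product)
    also have "\<dots> \<le> g * (2 * k)" using k by (intro mult_le_mono1)
    finally have "?a W \<le> 2 * g * k" by (simp add: ac_simps)
    moreover have "2 * g * card W = 2 * g * k + 2 * g * k" using c by simp
    ultimately show False using W by linarith
  qed
  have degW: "g < card (E `` {v} \<inter> W)" if v: "v \<in> W" for v
  proof (rule ccontr)
    assume no: "\<not> ?thesis"
    let ?N = "E `` {v} \<inter> W" let ?W = "W - {v}"
    have finN: "finite ?N" using finW by auto
    have "E \<inter> W \<times> W \<subseteq> (E \<inter> ?W \<times> ?W) \<union> ({v} \<times> ?N \<union> ?N \<times> {v})"
    proof (rule subrelI)
      fix a b assume ab: "(a, b) \<in> E \<inter> W \<times> W"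
      then have "(b, a) \<in> E" using sgraph_sym[OF sg] by auto
      then show "(a, b) \<in> (E \<inter> ?W \<times> ?W) \<union> ({v} \<times> ?N \<union> ?N \<times> {v})" using ab by auto
    qed
    then have "?a W \<le> card ((E \<inter> ?W \<times> ?W) \<union> ({v} \<times> ?N \<union> ?N \<times> {v}))"
      using finE finN by (intro card_mono) auto
    also have "\<dots> \<le> ?a ?W + (card ({v} \<times> ?N) + card (?N \<times> {v}))"
      by (meson card_Un_le le_trans add_left_mono)
    also have "\<dots> = ?a ?W + 2 * card ?N" by (simp add: card_cartesian_product)
    finally have aW: "?a W \<le> ?a ?W + 2 * g" using no by linarith
    have c: "card W = card ?W + 1" using card_Suc_Diff1[OF finW v] by simp
    then have "2 * g * card W = 2 * g * card ?W + 2 * g" by simp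
    then have "?P ?W" using W aW big c by auto
    then show False using least[of ?W] c by linarith
  qed
  have "k < card (X \<inter> Y)" if s: "sep W (E \<inter> W \<times> W) X Y" and ne: "X - Y \<noteq> {}" "Y - X \<noteq> {}" for X Y
  proof (rule ccontr)
    assume no: "\<not> ?thesis"
    have XY: "X \<union> Y = W" and noe: "(E \<inter> W \<times> W) \<inter> (X - Y) \<times> (Y - X) = {}" using s unfolding sep_def by auto
    have noe': "(a, b) \<notin> E" if "a \<in> X - Y" "b \<in> Y - X" for a b using that noe XY by auto
    have finXY: "finite X" "finite Y" using finW XY by (metis finite_Un)+
    obtain x where x: "x \<in> X - Y" using ne by auto
    obtain y where y: "y \<in> Y - X" using ne by auto
    have "E `` {x} \<inter> W \<subseteq> X" using noe' x XY by auto
    then have "card (E `` {x} \<inter> W) \<le> card X" using finXY by (metis card_mono)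
    then have cX: "2 * k \<le> card X" using degW[of x] x XY k by auto
    have "E `` {y} \<inter> W \<subseteq> Y" using noe' y XY sgraph_sym[OF sg] by blast
    then have "card (E `` {y} \<inter> W) \<le> card Y" using finXY by (metis card_mono)
    then have cY: "2 * k \<le> card Y" using degW[of y] y XY k by auto
    have "X \<subset> W" "Y \<subset> W" using x y XY by auto
    then have lt: "card X < card W" "card Y < card W" using finW by (simp_all add: psubset_card_mono)
    have "\<not> ?P X" "\<not> ?P Y" using least lt by (meson not_less)+
    then have aXY: "?a X + 2 * g * k \<le> 2 * g * card X" "?a Y + 2 * g * k \<le> 2 * g * card Y"
      using cX cY XY W by auto
    have "E \<inter> W \<times> W \<subseteq> (E \<inter> X \<times> X) \<union> (E \<inter> Y \<times> Y)"
    proof (rule subrelI)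
      fix a b assume ab: "(a, b) \<in> E \<inter> W \<times> W"
      then have "(b, a) \<in> E" using sgraph_sym[OF sg] by auto
      then show "(a, b) \<in> (E \<inter> X \<times> X) \<union> (E \<inter> Y \<times> Y)" using ab noe' XY by blast
    qed
    then have "?a W \<le> card ((E \<inter> X \<times> X) \<union> (E \<inter> Y \<times> Y))" using finE by (intro card_mono) auto
    then have aW: "?a W \<le> ?a X + ?a Y" by (meson card_Un_le le_trans)
    have "card X + card Y = card W + card (X \<inter> Y)" using card_Un_Int[OF finXY] XY by simp
    then have "2 * g * card X + 2 * g * card Y = 2 * g * card W + 2 * g * card (X \<inter> Y)"
      by (metis add_mult_distrib2)
    moreover have "2 * g * card (X \<inter> Y) \<le> 2 * g * k" using no by (intro mult_le_mono2) simp
    ultimately show False using aW aXY W by linarith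
  qed
  moreover have "W \<noteq> {}" using big by auto
  ultimately show ?thesis using degW W by (intro exI[of _ W]) blast
qed

lemma distinct_representatives:
  assumes "finite J" "card J \<le> n" "\<And>j. j \<in> J \<Longrightarrow> n \<le> card (A j)"
  shows "\<exists>z. inj_on z J \<and> (\<forall>j\<in>J. z j \<in> A j)"
  using assms
proof (induction J rule: finite_induct)
  case (insert j J)
  then obtain z where z: "inj_on z J" "\<forall>j\<in>J. z j \<in> A j" by auto
  have "card (z ` J) \<le> card J" using insert.hyps(1) by (rule card_image_le)
  then have "card (z ` J) < card (A j)" using insert.prems(1) insert.prems(2)[of j] insert.hyps by simp
  then have "\<not> A j \<subseteq> z ` J" using insert.hyps(1) card_mono[of "z ` J" "A j"] by auto
  then obtain v where v: "v \<in> A j" "v \<notin> z ` J" by auto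
  have "inj_on (z(j := v)) (insert j J)"
    using z(1) v(2) insert.hyps(2) by (auto simp: inj_on_def)
  moreover have "\<forall>i\<in>insert j J. (z(j := v)) i \<in> A i" using z(2) v insert.hyps(2) by auto
  ultimately show ?case by blast
qed auto

text \<open>\<open>T\<close> is the set of branch vertices and \<open>C {u, v}\<close> a connected set that contains the inner vertices
  of the path between \<open>u\<close> and \<open>v\<close>; it is empty for an undivided edge.\<close>

definition has_TK :: "nat \<Rightarrow> 'a set \<Rightarrow> 'a rel \<Rightarrow> bool" where
  "has_TK t V E \<longleftrightarrow> (\<exists>T C. T \<subseteq> V \<and> finite T \<and> card T = t \<and>
     (\<forall>u\<in>T. \<forall>v\<in>T. u \<noteq> v \<longrightarrow>
        (u, v) \<in> E \<and> C {u, v} = {} \<or>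
        C {u, v} \<subseteq> V - T \<and> conn E (C {u, v}) \<and> (\<exists>a\<in>C {u, v}. \<exists>b\<in>C {u, v}. (u, a) \<in> E \<and> (v, b) \<in> E)) \<and>
     (\<forall>e e'. e \<subseteq> T \<longrightarrow> e' \<subseteq> T \<longrightarrow> card e = 2 \<longrightarrow> card e' = 2 \<longrightarrow> e \<noteq> e' \<longrightarrow> C e \<inter> C e' = {}))"

text \<open>\<open>T\<close> is arbitrary, and \<open>z (u, v)\<close> is the private neighbour of
  \<open>u\<close> for the path to \<open>v\<close>, which makes \<open>p = t * (t - 1)\<close>
  terminals. Connectivity above \<open>t^2 = p + t\<close> survives the loss of \<open>T\<close>.
  With \<open>q = 8 * t^2\<close> for the linkage, \<open>robust_minor\<close> needs
  \<open>D > 48 * t^2\<close>. So \<open>D\<close> is \<open>49 * t^2\<close>, the degree is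
  \<open>98 * t^2\<close> without \<open>T\<close> and \<open>99 * t^2\<close> with it, and
  \<open>highly_connected_part\<close> halves the initial \<open>198 * t^2\<close>.\<close>

lemma has_TK_of_min_degree:
  assumes sg: "sgraph V E" and ne: "V \<noteq> {}" and t: "1 \<le> t"
    and deg: "\<And>v. v \<in> V \<Longrightarrow> 198 * t^2 \<le> card (E `` {v})"
  shows "has_TK t V E"
proof -
  have finE: "finite E" using sg by (rule sgraph_finite_E)
  have tt: "t \<le> t^2" "1 \<le> t^2" using t by (auto simp: power2_eq_square)
  obtain W where W: "W \<subseteq> V" "W \<noteq> {}" and degW: "\<And>v. v \<in> W \<Longrightarrow> 99 * t^2 < card (E `` {v} \<inter> W)"
    and con: "\<And>X Y. sep W (E \<inter> W \<times> W) X Y \<Longrightarrow> X - Y \<noteq> {} \<Longrightarrow> Y - X \<noteq> {} \<Longrightarrow> t^2 < card (X \<inter> Y)"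
    using highly_connected_part[OF sg ne, of "99 * t^2" "t^2"] deg tt by auto
  have finW: "finite W" using W sg finite_subset unfolding sgraph_def by blast
  obtain w where "w \<in> W" using W by auto
  then have "99 * t^2 < card (E `` {w} \<inter> W)" by (rule degW)
  also have "\<dots> \<le> card W" using finW by (intro card_mono) auto
  finally have cW: "99 * t^2 < card W" .
  then have "t \<le> card W" using tt by linarith
  then obtain T where T: "T \<subseteq> W" "card T = t" "finite T" by (meson obtain_subset_with_card_n)
  let ?Pr = "Sigma T (\<lambda>u. T - {u})"
  define p where "p = card ?Pr"
  have "p = (\<Sum>u\<in>T. card (T - {u}))" unfolding p_def using T by (intro card_SigmaI) auto
  also have "\<dots> = t * (t - 1)" using T by simp
  finally have p: "p + t = t^2" using t by (simp add: power2_eq_square algebra_simps)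
  have finPr: "finite ?Pr" using T by auto
  let ?W = "W - T" let ?E = "E \<inter> ?W \<times> ?W"
  have deg2: "98 * t^2 \<le> card (E `` {v} \<inter> ?W)" if "v \<in> W" for v
  proof -
    have "card (E `` {v} \<inter> W) - card T \<le> card (E `` {v} \<inter> W - T)"
      using T by (intro diff_card_le_card_Diff)
    moreover have "E `` {v} \<inter> W - T = E `` {v} \<inter> ?W" by auto
    ultimately show ?thesis using degW[OF that] T(2) tt by simp
  qed
  obtain z where z: "inj_on z ?Pr" "\<And>j. j \<in> ?Pr \<Longrightarrow> z j \<in> E `` {fst j} \<inter> ?W"
  proof -
    have "98 * t^2 \<le> card (E `` {fst j} \<inter> ?W)" if "j \<in> ?Pr" for j using that T(1) by (intro deg2) auto
    then have "p \<le> card (E `` {fst j} \<inter> ?W)" if "j \<in> ?Pr" for j using that p by fastforce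
    then show ?thesis using distinct_representatives[OF finPr, of p "\<lambda>j. E `` {fst j} \<inter> ?W"] that p_def by auto
  qed
  let ?Z = "z ` ?Pr"
  have Z: "?Z \<subseteq> ?W" "card ?Z = p" using z by (auto simp: card_image p_def)
  have sg2: "sgraph ?W ?E" using sg W(1) by (intro sgraph_induced) auto
  have "card (W - T) \<noteq> 0" using diff_card_le_card_Diff[OF T(3), of W] cW T(2) tt by linarith
  then have ne2: "?W \<noteq> {}" by (metis card.empty)
  have "(\<Sum>v\<in>?W. 98 * t^2) \<le> (\<Sum>v\<in>?W. card (?E `` {v}))"
  proof (rule sum_mono)
    fix v assume v: "v \<in> ?W"
    then have "?E `` {v} = E `` {v} \<inter> ?W" by auto
    then show "98 * t^2 \<le> card (?E `` {v})" using deg2[of v] v by simp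
  qed
  then have e2: "2 * (49 * t^2) * card ?W \<le> card ?E" using card_arcs[OF sg2] by (simp add: mult.commute)
  obtain J HJ and B :: "'a \<Rightarrow> 'a set" where J: "robust J HJ (8 * t^2)" "8 * t^2 < card J" "irrefl HJ" "model ?W ?E J HJ B"
  proof -
    have "6 * (8 * t^2) < 49 * t^2" using tt by linarith
    then show ?thesis using robust_minor[OF sg2 ne2 e2] that by blast
  qed
  have free: "p \<le> card (X \<inter> Y)" if s: "sep ?W ?E X Y" "?Z \<subseteq> X" "h \<in> J" "B h \<subseteq> Y - X" for X Y h
  proof (rule ccontr)
    assume no: "\<not> ?thesis"
    have XY: "X \<union> Y = ?W" and noe: "?E \<inter> (X - Y) \<times> (Y - X) = {}" using s(1) unfolding sep_def by auto
    have finXY: "finite (X \<inter> Y)" using XY finW by (metis finite_Diff finite_Int finite_Un)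
    \<comment> \<open>Putting \<open>T\<close> into both sides turns a separation of the rest into
      one of \<open>W\<close> and raises the order by at most \<open>t\<close>.\<close>
    have "sep W (E \<inter> W \<times> W) (X \<union> T) (Y \<union> T)"
      unfolding sep_def using XY noe T(1) by auto
    moreover have "(X \<union> T) - (Y \<union> T) \<noteq> {}"
    proof
      assume "(X \<union> T) - (Y \<union> T) = {}"
      then have "?Z \<subseteq> X \<inter> Y" using s(2) XY by auto
      then have "p \<le> card (X \<inter> Y)" using Z(2) finXY by (metis card_mono)
      then show False using no by simp
    qed
    moreover have "(Y \<union> T) - (X \<union> T) \<noteq> {}"
    proof -
      obtain b where "b \<in> B h" using modelD(2)[OF J(4) s(3)] by auto
      then have "b \<in> Y - X" using s(4) by auto
      then show ?thesis using XY by auto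
    qed
    ultimately have "t^2 < card ((X \<union> T) \<inter> (Y \<union> T))" by (rule con)
    also have "(X \<union> T) \<inter> (Y \<union> T) = (X \<inter> Y) \<union> T" by auto
    also have "card \<dots> \<le> card (X \<inter> Y) + card T" by (rule card_Un_le)
    finally show False using no p T(2) by linarith
  qed
  \<comment> \<open>The two terminals that belong to the edge \<open>e\<close>; the linkage indexes
    its sets by such pairs, \<open>C\<close> by edges.\<close>
  define m where "m e = z ` {j\<in>?Pr. {fst j, snd j} = e}" for e
  let ?Es = "{e. e \<subseteq> T \<and> card e = 2}"
  have Es: "\<exists>u v. u \<noteq> v \<and> e = {u, v} \<and> u \<in> T \<and> v \<in> T" if "e \<in> ?Es" for e
    using that by (auto simp: card_2_iff)
  have m_eq: "m {u, v} = {z (u, v), z (v, u)}" if "u \<in> T" "v \<in> T" "u \<noteq> v" for u v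
  proof -
    have "{j\<in>?Pr. {fst j, snd j} = {u, v}} = {(u, v), (v, u)}" using that by (auto simp: doubleton_eq_iff)
    then show ?thesis unfolding m_def by simp
  qed
  have mdisj: "m e \<inter> m e' = {}" if "e \<noteq> e'" for e e'
  proof (rule ccontr)
    assume "m e \<inter> m e' \<noteq> {}"
    then obtain j j' where "j \<in> ?Pr" "j' \<in> ?Pr" "{fst j, snd j} = e" "{fst j', snd j'} = e'" "z j = z j'"
      unfolding m_def by auto
    moreover from this have "j = j'" using z(1) by (meson inj_onD)
    ultimately show False using that by simp
  qed
  define M where "M = m ` ?Es"
  have finEs: "finite ?Es" using T(3) by auto
  have "\<exists>L. (\<forall>x\<in>M. x \<subseteq> L x \<and> L x \<subseteq> ?W \<and> conn ?E (L x)) \<and> (\<forall>x\<in>M. \<forall>x'\<in>M. x \<noteq> x' \<longrightarrow> L x \<inter> L x' = {})"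
  proof (rule linkage[OF sg2 Z J(4,1) _ J(2,3) free])
    show "8 * p \<le> 8 * t^2" using p by simp
    show "x \<subseteq> ?Z \<and> (\<exists>s t. x = {s, t})" if "x \<in> M" for x
    proof -
      obtain e where e: "e \<in> ?Es" "x = m e" using \<open>x \<in> M\<close> M_def by auto
      then obtain u v where "u \<noteq> v" "e = {u, v}" "u \<in> T" "v \<in> T" using Es by blast
      then have "x = {z (u, v), z (v, u)}" using m_eq e(2) by simp
      then show ?thesis using e(2) unfolding m_def by auto
    qed
    show "disjoint M"
    proof (rule disjointI)
      fix a b assume "a \<in> M" "b \<in> M" "a \<noteq> b"
      then obtain e e' where "a = m e" "b = m e'" "e \<noteq> e'" unfolding M_def by auto
      then show "a \<inter> b = {}" using mdisj by simp
    qed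
    have "?Es \<subseteq> (\<lambda>j. {fst j, snd j}) ` ?Pr"
    proof
      fix e assume "e \<in> ?Es"
      then obtain u v where "u \<noteq> v" "e = {u, v}" "u \<in> T" "v \<in> T" using Es by blast
      then show "e \<in> (\<lambda>j. {fst j, snd j}) ` ?Pr" by (intro image_eqI[of _ _ "(u, v)"]) auto
    qed
    then have "card ?Es \<le> p" unfolding p_def using finPr by (meson card_image_le card_mono finite_imageI le_trans)
    then show "card M \<le> p" using card_image_le[OF finEs, of m] M_def by simp
  qed
  then obtain L where L: "\<forall>x\<in>M. x \<subseteq> L x \<and> L x \<subseteq> ?W \<and> conn ?E (L x)"
    "\<forall>x\<in>M. \<forall>x'\<in>M. x \<noteq> x' \<longrightarrow> L x \<inter> L x' = {}" by (elim exE conjE) (rule that)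
  define C where "C e = L (m e)" for e
  have "C {u, v} \<subseteq> V - T \<and> conn E (C {u, v}) \<and> (\<exists>a\<in>C {u, v}. \<exists>b\<in>C {u, v}. (u, a) \<in> E \<and> (v, b) \<in> E)"
    if uv: "u \<in> T" "v \<in> T" "u \<noteq> v" for u v
  proof -
    have "m {u, v} \<in> M" unfolding M_def using uv by (intro imageI) auto
    then have l: "m {u, v} \<subseteq> C {u, v}" "C {u, v} \<subseteq> ?W" "conn ?E (C {u, v})" using L(1) unfolding C_def by blast+
    have "conn E (C {u, v})" using l(3) by (rule conn_mono) auto
    moreover have "z (u, v) \<in> C {u, v}" "z (v, u) \<in> C {u, v}" using l(1) m_eq[OF uv] by auto
    moreover have "(u, z (u, v)) \<in> E" "(v, z (v, u)) \<in> E" using z(2)[of "(u, v)"] z(2)[of "(v, u)"] uv by auto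
    ultimately show ?thesis using l(2) W(1) by blast
  qed
  moreover have "C e \<inter> C e' = {}" if e: "e \<in> ?Es" "e' \<in> ?Es" "e \<noteq> e'" for e e'
  proof -
    have "m e \<in> M" "m e' \<in> M" unfolding M_def using e by auto
    obtain u v where "u \<noteq> v" "e = {u, v}" "u \<in> T" "v \<in> T" using Es[OF e(1)] by blast
    then have "m e \<noteq> {}" using m_eq by simp
    then have "m e \<noteq> m e'" using mdisj[OF e(3)] by auto
    then show ?thesis using L(2) \<open>m e \<in> M\<close> \<open>m e' \<in> M\<close> unfolding C_def by blast
  qed
  ultimately have "\<forall>u\<in>T. \<forall>v\<in>T. u \<noteq> v \<longrightarrow> (u, v) \<in> E \<and> C {u, v} = {} \<or>
      C {u, v} \<subseteq> V - T \<and> conn E (C {u, v}) \<and> (\<exists>a\<in>C {u, v}. \<exists>b\<in>C {u, v}. (u, a) \<in> E \<and> (v, b) \<in> E)"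
    "\<forall>e e'. e \<subseteq> T \<longrightarrow> e' \<subseteq> T \<longrightarrow> card e = 2 \<longrightarrow> card e' = 2 \<longrightarrow> e \<noteq> e' \<longrightarrow> C e \<inter> C e' = {}"
    by (simp_all only: mem_Collect_eq) blast+
  then show ?thesis unfolding has_TK_def using T W(1) by (intro exI[of _ T] exI[of _ C]) simp
qed

section \<open>From connected sets to the relation \<open>subdivision_pair\<close>\<close>

lemma rtrancl_path:
  assumes "(a, b) \<in> (E \<inter> S \<times> S)\<^sup>*" "a \<in> S" "b \<in> S"
  shows "\<exists>ws. ws \<noteq> [] \<and> distinct ws \<and> hd ws = a \<and> last ws = b \<and> set ws \<subseteq> S \<and> successively (\<lambda>x y. (x, y) \<in> E) ws"
  using assms
proof (induction rule: converse_rtrancl_induct)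
  case base
  then show ?case by (intro exI[of _ "[b]"]) auto
next
  case (step a c)
  then obtain ws where ws: "ws \<noteq> []" "distinct ws" "hd ws = c" "last ws = b" "set ws \<subseteq> S"
    "successively (\<lambda>x y. (x, y) \<in> E) ws" by auto
  show ?case
  proof (cases "a \<in> set ws")
    case False
    then show ?thesis using ws step by (intro exI[of _ "a # ws"]) (auto simp: successively_Cons)
  next
    case True
    \<comment> \<open>The walk returns to \<open>a\<close>, and its tail from that visit on is
      already a path from \<open>a\<close>.\<close>
    then obtain us vs where "ws = us @ a # vs" by (meson split_list)
    then show ?thesis using ws by (intro exI[of _ "a # vs"]) (auto simp: successively_append_iff)
  qed
qed

fun path_arcs :: "'a \<Rightarrow> 'a list \<Rightarrow> 'a \<Rightarrow> 'a rel" where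
  "path_arcs u [] v = {(u, v), (v, u)}"
| "path_arcs u (w # ws) v = {(u, w), (w, u)} \<union> path_arcs w ws v"

lemma path_arcs_subset:
  assumes "sym E" "successively (\<lambda>x y. (x, y) \<in> E) (u # ws @ [v])"
  shows "path_arcs u ws v \<subseteq> E"
  using assms(2)
proof (induction ws arbitrary: u)
  case Nil
  then show ?case using symD[OF assms(1)] by auto
next
  case (Cons w ws)
  then show ?case using symD[OF assms(1)] by auto
qed

text \<open>After subdividing \<open>(u, v)\<close> by \<open>w\<close>, the rest of the list
  subdivides \<open>(w, v)\<close>: the start moves along the path while \<open>v\<close>
  stays.\<close>

lemma subdivision_insert_path:
  assumes "subdivision_pair K H" "(u, v) \<in> parcs H" "distinct ws" "set ws \<inter> pverts H = {}"
  shows "\<exists>H'. subdivision_pair K H' \<and> pverts H' = pverts H \<union> set ws \<and>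
    parcs H' = (parcs H - {(u, v), (v, u)}) \<union> path_arcs u ws v"
  using assms
proof (induction ws arbitrary: H u)
  case Nil
  interpret H: pair_bidirected_digraph H using Nil.prems(1) by (rule bidirected_digraphI_subdivision)
  have "(v, u) \<in> parcs H" using H.arcs_symmetric Nil.prems(2) by auto
  then have "parcs H = (parcs H - {(u, v), (v, u)}) \<union> path_arcs u [] v" using Nil.prems(2) by auto
  then show ?case using Nil.prems(1) by (intro exI[of _ H]) simp
next
  case (Cons w ws)
  interpret H: pair_bidirected_digraph H using Cons.prems(1) by (rule bidirected_digraphI_subdivision)
  let ?H = "subdivide H (u, v) w"
  have uv: "u \<in> pverts H" "v \<in> pverts H" "u \<noteq> v"
    using Cons.prems(2) H.wellformed'(1) H.wellformed'(2) H.adj_not_same by auto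
  have w: "w \<notin> pverts H" using Cons.prems(4) by auto
  have nw: "(w, a) \<notin> parcs H" "(a, w) \<notin> parcs H" for a using w H.wellformed' by blast+
  have sd: "subdivision_pair K ?H" using Cons.prems(2) w Cons.prems(1) by (rule subdivision_pair_divide)
  have pv: "pverts ?H = pverts H \<union> {w}" by (simp add: subdivide.simps)
  have pa: "parcs ?H = (parcs H - {(u, v), (v, u)}) \<union> {(u, w), (w, u), (w, v), (v, w)}" by (simp add: subdivide.simps)
  obtain H' where H': "subdivision_pair K H'" "pverts H' = pverts ?H \<union> set ws"
    "parcs H' = (parcs ?H - {(w, v), (v, w)}) \<union> path_arcs w ws v"
    using Cons.IH[OF sd, of w] Cons.prems(3,4) pa pv by auto
  have "parcs ?H - {(w, v), (v, w)} = (parcs H - {(u, v), (v, u)}) \<union> {(u, w), (w, u)}"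
    unfolding pa using nw uv w by auto
  then show ?case using H' pv by (intro exI[of _ H']) auto
qed

lemma contains_complete_subdivision_of_has_TK:
  assumes G: "pair_graph G" and tk: "has_TK t (pverts G) (parcs G)"
  shows "contains_complete_subdivision t G"
proof -
  interpret G: pair_graph G by fact
  have symG: "sym (parcs G)" using G.arcs_symmetric by (auto intro: symI)
  obtain T C where T: "T \<subseteq> pverts G" "finite T" "card T = t"
    and C0: "\<forall>u\<in>T. \<forall>v\<in>T. u \<noteq> v \<longrightarrow> (u, v) \<in> parcs G \<and> C {u, v} = {} \<or>
        C {u, v} \<subseteq> pverts G - T \<and> conn (parcs G) (C {u, v}) \<and>
        (\<exists>a\<in>C {u, v}. \<exists>b\<in>C {u, v}. (u, a) \<in> parcs G \<and> (v, b) \<in> parcs G)"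
    and Cd0: "\<forall>e e'. e \<subseteq> T \<longrightarrow> e' \<subseteq> T \<longrightarrow> card e = 2 \<longrightarrow> card e' = 2 \<longrightarrow> e \<noteq> e' \<longrightarrow> C e \<inter> C e' = {}"
    using tk unfolding has_TK_def by (elim exE conjE) (rule that)
  note C = C0[rule_format] and Cd = Cd0[rule_format]
  let ?Es = "{e. e \<subseteq> T \<and> card e = 2}"
  \<comment> \<open>An unordered pair is oriented once, together with the choice of its path, so
    that \<open>path_arcs\<close> can be applied.\<close>
  have "\<exists>u v ws. e = {u, v} \<and> u \<noteq> v \<and> distinct ws \<and> set ws \<subseteq> C e \<and> C e \<subseteq> pverts G - T \<and> path_arcs u ws v \<subseteq> parcs G"
    if e: "e \<in> ?Es" for e
  proof -
    obtain u v where uv: "u \<noteq> v" "e = {u, v}" "u \<in> T" "v \<in> T" using e by (auto simp: card_2_iff)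
    from C[OF uv(3,4,1)] show ?thesis
    proof
      assume "(u, v) \<in> parcs G \<and> C {u, v} = {}"
      then have "path_arcs u [] v \<subseteq> parcs G" "C e = {}" using symD[OF symG] uv by auto
      then show ?thesis using uv by (intro exI[of _ u] exI[of _ v] exI[of _ "[]"]) auto
    next
      assume *: "C {u, v} \<subseteq> pverts G - T \<and> conn (parcs G) (C {u, v}) \<and>
        (\<exists>a\<in>C {u, v}. \<exists>b\<in>C {u, v}. (u, a) \<in> parcs G \<and> (v, b) \<in> parcs G)"
      then obtain a b where ab: "a \<in> C e" "b \<in> C e" "(u, a) \<in> parcs G" "(v, b) \<in> parcs G" using uv by auto
      have "(a, b) \<in> (parcs G \<inter> C e \<times> C e)\<^sup>*" using * ab uv(2) unfolding conn_def by blast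
      then obtain ws where ws: "ws \<noteq> []" "distinct ws" "hd ws = a" "last ws = b" "set ws \<subseteq> C e"
        "successively (\<lambda>x y. (x, y) \<in> parcs G) ws" using rtrancl_path[of a b "parcs G" "C e"] ab by metis
      have "(b, v) \<in> parcs G" using ab(4) symG by (meson symD)
      then have "successively (\<lambda>x y. (x, y) \<in> parcs G) (u # ws @ [v])"
        using ws ab(3) by (auto simp: successively_Cons successively_append_iff)
      then have "path_arcs u ws v \<subseteq> parcs G" using symG by (intro path_arcs_subset)
      then show ?thesis using * ws uv by blast
    qed
  qed
  then have "\<forall>e\<in>?Es. \<exists>w. e = {fst w, fst (snd w)} \<and> fst w \<noteq> fst (snd w) \<and> distinct (snd (snd w)) \<and>
      set (snd (snd w)) \<subseteq> C e \<and> C e \<subseteq> pverts G - T \<and> path_arcs (fst w) (snd (snd w)) (fst (snd w)) \<subseteq> parcs G"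
    by simp
  then obtain w where w: "\<forall>e\<in>?Es. e = {fst (w e), fst (snd (w e))} \<and> fst (w e) \<noteq> fst (snd (w e)) \<and>
      distinct (snd (snd (w e))) \<and> set (snd (snd (w e))) \<subseteq> C e \<and> C e \<subseteq> pverts G - T \<and>
      path_arcs (fst (w e)) (snd (snd (w e))) (fst (snd (w e))) \<subseteq> parcs G"
    by (rule bchoice[THEN exE])
  define fu fv fw where "fu e = fst (w e)" and "fv e = fst (snd (w e))" and "fw e = snd (snd (w e))" for e
  have f: "e = {fu e, fv e} \<and> fu e \<noteq> fv e \<and> distinct (fw e) \<and>
      set (fw e) \<subseteq> C e \<and> C e \<subseteq> pverts G - T \<and> path_arcs (fu e) (fw e) (fv e) \<subseteq> parcs G" if "e \<in> ?Es" for e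
    using w that unfolding fu_def fv_def fw_def by (rule bspec)
  let ?rest = "\<lambda>F. {(u, v). u \<in> T \<and> v \<in> T \<and> u \<noteq> v \<and> {u, v} \<notin> F}"
  define K where "K = \<lparr>pverts = T, parcs = ?rest {}\<rparr>"
  have K: "complete_digraph t (with_proj K)"
    unfolding complete_digraph_pair_def K_def using T by auto
  then interpret K: pair_graph K unfolding complete_digraph_def by (auto intro: pair_graphI_graph)
  have finEs: "finite ?Es" using T by auto
  \<comment> \<open>The edges in \<open>F\<close> have been replaced. The others may be absent from
    \<open>G\<close>, so the intermediate graphs are no subgraphs of \<open>G\<close>; the lower
    bound on \<open>parcs H\<close> guarantees that the next edge is still there.\<close>
  have "\<exists>H. subdivision_pair K H \<and> pverts H = T \<union> (\<Union>e\<in>F. set (fw e)) \<and> ?rest F \<subseteq> parcs H \<and>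
      parcs H \<subseteq> ?rest F \<union> (\<Union>e\<in>F. path_arcs (fu e) (fw e) (fv e))"
    if "finite F" "F \<subseteq> ?Es" for F
    using that
  proof (induction F rule: finite_induct)
    case empty
    have "pair_bidirected_digraph K" by unfold_locales
    then have "subdivision_pair K K" by (rule subdivision_pair_base)
    then show ?case by (intro exI[of _ K]) (simp add: K_def)
  next
    case (insert e F)
    then obtain H where H: "subdivision_pair K H" "pverts H = T \<union> (\<Union>e\<in>F. set (fw e))" "?rest F \<subseteq> parcs H"
      "parcs H \<subseteq> ?rest F \<union> (\<Union>e\<in>F. path_arcs (fu e) (fw e) (fv e))" by blast
    have eE: "e \<in> ?Es" and FE: "F \<subseteq> ?Es" using insert.prems by auto
    note fe = f[OF eE]
    have uvT: "fu e \<in> T" "fv e \<in> T" using fe eE by blast+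
    then have "(fu e, fv e) \<in> ?rest F" using fe insert.hyps(2) by auto
    then have uv: "(fu e, fv e) \<in> parcs H" using H(3) by blast
    have "set (fw e) \<inter> set (fw e') = {}" if "e' \<in> F" for e'
    proof -
      have "e' \<in> ?Es" "e \<noteq> e'" using that FE insert.hyps(2) by auto
      then have "C e \<inter> C e' = {}" using Cd eE by auto
      moreover have "set (fw e') \<subseteq> C e'" using f[OF \<open>e' \<in> ?Es\<close>] by auto
      ultimately show ?thesis using fe by blast
    qed
    moreover have "set (fw e) \<inter> T = {}" using fe by blast
    ultimately have disj: "set (fw e) \<inter> pverts H = {}" unfolding H(2) by blast
    have "distinct (fw e)" using fe by simp
    from subdivision_insert_path[OF H(1) uv this disj] obtain H' where H': "subdivision_pair K H'" "pverts H' = pverts H \<union> set (fw e)"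
      "parcs H' = (parcs H - {(fu e, fv e), (fv e, fu e)}) \<union> path_arcs (fu e) (fw e) (fv e)"
      by (elim exE conjE) (rule that)
    have rest: "?rest (insert e F) = ?rest F - {(fu e, fv e), (fv e, fu e)}"
    proof -
      have "{u, v} = e \<longleftrightarrow> (u, v) = (fu e, fv e) \<or> (u, v) = (fv e, fu e)" for u v
        using fe by (metis doubleton_eq_iff prod.inject)
      then show ?thesis by auto
    qed
    have "?rest (insert e F) \<subseteq> parcs H'" unfolding rest H'(3) using H(3) by blast
    moreover have "parcs H' \<subseteq> ?rest (insert e F) \<union> (\<Union>e\<in>insert e F. path_arcs (fu e) (fw e) (fv e))"
      unfolding rest H'(3) using H(4) by blast
    moreover have "pverts H' = T \<union> (\<Union>e\<in>insert e F. set (fw e))" unfolding H'(2) H(2) by auto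
    ultimately show ?case using H'(1) by (intro exI[of _ H'] conjI)
  qed
  from this[OF finEs order_refl] obtain H where H: "subdivision_pair K H"
    "pverts H = T \<union> (\<Union>e\<in>?Es. set (fw e))" "parcs H \<subseteq> ?rest ?Es \<union> (\<Union>e\<in>?Es. path_arcs (fu e) (fw e) (fv e))" by (elim exE conjE) (rule that)
  have "card {u, v} = 2" if "u \<noteq> v" for u v :: 'a using that by simp
  then have none: "?rest ?Es = {}" by blast
  have paths: "path_arcs (fu e) (fw e) (fv e) \<subseteq> parcs G" if "e \<in> ?Es" for e using f[OF that] by blast
  have "?rest ?Es \<union> (\<Union>e\<in>?Es. path_arcs (fu e) (fw e) (fv e)) \<subseteq> parcs G"
    unfolding none by (intro Un_least UN_least paths empty_subsetI)
  with H(3) have arcs: "parcs H \<subseteq> parcs G" by (rule order_trans)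
  have "set (fw e) \<subseteq> pverts G" if "e \<in> ?Es" for e using f[OF that] by blast
  then have verts: "pverts H \<subseteq> pverts G" unfolding H(2) using T(1) by blast
  interpret H: pair_bidirected_digraph H using H(1) by (rule bidirected_digraphI_subdivision)
  have "subgraph (with_proj H) (with_proj G)"
    unfolding subgraph_def using verts arcs by (auto simp: compatibleI_with_proj G.wf_digraph H.wf_digraph)
  then show ?thesis unfolding contains_complete_subdivision_def using K H(1) by blast
qed

section \<open>Counting cliques\<close>

definition cliques_in :: "'a rel \<Rightarrow> 'a set \<Rightarrow> 'a set set" where
  "cliques_in E W = {C. C \<subseteq> W \<and> (\<forall>u\<in>C. \<forall>v\<in>C. u \<noteq> v \<longrightarrow> (u, v) \<in> E)}"

lemma finite_cliques_in: "finite W \<Longrightarrow> finite (cliques_in E W)"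
  unfolding cliques_in_def by (rule finite_subset[of _ "Pow W"]) auto

lemma card_cliques_in_le_power: "finite W \<Longrightarrow> card (cliques_in E W) \<le> 2 ^ card W"
proof -
  assume "finite W"
  then have "card (cliques_in E W) \<le> card (Pow W)" unfolding cliques_in_def by (intro card_mono) auto
  then show ?thesis using \<open>finite W\<close> by (simp add: card_Pow)
qed

lemma card_cliques_in_split:
  assumes "finite W" "v \<in> W"
  shows "card (cliques_in E W) \<le> card (cliques_in E (W - {v})) + card (cliques_in E (W \<inter> E `` {v}))"
proof -
  have "cliques_in E W \<subseteq> cliques_in E (W - {v}) \<union> insert v ` cliques_in E (W \<inter> E `` {v})"
  proof
    fix C assume C: "C \<in> cliques_in E W"
    show "C \<in> cliques_in E (W - {v}) \<union> insert v ` cliques_in E (W \<inter> E `` {v})"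
    proof (cases "v \<in> C")
      case True
      then have "C - {v} \<in> cliques_in E (W \<inter> E `` {v})" using C unfolding cliques_in_def by auto
      moreover have "C = insert v (C - {v})" using True by auto
      ultimately show ?thesis by blast
    next
      case False
      then show ?thesis using C unfolding cliques_in_def by auto
    qed
  qed
  then have "card (cliques_in E W) \<le> card (cliques_in E (W - {v}) \<union> insert v ` cliques_in E (W \<inter> E `` {v}))"
    using assms(1) by (intro card_mono) (simp_all add: finite_cliques_in)
  also have "\<dots> \<le> card (cliques_in E (W - {v})) + card (insert v ` cliques_in E (W \<inter> E `` {v}))"
    by (rule card_Un_le)
  also have "\<dots> \<le> card (cliques_in E (W - {v})) + card (cliques_in E (W \<inter> E `` {v}))"
    using assms(1) by (intro add_left_mono card_image_le finite_cliques_in) auto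
  finally show ?thesis .
qed

text \<open>Removing vertices in degeneracy order, a nonempty clique is charged to the first of its
  vertices to be removed, and the rest of it lies in at most \<open>N\<close> remaining neighbours.
  The summand 1 is the empty clique.\<close>

lemma card_cliques_in_degenerate:
  assumes "finite V"
    and "\<And>W. W \<subseteq> V \<Longrightarrow> W \<noteq> {} \<Longrightarrow> \<exists>v\<in>W. card (W \<inter> E `` {v}) \<le> N"
    and "\<And>W. W \<subseteq> V \<Longrightarrow> card W \<le> N \<Longrightarrow> card (cliques_in E W) \<le> M"
  shows "card (cliques_in E V) \<le> 1 + card V * M"
  using assms
proof (induction "card V" arbitrary: V)
  case 0
  then have "V = {}" by simp
  then show ?case unfolding cliques_in_def by (simp add: subset_singleton_iff[of _ "{}"] Collect_conv_if)
next
  case (Suc n)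
  then have "V \<noteq> {}" by auto
  then obtain v where v: "v \<in> V" "card (V \<inter> E `` {v}) \<le> N" using Suc.prems(2)[of V] by auto
  have n: "n = card (V - {v})" using Suc.hyps(2) Suc.prems(1) v(1) by (metis card_Diff_singleton diff_Suc_1)
  have "card (cliques_in E (V - {v})) \<le> 1 + card (V - {v}) * M"
  proof (rule Suc.hyps(1)[OF n])
    show "finite (V - {v})" using Suc.prems(1) by simp
    show "\<exists>v\<in>W. card (W \<inter> E `` {v}) \<le> N" if "W \<subseteq> V - {v}" "W \<noteq> {}" for W
      using that by (intro Suc.prems(2)) auto
    show "card (cliques_in E W) \<le> M" if "W \<subseteq> V - {v}" "card W \<le> N" for W
      using that by (intro Suc.prems(3)) auto
  qed
  moreover have "card (cliques_in E (V \<inter> E `` {v})) \<le> M" using v by (intro Suc.prems(3)) auto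
  moreover have "card V * M = card (V - {v}) * M + M" using n Suc.hyps(2) by (metis add.commute mult_Suc)
  ultimately show ?case using card_cliques_in_split[OF Suc.prems(1) v(1), of E] by linarith
qed

text \<open>A small set is listed and padded with \<open>None\<close> to length \<open>t\<close>,
  which explains the base \<open>card W + 1\<close>.\<close>

lemma card_bounded_subsets_le:
  assumes "finite W"
  shows "card {C. C \<subseteq> W \<and> card C \<le> t} \<le> (card W + 1) ^ t"
proof -
  let ?A = "insert None (Some ` W)"
  let ?L = "{xs. set xs \<subseteq> ?A \<and> length xs = t}"
  have finL: "finite ?L" using assms by (intro finite_lists_length_eq) auto
  have "{C. C \<subseteq> W \<and> card C \<le> t} \<subseteq> (\<lambda>xs. {a. Some a \<in> set xs}) ` ?L"
  proof
    fix C assume C: "C \<in> {C. C \<subseteq> W \<and> card C \<le> t}"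
    then have "finite C" using assms finite_subset by blast
    then obtain xs where xs: "set xs = C" "distinct xs" using finite_distinct_list by blast
    then have l: "length xs \<le> t" using C distinct_card by fastforce
    let ?ys = "map Some xs @ replicate (t - length xs) None"
    have "{a. Some a \<in> set ?ys} = C" using xs by auto
    moreover have "?ys \<in> ?L" using xs l C by auto
    ultimately show "C \<in> (\<lambda>xs. {a. Some a \<in> set xs}) ` ?L" by blast
  qed
  then have "card {C. C \<subseteq> W \<and> card C \<le> t} \<le> card ?L"
    using finL by (meson card_image_le card_mono finite_imageI le_trans)
  also have "\<dots> = card ?A ^ t" using assms by (intro card_lists_length_eq) auto
  also have "card ?A = card W + 1" using assms by (simp add: card_image)
  finally show ?thesis .
qed

section \<open>Subdivisions of dense graphs by paths of length at most two\<close>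

lemma has_TK_mono:
  assumes "has_TK t W F" "W \<subseteq> V" "F \<subseteq> E"
  shows "has_TK t V E"
proof -
  obtain T C where T: "T \<subseteq> W" "finite T" "card T = t"
    and C: "\<forall>u\<in>T. \<forall>v\<in>T. u \<noteq> v \<longrightarrow> (u, v) \<in> F \<and> C {u, v} = {} \<or>
        C {u, v} \<subseteq> W - T \<and> conn F (C {u, v}) \<and> (\<exists>a\<in>C {u, v}. \<exists>b\<in>C {u, v}. (u, a) \<in> F \<and> (v, b) \<in> F)"
    and Cd: "\<forall>e e'. e \<subseteq> T \<longrightarrow> e' \<subseteq> T \<longrightarrow> card e = 2 \<longrightarrow> card e' = 2 \<longrightarrow> e \<noteq> e' \<longrightarrow> C e \<inter> C e' = {}"
    using assms(1) unfolding has_TK_def by (elim exE conjE) (rule that)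
  have "(u, v) \<in> E \<and> C {u, v} = {} \<or>
      C {u, v} \<subseteq> V - T \<and> conn E (C {u, v}) \<and> (\<exists>a\<in>C {u, v}. \<exists>b\<in>C {u, v}. (u, a) \<in> E \<and> (v, b) \<in> E)"
    if uv: "u \<in> T" "v \<in> T" "u \<noteq> v" for u v
    using C[rule_format, OF uv]
  proof
    assume "(u, v) \<in> F \<and> C {u, v} = {}"
    then show ?thesis using assms(3) by blast
  next
    assume *: "C {u, v} \<subseteq> W - T \<and> conn F (C {u, v}) \<and> (\<exists>a\<in>C {u, v}. \<exists>b\<in>C {u, v}. (u, a) \<in> F \<and> (v, b) \<in> F)"
    then have "conn E (C {u, v})" using assms(3) by (auto intro: conn_mono)
    then show ?thesis using * assms(2,3) by blast
  qed
  then show ?thesis unfolding has_TK_def using T assms(2) Cd by (intro exI[of _ T] exI[of _ C]) simp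
qed

lemma has_TK_clique:
  assumes "C \<in> cliques_in E V" "t \<le> card C" "finite V"
  shows "has_TK t V E"
proof -
  obtain T where T: "T \<subseteq> C" "card T = t" "finite T" using assms(2) by (meson obtain_subset_with_card_n)
  then show ?thesis unfolding has_TK_def using assms(1) unfolding cliques_in_def
    by (intro exI[of _ T] exI[of _ "\<lambda>_. {}"]) auto
qed

text \<open>Deleting a vertex of maximum degree in the graph of non-edges keeps the density of non-edges
  from growing; the squares absorb the difference between \<open>j\<^sup>2\<close> and \<open>j (j - 1)\<close>.\<close>

lemma sparse_subset:
  fixes c :: real and F :: "'a rel"
  assumes W: "finite W" "sym F" "irrefl F" and c: "card (F \<inter> W \<times> W) \<le> c * (real (card W))\<^sup>2" "0 \<le> c" and j: "j \<le> card W"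
  shows "\<exists>T\<subseteq>W. card T = j \<and> card (F \<inter> T \<times> T) \<le> c * (real j)\<^sup>2"
  using j
proof (induction j rule: inc_induct)
  case base
  then show ?case using c by (intro exI[of _ W]) auto
next
  case (step j)
  then obtain T where T: "T \<subseteq> W" "card T = Suc j" "card (F \<inter> T \<times> T) \<le> c * (real (Suc j))\<^sup>2" by auto
  have finT: "finite T" using T(1) W(1) finite_subset by blast
  define a where "a = card (F \<inter> T \<times> T)"
  let ?d = "\<lambda>v. card (T \<inter> F `` {v})"
  have fin: "finite (F \<inter> T \<times> T)" using finT by auto
  have sum: "a = (\<Sum>v\<in>T. ?d v)"
  proof -
    have "Sigma T (\<lambda>v. T \<inter> F `` {v}) = F \<inter> T \<times> T" by auto
    then show ?thesis unfolding a_def using finT card_SigmaI[of T "\<lambda>v. T \<inter> F `` {v}"] by simp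
  qed
  have "T \<noteq> {}" using T(2) by auto
  \<comment> \<open>Some vertex reaches the average \<open>a / (j + 1)\<close> of \<open>?d\<close>;
    as \<open>a\<close> counts ordered pairs, its deletion removes \<open>2 * ?d v\<close> of
    them.\<close>
  have "\<exists>v\<in>T. a \<le> Suc j * ?d v"
  proof (rule ccontr)
    assume "\<not> ?thesis"
    then have "(\<Sum>v\<in>T. Suc j * ?d v) < (\<Sum>v\<in>T. a)" using finT \<open>T \<noteq> {}\<close> by (intro sum_strict_mono) auto
    then have "Suc j * a < Suc j * a" using sum T(2) by (simp only: sum_distrib_left[symmetric] sum_constant of_nat_id)
    then show False by simp
  qed
  then obtain v where v: "v \<in> T" "a \<le> Suc j * ?d v" by auto
  let ?T = "T - {v}"
  have "card (F \<inter> ?T \<times> ?T) + 2 * ?d v \<le> a"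
  proof -
    let ?N = "T \<inter> F `` {v}"
    have vN: "v \<notin> ?N" using W(3) unfolding irrefl_def by auto
    have sub: "(F \<inter> ?T \<times> ?T) \<union> ({v} \<times> ?N \<union> ?N \<times> {v}) \<subseteq> F \<inter> T \<times> T"
    proof -
      have "{v} \<times> ?N \<subseteq> F \<inter> T \<times> T" using v(1) by auto
      moreover have "?N \<times> {v} \<subseteq> F \<inter> T \<times> T" using v(1) W(2) by (auto dest: symD)
      ultimately show ?thesis by auto
    qed
    have "card ((F \<inter> ?T \<times> ?T) \<union> ({v} \<times> ?N \<union> ?N \<times> {v})) = card (F \<inter> ?T \<times> ?T) + card ({v} \<times> ?N \<union> ?N \<times> {v})"
      using finT by (intro card_Un_disjoint) auto
    also have "card ({v} \<times> ?N \<union> ?N \<times> {v}) = card ({v} \<times> ?N) + card (?N \<times> {v})"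
      using finT vN by (intro card_Un_disjoint) auto
    also have "\<dots> = 2 * ?d v" by (simp add: card_cartesian_product)
    finally show ?thesis using card_mono[OF fin sub] unfolding a_def by simp
  qed
  then have "real (card (F \<inter> ?T \<times> ?T)) + 2 * real (?d v) \<le> a" by linarith
  then have "(j + 1) * real (card (F \<inter> ?T \<times> ?T)) + 2 * (real (j + 1) * ?d v) \<le> (j + 1) * real a"
    using mult_left_mono[of "real (card (F \<inter> ?T \<times> ?T)) + 2 * real (?d v)" a "j + 1"] by (simp add: algebra_simps)
  moreover have "real a \<le> real (j + 1) * ?d v"
    using v(2) by (metis Suc_eq_plus1 of_nat_le_iff of_nat_mult)
  ultimately have "(j + 1) * real (card (F \<inter> ?T \<times> ?T)) \<le> (real j - 1) * a" by (simp add: algebra_simps)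
  also have "\<dots> \<le> (j + 1) * (c * (real j)\<^sup>2)"
  \<comment> \<open>Since (j - 1) (j + 1)^2 = (j + 1) (j^2 - 1), the quadratic bound survives the
    step. For \<open>j = 0\<close> the factor \<open>j - 1\<close> is negative and the left side is
    at most 0.\<close>
  proof (cases "j = 0")
    case False
    then have "(real j - 1) * a \<le> (real j - 1) * (c * (real j + 1)\<^sup>2)"
      using T(3) unfolding a_def by (intro mult_left_mono) (auto simp: algebra_simps)
    also have "\<dots> = (j + 1) * (c * (real j ^ 2 - 1))" by (simp add: power2_eq_square algebra_simps)
    also have "\<dots> \<le> (j + 1) * (c * (real j)\<^sup>2)" using c(2) by (intro mult_left_mono) auto
    finally show ?thesis .
  qed (use c in auto)
  finally have "real (card (F \<inter> ?T \<times> ?T)) \<le> c * (real j)\<^sup>2"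
    using mult_le_cancel_left_pos[of "real (j + 1)"] by (simp del: of_nat_add)
  moreover have "card ?T = j" using T(2) v(1) finT by simp
  ultimately show ?case using T(1) by (intro exI[of _ ?T]) auto
qed

text \<open>With m = \<open>card W\<close>, averaging gives \<open>T\<close> with at most (r / m)
  t^2 <= m / 2 non-adjacent pairs. Each pair has at least m - t - 2 r >= 5 m / 8 common neighbours
  outside \<open>T\<close>, so distinct ones can be chosen greedily.\<close>

lemma has_TK_dense:
  fixes r :: real
  assumes sg: "sgraph W E" and large: "8 * t \<le> card W" "1 \<le> t"
    and r: "r \<le> card W / 8" "2 * r * (real t)\<^sup>2 \<le> (real (card W))\<^sup>2" "0 \<le> r"
    and deg: "\<And>v. v \<in> W \<Longrightarrow> card (W - {v} - E `` {v}) \<le> r"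
  shows "has_TK t W E"
proof -
  have finW: "finite W" and symE: "sym E" using sg unfolding sgraph_def by auto
  define m where "m = real (card W)"
  have m8: "8 * real t \<le> m" "0 < m" using large unfolding m_def by linarith+
  define F where "F = (W \<times> W) - E - Id"
  have symF: "sym F" using symE unfolding F_def sym_def by blast
  have irrF: "irrefl F" unfolding F_def irrefl_def by auto
  have "card (F \<inter> W \<times> W) = (\<Sum>v\<in>W. card (W - {v} - E `` {v}))"
  proof -
    have "Sigma W (\<lambda>v. W - {v} - E `` {v}) = F \<inter> W \<times> W" unfolding F_def by auto
    then show ?thesis using finW card_SigmaI[of W "\<lambda>v. W - {v} - E `` {v}"] by simp
  qed
  then have "real (card (F \<inter> W \<times> W)) = (\<Sum>v\<in>W. real (card (W - {v} - E `` {v})))" by simp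
  also have "\<dots> \<le> (\<Sum>v\<in>W. r)" using deg by (intro sum_mono)
  also have "\<dots> = (r / m) * (real (card W))\<^sup>2" using m8 unfolding m_def by (simp add: power2_eq_square)
  finally have sparse: "card (F \<inter> W \<times> W) \<le> (r / m) * (real (card W))\<^sup>2" .
  have "0 \<le> r / m" using r(3) m8 by simp
  moreover have "t \<le> card W" using large by linarith
  ultimately have "\<exists>T\<subseteq>W. card T = t \<and> card (F \<inter> T \<times> T) \<le> (r / m) * (real t)\<^sup>2"
    by (rule sparse_subset[OF finW symF irrF sparse])
  then obtain T where T: "T \<subseteq> W" "card T = t" "card (F \<inter> T \<times> T) \<le> (r / m) * (real t)\<^sup>2"
    by (elim exE conjE) (rule that)
  have finT: "finite T" using T(1) finW finite_subset by blast
  let ?J = "(\<lambda>(u, v). {u, v}) ` (F \<inter> T \<times> T)"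
  have "real (card ?J) \<le> (r / m) * (real t)\<^sup>2"
  proof -
    have "card ?J \<le> card (F \<inter> T \<times> T)" using finT by (intro card_image_le) auto
    then show ?thesis using T(3) by linarith
  qed
  also have "\<dots> = (2 * r * (real t)\<^sup>2) / (2 * m)" by simp
  also have "\<dots> \<le> m\<^sup>2 / (2 * m)" using r(2) m8 unfolding m_def by (intro divide_right_mono) auto
  also have "\<dots> = m / 2" using m8 by (simp add: power2_eq_square)
  finally have cJ: "real (card ?J) \<le> m / 2" .
  let ?A = "\<lambda>e. (W - T) \<inter> {w. \<forall>u\<in>e. (u, w) \<in> E}"
  have cA: "card ?J \<le> card (?A e)" if e: "e \<in> ?J" for e
  proof -
    obtain u v where uv: "e = {u, v}" "u \<in> T" "v \<in> T" using e by auto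
    let ?U = "T \<union> ((W - {u} - E `` {u}) \<union> (W - {v} - E `` {v}))"
    have "W \<subseteq> ?A e \<union> ?U" using uv by auto
    then have "card W \<le> card (?A e \<union> ?U)" using finW finT by (intro card_mono) auto
    also have "\<dots> \<le> card (?A e) + (card T + (card (W - {u} - E `` {u}) + card (W - {v} - E `` {v})))"
      by (intro card_Un_le[THEN order_trans] add_mono order_refl)
    finally have "m \<le> card (?A e) + (t + (real (card (W - {u} - E `` {u})) + card (W - {v} - E `` {v})))"
      unfolding m_def T(2) by linarith
    moreover have "card (W - {u} - E `` {u}) \<le> r" "card (W - {v} - E `` {v}) \<le> r" using uv T(1) deg by blast+
    moreover have "8 * r \<le> m" using r(1) unfolding m_def by simp
    ultimately have "m / 2 \<le> card (?A e)" using m8 by linarith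
    then show ?thesis using cJ by linarith
  qed
  have finJ: "finite ?J" using finT by auto
  have "\<exists>z. inj_on z ?J \<and> (\<forall>e\<in>?J. z e \<in> ?A e)"
    using finJ order_refl cA by (rule distinct_representatives)
  then obtain z where z: "inj_on z ?J" "\<forall>e\<in>?J. z e \<in> ?A e" by (elim exE conjE) (rule that)
  define C where "C e = (if e \<in> ?J then {z e} else {})" for e
  have "(u, v) \<in> E \<and> C {u, v} = {} \<or>
      C {u, v} \<subseteq> W - T \<and> conn E (C {u, v}) \<and> (\<exists>a\<in>C {u, v}. \<exists>b\<in>C {u, v}. (u, a) \<in> E \<and> (v, b) \<in> E)"
    if uv: "u \<in> T" "v \<in> T" "u \<noteq> v" for u v
  proof (cases "{u, v} \<in> ?J")
    case True
    then show ?thesis using bspec[OF z(2) True] unfolding C_def by simp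
  next
    case False
    have "(u, v) \<in> E"
    proof (rule ccontr)
      assume "(u, v) \<notin> E"
      then have "(u, v) \<in> F \<inter> T \<times> T" using uv T(1) unfolding F_def by auto
      then have "{u, v} \<in> ?J" by (intro image_eqI[of _ _ "(u, v)"]) auto
      then show False using False by simp
    qed
    then show ?thesis using False unfolding C_def by simp
  qed
  moreover have "C e \<inter> C e' = {}" if "e \<noteq> e'" for e e'
    using z(1) that unfolding C_def by (auto dest: inj_onD)
  ultimately show ?thesis unfolding has_TK_def using T(1,2) finT
    by (intro exI[of _ T] exI[of _ C]) simp
qed

section \<open>Solving the recursion for the number of cliques\<close>

lemma exp_neg_le:
  fixes x :: real
  assumes "0 \<le> x" "x \<le> 1"
  shows "exp (- x) \<le> 1 - x / 2"
proof -
  have "1 \<le> (1 + x) * (1 - x / 2)" using assms mult_mono[of x 1 x x] by (simp add: algebra_simps)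
  also have "\<dots> \<le> exp x * (1 - x / 2)" using assms exp_ge_add_one_self[of x] by (intro mult_right_mono) auto
  finally show ?thesis by (simp add: exp_minus field_simps)
qed

text \<open>The cube root of the claim, \<open>u \<le> exp (2 * u / 3)\<close>, already follows from
  the quadratic Taylor polynomial.\<close>

lemma cube_le_exp:
  fixes u :: real
  assumes "0 \<le> u"
  shows "u ^ 3 \<le> exp (2 * u)"
proof -
  have "0 \<le> (u - 3 / 4)\<^sup>2" by simp
  then have "u \<le> 1 + 2 * u / 3 + (2 * u / 3)\<^sup>2 / 2" by (simp add: power2_eq_square algebra_simps)
  also have "\<dots> \<le> exp (2 * u / 3)" using assms by (intro exp_lower_Taylor_quadratic) auto
  finally have "u ^ 3 \<le> exp (2 * u / 3) ^ 3" using assms by (intro power_mono)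
  also have "\<dots> = exp (2 * u)" by (simp add: exp_of_nat_mult[symmetric])
  finally show ?thesis .
qed

text \<open>One branch loses a single vertex and gains \<open>2 / u ^ 3\<close>, which frees the
  share \<open>1 / u ^ 3\<close> of \<open>exp c\<close>. The other loses \<open>k\<close> vertices,
  gains at least \<open>2 * u\<close>, and fits into that share by \<open>cube_le_exp\<close>. A
  gain per vertex of order (ln k) / k would be the natural rate; the power -3/4 of k is larger but
  integrates to roots.\<close>

lemma exp_recursion:
  fixes a b c u k :: real
  assumes u: "2 \<le> u" "u ^ 4 \<le> k" and ab: "2 / u ^ 3 \<le> c - a" "k * (2 / u ^ 3) \<le> c - b"
  shows "exp a + exp b \<le> exp c"
proof -
  let ?x = "2 / u ^ 3"
  have u3: "8 \<le> u ^ 3" using power_mono[OF u(1), of 3] by simp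
  then have x: "0 \<le> ?x" "?x \<le> 1" using u(1) by (simp_all add: divide_le_eq)
  have "exp a \<le> exp c * exp (- ?x)" using ab(1) by (simp add: exp_add[symmetric])
  also have "\<dots> \<le> exp c * (1 - ?x / 2)" using exp_neg_le[OF x] by (intro mult_left_mono) auto
  finally have 1: "exp a \<le> exp c * (1 - 1 / u ^ 3)" by simp
  have "2 * u = u ^ 4 * ?x" using u by (simp add: field_simps power_numeral_reduce)
  also have "\<dots> \<le> k * ?x" using u(2) x(1) by (rule mult_right_mono)
  finally have "exp b \<le> exp c * exp (- (2 * u))" using ab(2) by (simp add: exp_add[symmetric])
  also have "exp (- (2 * u)) \<le> 1 / u ^ 3"
    using cube_le_exp[of u] u u3 by (simp add: exp_minus field_simps)
  finally have "exp b \<le> exp c * (1 / u ^ 3)" by simp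
  with 1 show ?thesis by (simp add: algebra_simps)
qed

text \<open>The derivative of this function dominates \<open>2 r\<^sup>-\<^sup>3\<^sup>/\<^sup>4\<close> for \<open>r = min (m / 8) (m\<^sup>2 / (2 t\<^sup>2))\<close>:
  the square root takes care of the second argument of the minimum, the fourth root of the first.\<close>

definition clique_exponent :: "real \<Rightarrow> real \<Rightarrow> real" where
  "clique_exponent t m = 12 * t - 7 * t * sqrt (t / m) + 40 * sqrt (sqrt m)"

lemma sqrt_sqrt_pow4: "0 \<le> m \<Longrightarrow> sqrt (sqrt m) ^ 4 = m"
proof -
  assume "0 \<le> m"
  have "sqrt (sqrt m) ^ 4 = ((sqrt (sqrt m))\<^sup>2)\<^sup>2" by (simp flip: power_mult)
  then show ?thesis using \<open>0 \<le> m\<close> by simp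
qed

text \<open>Concavity in difference form: the left side is \<open>s\<close> times the derivative of
  the fourth root at \<open>m\<close>. The next lemma does the same for the negative inverse square
  root.\<close>

lemma sqrt_sqrt_increment:
  fixes s m :: real
  assumes "0 \<le> s" "s < m"
  shows "s / (4 * sqrt (sqrt m) ^ 3) \<le> sqrt (sqrt m) - sqrt (sqrt (m - s))"
proof -
  let ?a = "sqrt (sqrt m)" let ?b = "sqrt (sqrt (m - s))"
  have b: "0 \<le> ?b" "?b \<le> ?a" "0 < ?a" using assms by auto
  have "?a ^ 4 = m" "?b ^ 4 = m - s" using assms by (simp_all add: sqrt_sqrt_pow4)
  then have "s = ?a ^ 4 - ?b ^ 4" by simp
  also have "\<dots> = (?a - ?b) * ((?a + ?b) * (?a\<^sup>2 + ?b\<^sup>2))" by (simp add: power4_eq_xxxx power2_eq_square algebra_simps)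
  also have "\<dots> \<le> (?a - ?b) * ((2 * ?a) * (2 * ?a\<^sup>2))"
    using b by (intro mult_left_mono mult_mono) (auto intro!: power_mono simp del: real_sqrt_pow2 real_sqrt_power)
  also have "\<dots> = (?a - ?b) * (4 * ?a ^ 3)" by (simp add: power2_eq_square power3_eq_cube)
  finally show ?thesis using b(3) by (simp add: field_simps)
qed

lemma inverse_sqrt_increment:
  fixes s m :: real
  assumes "0 \<le> s" "s < m"
  shows "s / (2 * sqrt m ^ 3) \<le> 1 / sqrt (m - s) - 1 / sqrt m"
proof -
  let ?a = "sqrt m" let ?b = "sqrt (m - s)"
  have b: "0 < ?b" "?b \<le> ?a" "0 < ?a" using assms by auto
  have "?a ^ 2 = m" "?b ^ 2 = m - s" using assms by simp_all
  then have s: "s = (?a - ?b) * (?a + ?b)" by (simp add: power2_eq_square algebra_simps)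
  have "s / (2 * ?a ^ 3) = (?a - ?b) * ((?a + ?b) / (2 * ?a ^ 3))" using s by (metis times_divide_eq_right)
  also have "\<dots> \<le> (?a - ?b) * (1 / (?a * ?b))"
  proof (rule mult_left_mono)
    have "(?a + ?b) * (?a * ?b) \<le> (2 * ?a) * (?a * ?a)" using b by (intro mult_mono) auto
    then show "(?a + ?b) / (2 * ?a ^ 3) \<le> 1 / (?a * ?b)" using b by (simp add: field_simps power3_eq_cube)
  qed (use b in auto)
  also have "\<dots> = 1 / ?b - 1 / ?a" using b by (simp add: field_simps)
  finally show ?thesis .
qed

lemma pow4_le_imp_le: "a ^ 4 \<le> b ^ 4 \<Longrightarrow> 0 \<le> b \<Longrightarrow> a \<le> b" for a b :: real
  by (metis linorder_not_less power_strict_mono zero_less_numeral)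

text \<open>Both increments are nonnegative, and the one that belongs to the smaller argument of the
  minimum suffices. For \<open>m / 8\<close> the numbers are 8 < 1.7^4 and 1.7^3 < 5 = 40 / (4 * 2);
  for the other argument they are 2 < 1.2^4 and 1.2^3 < 7 / (2 * 2). Hence the coefficients 40 and
  7.\<close>

lemma clique_exponent_increment:
  fixes t m s u :: real
  assumes t: "0 < t" and s: "0 \<le> s" "s < m" and u: "0 < u" "u ^ 4 = min (m / 8) (m\<^sup>2 / (2 * t\<^sup>2))"
  shows "s * (2 / u ^ 3) \<le> clique_exponent t m - clique_exponent t (m - s)"
proof -
  let ?a = "sqrt m" let ?c = "sqrt t" let ?q = "sqrt (sqrt m)"
  have pos: "0 < ?a" "0 < ?c" "0 < ?q" "0 < m" using t s by auto
  have eq: "clique_exponent t m - clique_exponent t (m - s) =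
      7 * ?c ^ 3 * (1 / sqrt (m - s) - 1 / ?a) + 40 * (?q - sqrt (sqrt (m - s)))"
  proof -
    have c3: "t * ?c = ?c ^ 3" using t by (simp add: power3_eq_cube)
    have root: "7 * t * sqrt (t / x) = 7 * ?c ^ 3 * (1 / sqrt x)" for x
    proof -
      have "7 * t * sqrt (t / x) = 7 * (t * ?c) * (1 / sqrt x)" by (simp add: real_sqrt_divide)
      then show ?thesis by (simp only: c3)
    qed
    show ?thesis unfolding clique_exponent_def root by (simp add: algebra_simps)
  qed
  have i1: "7 * ?c ^ 3 * (s / (2 * ?a ^ 3)) \<le> 7 * ?c ^ 3 * (1 / sqrt (m - s) - 1 / ?a)"
    using inverse_sqrt_increment[OF s] pos by (intro mult_left_mono) auto
  have i2: "40 * (s / (4 * ?q ^ 3)) \<le> 40 * (?q - sqrt (sqrt (m - s)))"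
    using sqrt_sqrt_increment[OF s] by simp
  have nn: "0 \<le> 7 * ?c ^ 3 * (s / (2 * ?a ^ 3))" "0 \<le> 40 * (s / (4 * ?q ^ 3))" using pos s by auto
  show ?thesis
  proof (cases "m / 8 \<le> m\<^sup>2 / (2 * t\<^sup>2)")
    case True
    have "?q ^ 4 = m" using pos by (simp add: sqrt_sqrt_pow4)
    also have "m = 8 * u ^ 4" using u(2) True by simp
    also have "\<dots> \<le> (1.7 * u) ^ 4" unfolding power_mult_distrib by (intro mult_right_mono) (simp_all add: power_divide)
    finally have "?q \<le> 1.7 * u" by (rule pow4_le_imp_le) (use u pos in simp)
    then have "?q ^ 3 \<le> (1.7 * u) ^ 3" using pos by (intro power_mono) auto
    also have "\<dots> \<le> 5 * u ^ 3" unfolding power_mult_distrib using u by (intro mult_right_mono) (auto simp: power3_eq_cube)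
    finally have "s * (2 / u ^ 3) \<le> 40 * (s / (4 * ?q ^ 3))"
      using s u pos mult_left_mono[of "?q ^ 3" "5 * u ^ 3" s] by (simp add: field_simps)
    then show ?thesis using eq i1 i2 nn by linarith
  next
    case False
    then have "u ^ 4 = m\<^sup>2 / (2 * t\<^sup>2)" using u(2) by simp
    then have "m\<^sup>2 = 2 * u ^ 4 * t\<^sup>2" using t by (simp add: field_simps)
    moreover have "?a ^ 4 = m\<^sup>2" "?c ^ 4 = t\<^sup>2" using pos t by (simp_all add: power4_eq_xxxx power2_eq_square)
    ultimately have "?a ^ 4 = 2 * (u * ?c) ^ 4" by (simp add: power_mult_distrib)
    also have "\<dots> \<le> (1.2 * (u * ?c)) ^ 4" unfolding power_mult_distrib[of "1.2"] by (intro mult_right_mono) (simp_all add: power_divide)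
    finally have "?a \<le> 1.2 * (u * ?c)" by (rule pow4_le_imp_le) (use u pos in simp)
    then have "?a ^ 3 \<le> (1.2 * (u * ?c)) ^ 3" using pos by (intro power_mono) auto
    also have "\<dots> = (1.2 ^ 3) * (u ^ 3 * ?c ^ 3)" by (simp only: power_mult_distrib)
    also have "\<dots> \<le> (7 / 4) * (u ^ 3 * ?c ^ 3)" using u pos by (intro mult_right_mono) (auto simp: power3_eq_cube)
    finally have "4 * ?a ^ 3 \<le> 7 * (u ^ 3 * ?c ^ 3)" by simp
    then have "s * (2 / u ^ 3) \<le> 7 * ?c ^ 3 * (s / (2 * ?a ^ 3))"
      using s u pos mult_left_mono[of "4 * ?a ^ 3" "7 * (u ^ 3 * ?c ^ 3)" s] by (simp add: field_simps)
    then show ?thesis using eq i1 i2 nn by linarith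
  qed
qed

text \<open>The induction runs over the bound \<open>m\<close> because a neighbourhood may have
  fewer than \<open>m - k\<close> vertices. Beyond \<open>8 * t\<close> a step takes away at most
  half of \<open>m\<close>, so \<open>4 * t \<le> m\<close> persists; up to \<open>8 * t\<close> all
  subsets are counted.\<close>

lemma card_cliques_in_le_exp:
  assumes sg: "sgraph V E" and no: "\<not> has_TK t V E" and t: "16 \<le> t"
    and W: "W \<subseteq> V" "card W \<le> m" "4 * t \<le> m"
  shows "card (cliques_in E W) \<le> exp (clique_exponent t m)"
  using W
proof (induction m arbitrary: W rule: less_induct)
  case (less m)
  have finW: "finite W" using less.prems(1) sg finite_subset unfolding sgraph_def by blast
  show ?case
  proof (cases "m \<le> 8 * t")
    case True
    have "card (cliques_in E W) \<le> 2 ^ card W" using finW by (rule card_cliques_in_le_power)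
    also have "\<dots> \<le> 2 ^ (8 * t)" using True less.prems by (intro power_increasing) auto
    finally have "real (card (cliques_in E W)) \<le> 2 ^ (8 * t)"
      by (metis of_nat_le_iff of_nat_numeral of_nat_power)
    also have "\<dots> \<le> exp 1 ^ (8 * t)" using exp_ge_add_one_self[of 1] by (intro power_mono) auto
    also have "\<dots> = exp (8 * t)" by (simp add: exp_of_nat_mult[symmetric])
    also have "exp (real (8 * t)) \<le> exp (clique_exponent t m)"
    proof -
      \<comment> \<open>For \<open>m \<ge> 4 * t\<close> the negative summand costs at most 7 t / 2,
        and the leading \<open>12 * t\<close> still leaves more than \<open>8 * t\<close>.\<close>
      have "real t / m \<le> 1 / 4" using less.prems(3) t by (simp add: field_simps)
      then have "sqrt (t / m) \<le> sqrt (1 / 4)" by simp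
      also have "\<dots> = 1 / 2" by (simp add: real_sqrt_divide)
      finally have "7 * real t * sqrt (t / m) \<le> 7 * real t * (1 / 2)" by (intro mult_left_mono) auto
      moreover have "0 \<le> 40 * sqrt (sqrt (real m))" by simp
      ultimately have "8 * real t \<le> clique_exponent t m" unfolding clique_exponent_def by linarith
      then show ?thesis by simp
    qed
    finally show ?thesis .
  next
    case False
    define r where "r = min (real m / 8) ((real m)\<^sup>2 / (2 * (real t)\<^sup>2))"
    define u where "u = sqrt (sqrt r)"
    have m: "8 * real t < m" using False by linarith
    \<comment> \<open>The assumption \<open>16 \<le> t\<close> enters through m / 8 > t; the bound
      yields \<open>2 \<le> u\<close>, which \<open>exp_recursion\<close> demands.\<close>
    have r16: "16 \<le> r"
    proof -
      have "(8 * real t)\<^sup>2 \<le> (real m)\<^sup>2" using m by (intro power_mono) auto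
      then have "64 * (real t)\<^sup>2 \<le> (real m)\<^sup>2" unfolding power_mult_distrib by simp
      then have "32 * (real t)\<^sup>2 \<le> (real m)\<^sup>2" using zero_le_power2[of "real t"] by linarith
      then have "16 \<le> (real m)\<^sup>2 / (2 * (real t)\<^sup>2)" using t by (simp add: le_divide_eq)
      then show ?thesis using m t unfolding r_def by auto
    qed
    have u4: "u ^ 4 = r" unfolding u_def using r16 by (simp add: sqrt_sqrt_pow4)
    have u2: "2 \<le> u"
    proof (rule pow4_le_imp_le)
      show "2 ^ 4 \<le> u ^ 4" using r16 u4 by simp
    qed (use r16 in \<open>simp add: u_def\<close>)
    define k where "k = nat \<lceil>r\<rceil>"
    have k: "r \<le> k" "real k < r + 1" "1 \<le> k" unfolding k_def using r16 by linarith+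
    have "real k < m / 8 + 1" using k(2) unfolding r_def by linarith
    then have km: "2 * k \<le> m" using m t by linarith
    have inc: "s * (2 / u ^ 3) \<le> clique_exponent t m - clique_exponent t (real m - s)" if "0 \<le> s" "s < m" for s :: real
      using that t u2 u4 unfolding r_def by (intro clique_exponent_increment) auto
    have step: "exp (clique_exponent t (real m - 1)) + exp (clique_exponent t (real m - real k)) \<le> exp (clique_exponent t m)"
      using inc[of 1] inc[of k] m t km k(1,3) u4 by (intro exp_recursion[OF u2, of k]) auto
    have rm: "real (m - 1) = real m - 1" "real (m - k) = real m - real k" using m t km by auto
    show ?thesis
    proof (cases "card W < m")
      case True
      then have "card (cliques_in E W) \<le> exp (clique_exponent t (real m - 1))"
        using less.IH[of "m - 1" W] less.prems False rm t by auto
      also have "\<dots> \<le> exp (clique_exponent t m)" using step exp_gt_zero[of "clique_exponent t (real m - real k)"] by linarith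
      finally show ?thesis .
    next
      case eq: False
      then have cW: "card W = m" using less.prems by simp
      have sgW: "sgraph W (E \<inter> W \<times> W)" using sg less.prems(1) by (rule sgraph_induced)
      have "\<exists>v\<in>W. r < card (W - {v} - E `` {v})"
      proof (rule ccontr)
        assume "\<not> ?thesis"
        then have "\<And>v. v \<in> W \<Longrightarrow> card (W - {v} - (E \<inter> W \<times> W) `` {v}) \<le> r"
        proof -
          fix v assume v: "v \<in> W"
          then have "W - {v} - (E \<inter> W \<times> W) `` {v} = W - {v} - E `` {v}" by auto
          then show "card (W - {v} - (E \<inter> W \<times> W) `` {v}) \<le> r" using \<open>\<not> (\<exists>v\<in>W. r < card (W - {v} - E `` {v}))\<close> v by auto
        qed
        moreover have "2 * r * (real t)\<^sup>2 \<le> (real m)\<^sup>2"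
        proof -
          have "r \<le> (real m)\<^sup>2 / (2 * (real t)\<^sup>2)" unfolding r_def by simp
          then show ?thesis using t by (simp add: field_simps)
        qed
        ultimately have "has_TK t W (E \<inter> W \<times> W)"
          using False t r16 unfolding r_def[symmetric] cW[symmetric]
          by (intro has_TK_dense[OF sgW, where r = r]) (auto simp: cW r_def)
        then have "has_TK t V E" using less.prems(1) by (rule has_TK_mono) auto
        then show False using no by simp
      qed
      then obtain v where v: "v \<in> W" "r < card (W - {v} - E `` {v})" by auto
      have "k \<le> card (W - {v} - E `` {v})" unfolding k_def using v(2) by linarith
      moreover have "W \<inter> E `` {v} \<subseteq> W - (W - {v} - E `` {v})" by auto
      then have "card (W \<inter> E `` {v}) \<le> card (W - (W - {v} - E `` {v}))" using finW by (intro card_mono) auto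
      moreover have "card (W - (W - {v} - E `` {v})) = card W - card (W - {v} - E `` {v})"
        using finW by (intro card_Diff_subset) auto
      ultimately have c2: "card (W \<inter> E `` {v}) \<le> m - k" using cW by linarith
      have c1: "card (W - {v}) \<le> m - 1" using cW v(1) finW by simp
      have "real (card (cliques_in E (W - {v}))) \<le> exp (clique_exponent t (real m - 1))"
        proof -
        have "W - {v} \<subseteq> V" "4 * t \<le> m - 1" "m - 1 < m" using less.prems(1) False t by auto
        then show ?thesis using less.IH[of "m - 1" "W - {v}"] c1 rm(1) by simp
      qed
      moreover have "real (card (cliques_in E (W \<inter> E `` {v}))) \<le> exp (clique_exponent t (real m - real k))"
        proof -
        have "W \<inter> E `` {v} \<subseteq> V" "4 * t \<le> m - k" "m - k < m" using less.prems(1) False km k(3) t by auto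
        then show ?thesis using less.IH[of "m - k" "W \<inter> E `` {v}"] c2 rm(2) by simp
      qed
      moreover have "real (card (cliques_in E W)) \<le> card (cliques_in E (W - {v})) + card (cliques_in E (W \<inter> E `` {v}))"
        using card_cliques_in_split[OF finW v(1), of E] by linarith
      ultimately show ?thesis using step by linarith
    qed
  qed
qed

text \<open>For \<open>t < 2 ^ 15\<close> the crude count of sets with at most \<open>t\<close>
  elements stays below \<open>(2 ^ 48) ^ t\<close>. For larger \<open>t\<close> the fourth root
  contributes at most 160 sqrt t, which is at most t because 160^2 = 25600 < 2^15; then exp (13 t)
  <= 4^(13 t) = 2^(26 t).\<close>

lemma card_cliques_in_small:
  assumes sg: "sgraph V E" and no: "\<not> has_TK t V E" and t: "1 \<le> t" and W: "W \<subseteq> V" "card W \<le> 198 * t\<^sup>2"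
  shows "card (cliques_in E W) \<le> 2 ^ (48 * t)"
proof (cases "t < 2 ^ 15")
  case True
  have finV: "finite V" using sg unfolding sgraph_def by auto
  then have finW: "finite W" using W finite_subset by blast
  have "cliques_in E W \<subseteq> {C. C \<subseteq> W \<and> card C \<le> t}"
  proof
    fix C assume C: "C \<in> cliques_in E W"
    then have "C \<in> cliques_in E V" using W(1) unfolding cliques_in_def by auto
    then have "\<not> t \<le> card C" using has_TK_clique[OF _ _ finV] no by blast
    then show "C \<in> {C. C \<subseteq> W \<and> card C \<le> t}" using C unfolding cliques_in_def by auto
  qed
  then have "card (cliques_in E W) \<le> card {C. C \<subseteq> W \<and> card C \<le> t}"
    using finW by (intro card_mono) auto
  also have "\<dots> \<le> (card W + 1) ^ t" using finW by (rule card_bounded_subsets_le)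
  also have "\<dots> \<le> (2 ^ 48) ^ t"
  proof (rule power_mono)
    have "t\<^sup>2 \<le> (2 ^ 15)\<^sup>2" using True by (intro power_mono) auto
    then show "card W + 1 \<le> 2 ^ 48" using W(2) by simp
  qed simp
  also have "\<dots> = 2 ^ (48 * t)" by (simp add: power_mult)
  finally show ?thesis .
next
  case False
  define m where "m = 198 * t\<^sup>2"
  have "t \<le> t\<^sup>2" using t by (simp add: power2_eq_square)
  then have m4: "4 * t \<le> m" unfolding m_def by linarith
  have big: "32768 \<le> real t" using False by simp
  have "real (card (cliques_in E W)) \<le> exp (clique_exponent t m)"
    using sg no _ W(1) _ m4 by (rule card_cliques_in_le_exp) (use False W(2) m_def in auto)
  also have "\<dots> \<le> exp (13 * real t)"
  proof -
    have "real m \<le> (256 * t\<^sup>2)" unfolding m_def by simp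
    then have "sqrt (sqrt (real m)) \<le> sqrt (sqrt ((16 * real t)\<^sup>2))"
      by (intro real_sqrt_le_mono) (simp add: power2_eq_square)
    also have "\<dots> = sqrt (16 * t)" by (subst real_sqrt_abs) simp
    also have "\<dots> = 4 * sqrt t" by (simp add: real_sqrt_mult)
    finally have "40 * sqrt (sqrt (real m)) \<le> 160 * sqrt t" by linarith
    also have "160 \<le> sqrt (real t)" using big by (intro real_le_rsqrt) simp
    then have "160 * sqrt t \<le> sqrt t * sqrt t" by (intro mult_right_mono) auto
    also have "\<dots> = t" by simp
    finally have "40 * sqrt (sqrt (real m)) \<le> t" .
    moreover have "0 \<le> 7 * real t * sqrt (t / m)" by simp
    ultimately have "clique_exponent t m \<le> 13 * t" unfolding clique_exponent_def by linarith
    then show ?thesis by simp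
  qed
  also have "exp (13 * real t) = exp 1 ^ (13 * t)" by (simp add: exp_of_nat_mult[symmetric])
  also have "\<dots> \<le> 4 ^ (13 * t)" using exp_le by (intro power_mono) auto
  also have "(4::real) ^ (13 * t) = 2 ^ (26 * t)"
    using power_mult[of "2::real" 2 "13 * t"] by simp
  also have "\<dots> \<le> 2 ^ (48 * t)" by (intro power_increasing) auto
  finally have "real (card (cliques_in E W)) \<le> real (2 ^ (48 * t))" by simp
  then show ?thesis by (simp only: of_nat_le_iff)
qed

lemma card_cliques_in_bound:
  assumes sg: "sgraph V E" and no: "\<not> has_TK t V E" and t: "1 \<le> t" and ne: "V \<noteq> {}"
  shows "card (cliques_in E V) \<le> 2 ^ (50 * t) * card V"
proof -
  have finV: "finite V" using sg unfolding sgraph_def by auto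
  have "card (cliques_in E V) \<le> 1 + card V * 2 ^ (48 * t)"
  proof (rule card_cliques_in_degenerate[OF finV])
    fix W assume W: "W \<subseteq> V" "W \<noteq> {}"
    show "\<exists>v\<in>W. card (W \<inter> E `` {v}) \<le> 198 * t\<^sup>2"
    proof (rule ccontr)
      assume *: "\<not> ?thesis"
      have "has_TK t W (E \<inter> W \<times> W)"
      proof (rule has_TK_of_min_degree[OF sgraph_induced[OF sg W(1)] W(2) t])
        fix v assume v: "v \<in> W"
        then have "(E \<inter> W \<times> W) `` {v} = W \<inter> E `` {v}" by auto
        then show "198 * t\<^sup>2 \<le> card ((E \<inter> W \<times> W) `` {v})" using * v by auto
      qed
      then have "has_TK t V E" using W(1) by (rule has_TK_mono) auto
      then show False using no by simp
    qed
  qed (use card_cliques_in_small[OF sg no t] in auto)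
  \<comment> \<open>The summand 1 for the empty clique costs one factor 2, and
    \<open>48 * t + 1 \<le> 50 * t\<close>.\<close>
  also have "\<dots> \<le> card V * 2 ^ (48 * t) + card V * 2 ^ (48 * t)"
  proof -
    have "1 \<le> card V * 2 ^ (48 * t)" using ne finV by (simp add: Suc_le_eq card_gt_0_iff)
    then show ?thesis by simp
  qed
  also have "\<dots> = card V * 2 ^ (48 * t + 1)" by simp
  also have "\<dots> \<le> card V * 2 ^ (50 * t)" using t by (intro mult_le_mono2 power_increasing) auto
  finally show ?thesis by (simp add: mult.commute)
qed

theorem theorem1:
  fixes G :: "'a pair_pre_digraph" and t n :: nat
  assumes "t \<ge> 1" and "n \<ge> 1"
    and "pair_graph G"
    and "card (pverts G) = n"
    and "\<not> contains_complete_subdivision t G"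
  shows "card (cliques G) \<le> 2 ^ (50 * t) * n"
proof -
  interpret G: pair_graph G by fact
  have "sym (parcs G)" using G.arcs_symmetric by (auto intro: symI)
  moreover have "irrefl (parcs G)" using G.adj_not_same by (auto simp: irrefl_def)
  moreover have "parcs G \<subseteq> pverts G \<times> pverts G" using G.wellformed' by auto
  ultimately have "sgraph (pverts G) (parcs G)" unfolding sgraph_def using G.pair_finite_verts by simp
  moreover have "\<not> has_TK t (pverts G) (parcs G)"
    using contains_complete_subdivision_of_has_TK[OF assms(3)] assms(5) by blast
  moreover have "pverts G \<noteq> {}" using assms(2,4) by auto
  ultimately have "card (cliques_in (parcs G) (pverts G)) \<le> 2 ^ (50 * t) * card (pverts G)"
    using assms(1) by (intro card_cliques_in_bound)
  then show ?thesis using assms(4) unfolding cliques_def cliques_in_def by simp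
qed

end
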